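(* Let $N\ge 2$ and let $\mathcal M$ be an $N$-fold strict monoidal category. Then the $N$-fold reduced bar construction $\overline W\mathcal M$, together with the natural transformations $\omega$, is a lax functor from $(\Delta^{op})^N$ to $Cat$; that is, for all arrows $e_1,e_2,e_3$ of $(\Delta^{op})^N$ such that $e_3\circ e_2\circ e_1$ is defined, the following equality of natural transformations $\overline W\mathcal M(e_3)\circ\overline W\mathcal M(e_2)\circ\overline W\mathcal M(e_1)\to\overline W\mathcal M(e_3\circ e_2\circ e_1)$ holds: $$\omega_{e_3\circ e_2,\,e_1}\circ\big(\omega_{e_3,e_2}\,\overline W\mathcal M(e_1)\big)=\omega_{e_3,\,e_2\circ e_1}\circ\big(\overline W\mathcal M(e_3)\,\omega_{e_2,e_1}\big).$$
   Context: **$N$-fold strict monoidal category.** A category $\mathcal M$ with $N$ strict monoidal structures $(\otimes_k,I_k)$, $1\le k\le N$, and, for all $1\le k<l\le N$, arrows $\kappa_{k,l}:I_k\to I_l$, $\beta_{k,l}:I_k\to I_k\otimes_l I_k$, $\tau_{k,l}:I_l\otimes_k I_l\to I_l$ and a natural transformation $\iota^{k,l}_{A,B,C,D}:(A\otimes_l B)\otimes_k(C\otimes_l D)\to(A\otimes_k C)\otimes_l(B\otimes_k D)$, such that (a) for all $k<l$, omitting the indices $k,l$ on $\kappa,\beta,\tau,\iota$: (1) $\iota_{A,D,B\otimes_kC,E\otimes_kF}\circ(\mathbf 1\otimes_k\iota_{B,E,C,F})=\iota_{A\otimes_kB,D\otimes_kE,C,F}\circ(\iota_{A,D,B,E}\otimes_k\mathbf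 1)$; (2) $\iota_{A,B,I_k,I_k}\circ(\mathbf 1\otimes_k\beta)=\mathbf 1$; (3) $\iota_{I_k,I_k,A,B}\circ(\beta\otimes_k\mathbf 1)=\mathbf 1$; (4) $\tau\circ(\mathbf 1\otimes_k\tau)=\tau\circ(\tau\otimes_k\mathbf 1)$; (5) $\tau\circ(\mathbf 1\otimes_k\kappa)=\mathbf 1$; (6) $\tau\circ(\kappa\otimes_k\mathbf 1)=\mathbf 1$; (7) $(\mathbf 1\otimes_l\iota_{B,C,E,F})\circ\iota_{A,B\otimes_lC,D,E\otimes_lF}=(\iota_{A,B,D,E}\otimes_l\mathbf 1)\circ\iota_{A\otimes_lB,C,D\otimes_lE,F}$; (8) $(\mathbf 1\otimes_l\tau)\circ\iota_{A,I_l,B,I_l}=\mathbf 1$; (9) $(\tau\otimes_l\mathbf 1)\circ\iota_{I_l,A,I_l,B}=\mathbf 1$; (10) $(\mathbf 1\otimes_l\beta)\circ\beta=(\beta\otimes_l\mathbf 1)\circ\beta$; (11) $(\mathbf 1\otimes_l\kappa)\circ\beta=\mathbf 1$; (12) $(\kappa\otimes_l\mathbf 1)\circ\beta=\mathbf 1$; and (b) for all $a<b<c$ (a vacuous condition if $N=2$; unspecified components of $\iota$ are at the evident unit objects): (13) $\kappa_{b,c}\circ\kappa_{a,b}=\kappa_{a,c}$; (14) $\beta_{b,c}\circ\kappa_{a,b}=(\kappa_{a,b}\otimes_c\kappa_{a,b})\circ\beta_{a,c}$; (15) $\tau_{b,c}\circ(\kappa_{a,c}\otimes_b\kappa_{a,c})\circ\beta_{a,b}=\kappa_{a,c}$;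 (16) $\iota^{b,c}\circ(\beta_{a,c}\otimes_b\beta_{a,c})\circ\beta_{a,b}=(\beta_{a,b}\otimes_c\beta_{a,b})\circ\beta_{a,c}$; (17) $\kappa_{b,c}\circ\tau_{a,b}=\tau_{a,c}\circ(\kappa_{b,c}\otimes_a\kappa_{b,c})$; (18) $\beta_{b,c}\circ\tau_{a,b}=(\tau_{a,b}\otimes_c\tau_{a,b})\circ\iota^{a,c}\circ(\beta_{b,c}\otimes_a\beta_{b,c})$; (19) $\tau_{b,c}\circ(\tau_{a,c}\otimes_b\tau_{a,c})\circ\iota^{a,b}=\tau_{a,c}\circ(\tau_{b,c}\otimes_a\tau_{b,c})$; (20) $\iota^{b,c}_{A\otimes_aE,B\otimes_aF,C\otimes_aG,D\otimes_aH}\circ(\iota^{a,c}_{A,B,E,F}\otimes_b\iota^{a,c}_{C,D,G,H})\circ\iota^{a,b}_{A\otimes_cB,C\otimes_cD,E\otimes_cF,G\otimes_cH}=(\iota^{a,b}_{A,C,E,G}\otimes_c\iota^{a,b}_{B,D,F,H})\circ\iota^{a,c}_{A\otimes_bC,B\otimes_bD,E\otimes_bG,F\otimes_bH}\circ(\iota^{b,c}_{A,B,C,D}\otimes_a\iota^{b,c}_{E,F,G,H})$. **The category $\Delta^{op}$.** $\Delta$ is the simplicial category of nonempty finite ordinals, with objects written $0,1,2,\dots$ (geometric dimension). In $\Delta^{op}$, $d^n_i:n\to n-1$ ($n\ge1$, $0\le i\le n$) and $s^n_i:n-1\to n$ ($n\ge1$, $0\le i\le n-1$) are the opposites of the standard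 coface and codegeneracy maps. The arrows $\mathbf 1_n,d^n_i,s^n_i$ are called basic. Every arrow $f$ has a unique representation $f^{\rm nf}$ (its normal form) of the form $\mathbf 1$ or $s_{l_1}\circ\dots\circ s_{l_k}\circ d_{j_1}\circ\dots\circ d_{j_m}$ (superscripts omitted) with $k+m\ge1$, $l_1>\dots>l_k$ and $j_1\ge\dots\ge j_m$. **Reduced bar construction.** For a strict monoidal category $(\mathcal C,\otimes,I)$ it is the functor $\overline W\mathcal C:\Delta^{op}\to Cat$ with $\overline W\mathcal C(n)=\mathcal C^n$; $\overline W\mathcal C(d^n_0)$ and $\overline W\mathcal C(d^n_n)$ delete the first, respectively last, coordinate; for $1\le i\le n-1$, $\overline W\mathcal C(d^n_i)(A_1,\dots,A_n)=(A_1,\dots,A_i\otimes A_{i+1},\dots,A_n)$; and $\overline W\mathcal C(s^n_j)(A_1,\dots,A_{n-1})=(A_1,\dots,A_j,I,A_{j+1},\dots,A_{n-1})$. $\overline W\mathcal M_i^p$ denotes the reduced bar construction of $\mathcal M^p$ with the componentwise structure given by $\otimes_i,I_i$ (so its value at $n$ is $\mathcal M^{n\cdot p}=(\mathcal M^p)^n$, i.e. $n$ blocks of length $p$). For a functor $F$, $(F)^o$ is its $o$-fold product with itself. The $N$-fold reduced bar construction is $\overline W\mathcal M(k_1,\dots,k_N)=\mathcal M^{k_1\cdots k_N}$ on objects of $(\Delta^{op})^N$ and, for $f_k:s_k\to t_k$ in $\Delta^{op}$, $\overline W\mathcal M(f_1,\dots,f_N)$ is the composite over $k=N,\dots,1$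 (with $k=1$ applied first) of the functors $(\overline W\mathcal M_k^{s_{k+1}\cdots s_N}(f_k))^{t_1\cdots t_{k-1}}$ (empty products are 1). It preserves identities. **Shuffles.** A sequence $\Phi$ of colour $k$ is $(f_r,k)\dots(f_1,k)$ with $f_i$ basic and $f_r\circ\dots\circ f_1$ defined; $\circ\Phi$ denotes the word $f_r\circ\dots\circ f_1$. Identity members may be freely inserted or deleted (so a sequence may have no non-identity members, but it always has a definite source and target). Let $\Theta$ be a shuffle of sequences $\Phi_1,\dots,\Phi_N$ of colours $1,\dots,N$. For a member $(f,k)$ of $\Theta$ and a colour $l\neq k$, let $t_l$ be the target of the closest member of colour $l$ to its right (if there is none, the source of $\circ\Phi_l$). The inner power of $(f,k)$ is $\prod_{k<l\le N}t_l$ and its outer power is $\prod_{1\le l<k}t_l$. The functor $\overline W\mathcal M_\Theta$ is the composite, in the order of $\Theta$ (rightmost applied first), of the functors $(\overline W\mathcal M_k^{i}(f))^{o}$ for the members $(f,k)$ with inner power $i$ and outer power $o$. One has $\overline W\mathcal M_{\Phi_N\dots\Phi_1}=\overline W\mathcal M(f_1,\dots,f_N)$ when $f_k$ is the composite of $\Phi_k$. **The transformations $\chi$.** For basic $f:n\to n'$, $g:m\to m'$, $1\le k<l\le N$, $u,v,w\ge0$, $$\chi^{k,l}_{u,v,w}(f,g):(\overline W\mathcal M_k^{vm'w}(f))^u\circ(\overline W\mathcal M_l^w(g))^{unv}\to(\overline W\mathcal M_l^w(g))^{un'v}\circ(\overline W\mathcal M_k^{vmw}(f))^u$$ is the natural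 transformation described coordinatewise as follows, with the coordinates of $\mathcal M^{un'vm'w}$ indexed lexicographically by $(x,r,y,q,z)$, $1\le x\le u$, $1\le r\le n'$, $1\le y\le v$, $1\le q\le m'$, $1\le z\le w$. It is the identity except when $f$ is $s^{n+1}_j$ or $d^n_j$ with $1\le j\le n-1$, and $g$ is $s^{m+1}_i$ or $d^m_i$ with $1\le i\le m-1$. In these cases all coordinates are identities except those with $r=j+1$ (if $f=s^{n+1}_j$) or $r=j$ (if $f=d^n_j$) and $q=i+1$ (if $g=s^{m+1}_i$) or $q=i$ (if $g=d^m_i$), where the arrow is: $\kappa_{k,l}$ for $(f,g)=(s,s)$; $\tau_{k,l}$ for $(d,s)$; $\beta_{k,l}$ for $(s,d)$; and, for $(d,d)$, $\iota^{k,l}$ at $(A_{x,j,y,i,z},A_{x,j,y,i+1,z},A_{x,j+1,y,i,z},A_{x,j+1,y,i+1,z})$. **Normalizing paths, $\varphi_\Theta$ and $\omega$.** A normalizing path starting with $\Theta$ is a list $\Theta_0,\dots,\Theta_j$ ($j\ge0$) of shuffles of $\Phi_1,\dots,\Phi_N$ with $\Theta_0=\Theta$, $\Theta_j=\Phi_N\dots\Phi_1$ and, for each $0\le i\le j-1$, $\Theta_i=\Pi(f,k)(g,l)\Lambda$ and $\Theta_{i+1}=\Pi(g,l)(f,k)\Lambda$ for some $k<l$ and non-identity members $(f,k),(g,l)$. Put $\varphi_i=\overline W\mathcal M_\Pi\;\chi^{k,l}_{u,v,w}(f,g)\;\overline W\mathcal M_\Lambda:\overline W\mathcal M_{\Theta_i}\to\overline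 W\mathcal M_{\Theta_{i+1}}$ (whiskering), where $\overline W\mathcal M_\Pi,\overline W\mathcal M_\Lambda$ are the parts of the composite $\overline W\mathcal M_{\Theta_i}$ coming from $\Pi,\Lambda$, and $u=\prod_{1\le z<k}t_z$, $v=\prod_{k<z<l}t_z$, $w=\prod_{l<z\le N}t_z$ with $t_z$ the target of the leftmost member of $\Lambda$ of colour $z$ (after adding identities if needed). Let $\varphi(\Theta_0,\dots,\Theta_j)=\varphi_{j-1}\circ\dots\circ\varphi_0$ (the identity if $j=0$); this is independent of the normalizing path starting with $\Theta$ and is denoted $\varphi_\Theta:\overline W\mathcal M_\Theta\to\overline W\mathcal M_{\Phi_N\dots\Phi_1}$. For a composable pair $e_1=(f^1_1,\dots,f^1_N)$, $e_2=(f^2_1,\dots,f^2_N)$ of arrows of $(\Delta^{op})^N$, let $\Phi^i_k$ be the sequence of colour $k$ with $\circ\Phi^i_k$ equal to $(f^i_k)^{\rm nf}$, and define $\omega_{e_2,e_1}=\varphi_{\Phi^2_N\dots\Phi^2_1\Phi^1_N\dots\Phi^1_1}:\overline W\mathcal M(e_2)\circ\overline W\mathcal M(e_1)\to\overline W\mathcal M(e_2\circ e_1)$. *)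

theory Defs
  imports Main "HOL-Library.FuncSet"
begin

section \<open>Categories, functors, natural transformations\<close>

record ('o, 'a) category =
  objs :: "'o set"
  arrs :: "'a set"
  src :: "'a \<Rightarrow> 'o"
  tgt :: "'a \<Rightarrow> 'o"
  idn :: "'o \<Rightarrow> 'a" ("\<one>\<index>")
  cmp :: "'a \<Rightarrow> 'a \<Rightarrow> 'a" (infixr "\<cdot>\<index>" 70)

definition hom :: "('o, 'a, 'm) category_scheme \<Rightarrow> 'o \<Rightarrow> 'o \<Rightarrow> 'a set" where
  "hom C A B = {f \<in> arrs C. src C f = A \<and> tgt C f = B}"

locale category =
  fixes C :: "('o, 'a, 'm) category_scheme" (structure)
  assumes src_obj: "f \<in> arrs C \<Longrightarrow> src C f \<in> objs C"
    and tgt_obj: "f \<in> arrs C \<Longrightarrow> tgt C f \<in> objs C"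
    and idn_hom: "A \<in> objs C \<Longrightarrow> \<one> A \<in> hom C A A"
    and cmp_hom: "\<lbrakk>f \<in> hom C A B; g \<in> hom C B D\<rbrakk> \<Longrightarrow> g \<cdot> f \<in> hom C A D"
    and idn_left: "f \<in> hom C A B \<Longrightarrow> \<one> B \<cdot> f = f"
    and idn_right: "f \<in> hom C A B \<Longrightarrow> f \<cdot> \<one> A = f"
    and cmp_assoc: "\<lbrakk>f \<in> hom C A B; g \<in> hom C B D; h \<in> hom C D E\<rbrakk>
          \<Longrightarrow> (h \<cdot> g) \<cdot> f = h \<cdot> (g \<cdot> f)"

definition op_cat :: "('o, 'a, 'm) category_scheme \<Rightarrow> ('o, 'a) category" where
  "op_cat C = \<lparr>objs = objs C, arrs = arrs C, src = tgt C, tgt = src C,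
     idn = idn C, cmp = (\<lambda>g f. cmp C f g)\<rparr>"

definition power_cat :: "nat \<Rightarrow> ('o, 'a, 'm) category_scheme \<Rightarrow> ('o list, 'a list) category" where
  "power_cat n C = \<lparr>objs = {As. length As = n \<and> set As \<subseteq> objs C},
     arrs = {fs. length fs = n \<and> set fs \<subseteq> arrs C},
     src = map (src C), tgt = map (tgt C), idn = map (idn C), cmp = map2 (cmp C)\<rparr>"

record ('o, 'a, 'p, 'b) funct =
  fobj :: "'o \<Rightarrow> 'p"
  farr :: "'a \<Rightarrow> 'b"

definition fid :: "('o, 'a, 'o, 'a) funct" where
  "fid = \<lparr>fobj = (\<lambda>A. A), farr = (\<lambda>f. f)\<rparr>"

definition fcomp :: "('p, 'b, 'q, 'c) funct \<Rightarrow> ('o, 'a, 'p, 'b) funct \<Rightarrow> ('o, 'a, 'q, 'c) funct"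
    (infixr "\<circ>\<^sub>F" 65) where
  "G \<circ>\<^sub>F F = \<lparr>fobj = fobj G \<circ> fobj F, farr = farr G \<circ> farr F\<rparr>"

locale is_functor =
  fixes C :: "('o, 'a, 'm) category_scheme" and D :: "('p, 'b, 'n) category_scheme"
    and F :: "('o, 'a, 'p, 'b) funct"
  assumes fobj_obj: "A \<in> objs C \<Longrightarrow> fobj F A \<in> objs D"
    and farr_hom: "f \<in> hom C A B \<Longrightarrow> farr F f \<in> hom D (fobj F A) (fobj F B)"
    and farr_idn: "A \<in> objs C \<Longrightarrow> farr F (idn C A) = idn D (fobj F A)"
    and farr_cmp: "\<lbrakk>f \<in> hom C A B; g \<in> hom C B E\<rbrakk>
          \<Longrightarrow> farr F (cmp C g f) = cmp D (farr F g) (farr F f)"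

locale is_nat_trans =
  fixes C :: "('o, 'a, 'm) category_scheme" and D :: "('p, 'b, 'n) category_scheme"
    and F G :: "('o, 'a, 'p, 'b) funct" and \<alpha> :: "'o \<Rightarrow> 'b"
  assumes component: "A \<in> objs C \<Longrightarrow> \<alpha> A \<in> hom D (fobj F A) (fobj G A)"
    and naturality: "f \<in> hom C A B \<Longrightarrow> cmp D (\<alpha> B) (farr F f) = cmp D (farr G f) (\<alpha> A)"

text \<open>
  Lax functors into categories that preserve identities strictly.  Since the comparison at
  identities is then an identity, the two unit laws say that the components of \<open>\<omega>\<close> at
  pairs containing an identity are identities.  Functors and natural transformations are
  compared only on the objects and arrows of their source category.
\<close>

locale lax_functor_to_Cat =
  fixes B :: "('k, 'e, 'm) category_scheme" (structure)
    and F\<^sub>0 :: "'k \<Rightarrow> ('o, 'a) category"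
    and F :: "'e \<Rightarrow> ('o, 'a, 'o, 'a) funct"
    and \<omega> :: "'e \<Rightarrow> 'e \<Rightarrow> 'o \<Rightarrow> 'a"
  assumes base: "category B"
    and on_objects: "K \<in> objs B \<Longrightarrow> category (F\<^sub>0 K)"
    and on_arrows: "e \<in> hom B K L \<Longrightarrow> is_functor (F\<^sub>0 K) (F\<^sub>0 L) (F e)"
    and identity_obj: "\<lbrakk>K \<in> objs B; A \<in> objs (F\<^sub>0 K)\<rbrakk> \<Longrightarrow> fobj (F (\<one> K)) A = A"
    and identity_arr: "\<lbrakk>K \<in> objs B; f \<in> arrs (F\<^sub>0 K)\<rbrakk> \<Longrightarrow> farr (F (\<one> K)) f = f"
    and comparison: "\<lbrakk>e\<^sub>1 \<in> hom B K L; e\<^sub>2 \<in> hom B L P\<rbrakk>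
          \<Longrightarrow> is_nat_trans (F\<^sub>0 K) (F\<^sub>0 P) (F e\<^sub>2 \<circ>\<^sub>F F e\<^sub>1) (F (e\<^sub>2 \<cdot> e\<^sub>1)) (\<omega> e\<^sub>2 e\<^sub>1)"
    and unit_right: "\<lbrakk>e \<in> hom B K L; A \<in> objs (F\<^sub>0 K)\<rbrakk>
          \<Longrightarrow> \<omega> e (\<one> K) A = idn (F\<^sub>0 L) (fobj (F e) A)"
    and unit_left: "\<lbrakk>e \<in> hom B K L; A \<in> objs (F\<^sub>0 K)\<rbrakk>
          \<Longrightarrow> \<omega> (\<one> L) e A = idn (F\<^sub>0 L) (fobj (F e) A)"
    and associativity:
      "\<lbrakk>e\<^sub>1 \<in> hom B K L; e\<^sub>2 \<in> hom B L P; e\<^sub>3 \<in> hom B P Q; A \<in> objs (F\<^sub>0 K)\<rbrakk>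
        \<Longrightarrow> cmp (F\<^sub>0 Q) (\<omega> (e\<^sub>3 \<cdot> e\<^sub>2) e\<^sub>1 A) (\<omega> e\<^sub>3 e\<^sub>2 (fobj (F e\<^sub>1) A))
          = cmp (F\<^sub>0 Q) (\<omega> e\<^sub>3 (e\<^sub>2 \<cdot> e\<^sub>1) A) (farr (F e\<^sub>3) (\<omega> e\<^sub>2 e\<^sub>1 A))"


section \<open>Strict monoidal and \<open>N\<close>-fold strict monoidal categories\<close>

record ('o, 'a) monoidal = "('o, 'a) category" +
  mulO :: "'o \<Rightarrow> 'o \<Rightarrow> 'o"
  mulA :: "'a \<Rightarrow> 'a \<Rightarrow> 'a"
  unitO :: "'o"

locale strict_monoidal_category = category C
  for C :: "('o, 'a, 'm) monoidal_scheme" (structure) +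
  assumes mulO_obj: "\<lbrakk>A \<in> objs C; B \<in> objs C\<rbrakk> \<Longrightarrow> mulO C A B \<in> objs C"
    and mulA_hom: "\<lbrakk>f \<in> hom C A A'; g \<in> hom C B B'\<rbrakk>
          \<Longrightarrow> mulA C f g \<in> hom C (mulO C A B) (mulO C A' B')"
    and mulA_idn: "\<lbrakk>A \<in> objs C; B \<in> objs C\<rbrakk> \<Longrightarrow> mulA C (\<one> A) (\<one> B) = \<one> (mulO C A B)"
    and mulA_cmp: "\<lbrakk>f \<in> hom C A A'; f' \<in> hom C A' A''; g \<in> hom C B B'; g' \<in> hom C B' B''\<rbrakk>
          \<Longrightarrow> mulA C (f' \<cdot> f) (g' \<cdot> g) = mulA C f' g' \<cdot> mulA C f g"
    and mulO_assoc: "\<lbrakk>A \<in> objs C; B \<in> objs C; D \<in> objs C\<rbrakk>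
          \<Longrightarrow> mulO C (mulO C A B) D = mulO C A (mulO C B D)"
    and mulA_assoc: "\<lbrakk>f \<in> arrs C; g \<in> arrs C; h \<in> arrs C\<rbrakk>
          \<Longrightarrow> mulA C (mulA C f g) h = mulA C f (mulA C g h)"
    and unitO_obj: "unitO C \<in> objs C"
    and mulO_unit: "A \<in> objs C \<Longrightarrow> mulO C (unitO C) A = A" "A \<in> objs C \<Longrightarrow> mulO C A (unitO C) = A"
    and mulA_unit: "f \<in> arrs C \<Longrightarrow> mulA C (\<one> (unitO C)) f = f"
          "f \<in> arrs C \<Longrightarrow> mulA C f (\<one> (unitO C)) = f"

definition power_monoidal ::
  "nat \<Rightarrow> ('o, 'a, 'm) monoidal_scheme \<Rightarrow> ('o list, 'a list) monoidal" where
  "power_monoidal p C = category.extend (power_cat p C)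
     (monoidal.fields (map2 (mulO C)) (map2 (mulA C)) (replicate p (unitO C)))"

text \<open>
  Colours are numbered \<open>0, \<dots>, N - 1\<close>.  The symbol \<open>\<otimes>\<close> is the tensor on objects and
  \<open>\<boxtimes>\<close> the tensor on arrows; \<open>\<kappa> k l\<close>, \<open>\<beta> k l\<close>, \<open>\<tau> k l\<close>, \<open>\<iota> k l\<close> matter only for \<open>k < l < N\<close>.
\<close>

record ('o, 'a) multi_monoidal = "('o, 'a) category" +
  tenO :: "'o \<Rightarrow> nat \<Rightarrow> 'o \<Rightarrow> 'o" ("(_ \<otimes>\<index>[_] _)" [76, 0, 76] 75)
  tenA :: "'a \<Rightarrow> nat \<Rightarrow> 'a \<Rightarrow> 'a" ("(_ \<boxtimes>\<index>[_] _)" [76, 0, 76] 75)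
  unt :: "nat \<Rightarrow> 'o" ("\<I>\<index>")
  kap :: "nat \<Rightarrow> nat \<Rightarrow> 'a" ("\<kappa>\<index>")
  bet :: "nat \<Rightarrow> nat \<Rightarrow> 'a" ("\<beta>\<index>")
  tau :: "nat \<Rightarrow> nat \<Rightarrow> 'a" ("\<tau>\<index>")
  iot :: "nat \<Rightarrow> nat \<Rightarrow> 'o \<Rightarrow> 'o \<Rightarrow> 'o \<Rightarrow> 'o \<Rightarrow> 'a" ("\<iota>\<index>")

definition monoidal_part :: "('o, 'a, 'm) multi_monoidal_scheme \<Rightarrow> nat \<Rightarrow> ('o, 'a) monoidal" where
  "monoidal_part M k = \<lparr>objs = objs M, arrs = arrs M, src = src M, tgt = tgt M,
     idn = idn M, cmp = cmp M,
     mulO = (\<lambda>A B. tenO M A k B), mulA = (\<lambda>f g. tenA M f k g), unitO = unt M k\<rparr>"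

locale pair_axioms =
  fixes M :: "('o, 'a, 'm) multi_monoidal_scheme" (structure) and k l :: nat
  assumes kap_hom: "\<kappa> k l \<in> hom M (\<I> k) (\<I> l)"
    and bet_hom: "\<beta> k l \<in> hom M (\<I> k) (\<I> k \<otimes>[l] \<I> k)"
    and tau_hom: "\<tau> k l \<in> hom M (\<I> l \<otimes>[k] \<I> l) (\<I> l)"
    and iot_hom: "{A, B, C, D} \<subseteq> objs M \<Longrightarrow> \<iota> k l A B C D
          \<in> hom M ((A \<otimes>[l] B) \<otimes>[k] (C \<otimes>[l] D)) ((A \<otimes>[k] C) \<otimes>[l] (B \<otimes>[k] D))"
    and iot_natural:
      "\<lbrakk>f\<^sub>1 \<in> hom M A A'; f\<^sub>2 \<in> hom M B B'; f\<^sub>3 \<in> hom M C C'; f\<^sub>4 \<in> hom M D D'\<rbrakk> \<Longrightarrow>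
        \<iota> k l A' B' C' D' \<cdot> ((f\<^sub>1 \<boxtimes>[l] f\<^sub>2) \<boxtimes>[k] (f\<^sub>3 \<boxtimes>[l] f\<^sub>4))
        = ((f\<^sub>1 \<boxtimes>[k] f\<^sub>3) \<boxtimes>[l] (f\<^sub>2 \<boxtimes>[k] f\<^sub>4)) \<cdot> \<iota> k l A B C D"
    and ax1: "{A, B, C, D, E, F} \<subseteq> objs M \<Longrightarrow>
        \<iota> k l A D (B \<otimes>[k] C) (E \<otimes>[k] F) \<cdot> (\<one> (A \<otimes>[l] D) \<boxtimes>[k] \<iota> k l B E C F)
        = \<iota> k l (A \<otimes>[k] B) (D \<otimes>[k] E) C F \<cdot> (\<iota> k l A D B E \<boxtimes>[k] \<one> (C \<otimes>[l] F))"
    and ax2: "{A, B} \<subseteq> objs M \<Longrightarrow>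
        \<iota> k l A B (\<I> k) (\<I> k) \<cdot> (\<one> (A \<otimes>[l] B) \<boxtimes>[k] \<beta> k l) = \<one> (A \<otimes>[l] B)"
    and ax3: "{A, B} \<subseteq> objs M \<Longrightarrow>
        \<iota> k l (\<I> k) (\<I> k) A B \<cdot> (\<beta> k l \<boxtimes>[k] \<one> (A \<otimes>[l] B)) = \<one> (A \<otimes>[l] B)"
    and ax4: "\<tau> k l \<cdot> (\<one> (\<I> l) \<boxtimes>[k] \<tau> k l) = \<tau> k l \<cdot> (\<tau> k l \<boxtimes>[k] \<one> (\<I> l))"
    and ax5: "\<tau> k l \<cdot> (\<one> (\<I> l) \<boxtimes>[k] \<kappa> k l) = \<one> (\<I> l)"
    and ax6: "\<tau> k l \<cdot> (\<kappa> k l \<boxtimes>[k] \<one> (\<I> l)) = \<one> (\<I> l)"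
    and ax7: "{A, B, C, D, E, F} \<subseteq> objs M \<Longrightarrow>
        (\<one> (A \<otimes>[k] D) \<boxtimes>[l] \<iota> k l B C E F) \<cdot> \<iota> k l A (B \<otimes>[l] C) D (E \<otimes>[l] F)
        = (\<iota> k l A B D E \<boxtimes>[l] \<one> (C \<otimes>[k] F)) \<cdot> \<iota> k l (A \<otimes>[l] B) C (D \<otimes>[l] E) F"
    and ax8: "{A, B} \<subseteq> objs M \<Longrightarrow>
        (\<one> (A \<otimes>[k] B) \<boxtimes>[l] \<tau> k l) \<cdot> \<iota> k l A (\<I> l) B (\<I> l) = \<one> (A \<otimes>[k] B)"
    and ax9: "{A, B} \<subseteq> objs M \<Longrightarrow>
        (\<tau> k l \<boxtimes>[l] \<one> (A \<otimes>[k] B)) \<cdot> \<iota> k l (\<I> l) A (\<I> l) B = \<one> (A \<otimes>[k] B)"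
    and ax10: "(\<one> (\<I> k) \<boxtimes>[l] \<beta> k l) \<cdot> \<beta> k l = (\<beta> k l \<boxtimes>[l] \<one> (\<I> k)) \<cdot> \<beta> k l"
    and ax11: "(\<one> (\<I> k) \<boxtimes>[l] \<kappa> k l) \<cdot> \<beta> k l = \<one> (\<I> k)"
    and ax12: "(\<kappa> k l \<boxtimes>[l] \<one> (\<I> k)) \<cdot> \<beta> k l = \<one> (\<I> k)"

locale triple_axioms =
  fixes M :: "('o, 'a, 'm) multi_monoidal_scheme" (structure) and a b c :: nat
  assumes ax13: "\<kappa> b c \<cdot> \<kappa> a b = \<kappa> a c"
    and ax14: "\<beta> b c \<cdot> \<kappa> a b = (\<kappa> a b \<boxtimes>[c] \<kappa> a b) \<cdot> \<beta> a c"
    and ax15: "\<tau> b c \<cdot> (\<kappa> a c \<boxtimes>[b] \<kappa> a c) \<cdot> \<beta> a b = \<kappa> a c"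
    and ax16: "\<iota> b c (\<I> a) (\<I> a) (\<I> a) (\<I> a) \<cdot> (\<beta> a c \<boxtimes>[b] \<beta> a c) \<cdot> \<beta> a b
        = (\<beta> a b \<boxtimes>[c] \<beta> a b) \<cdot> \<beta> a c"
    and ax17: "\<kappa> b c \<cdot> \<tau> a b = \<tau> a c \<cdot> (\<kappa> b c \<boxtimes>[a] \<kappa> b c)"
    and ax18: "\<beta> b c \<cdot> \<tau> a b
        = (\<tau> a b \<boxtimes>[c] \<tau> a b) \<cdot> \<iota> a c (\<I> b) (\<I> b) (\<I> b) (\<I> b) \<cdot> (\<beta> b c \<boxtimes>[a] \<beta> b c)"
    and ax19: "\<tau> b c \<cdot> (\<tau> a c \<boxtimes>[b] \<tau> a c) \<cdot> \<iota> a b (\<I> c) (\<I> c) (\<I> c) (\<I> c)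
        = \<tau> a c \<cdot> (\<tau> b c \<boxtimes>[a] \<tau> b c)"
    and ax20: "{A, B, C, D, E, F, G, H} \<subseteq> objs M \<Longrightarrow>
        \<iota> b c (A \<otimes>[a] E) (B \<otimes>[a] F) (C \<otimes>[a] G) (D \<otimes>[a] H)
          \<cdot> (\<iota> a c A B E F \<boxtimes>[b] \<iota> a c C D G H)
          \<cdot> \<iota> a b (A \<otimes>[c] B) (C \<otimes>[c] D) (E \<otimes>[c] F) (G \<otimes>[c] H)
        = (\<iota> a b A C E G \<boxtimes>[c] \<iota> a b B D F H)
          \<cdot> \<iota> a c (A \<otimes>[b] C) (B \<otimes>[b] D) (E \<otimes>[b] G) (F \<otimes>[b] H)
          \<cdot> (\<iota> b c A B C D \<boxtimes>[a] \<iota> b c E F G H)"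

locale N_fold_strict_monoidal_category = category M
  for N :: nat and M :: "('o, 'a, 'm) multi_monoidal_scheme" (structure) +
  assumes monoidal: "k < N \<Longrightarrow> strict_monoidal_category (monoidal_part M k)"
    and pair: "\<lbrakk>k < l; l < N\<rbrakk> \<Longrightarrow> pair_axioms M k l"
    and triple: "\<lbrakk>a < b; b < c; c < N\<rbrakk> \<Longrightarrow> triple_axioms M a b c"


section \<open>The opposite of the simplicial category\<close>

text \<open>
  The arrow \<open>(m, n, \<phi>)\<close> of \<open>Delta\<close> is the monotone map \<open>\<phi> : {0, \<dots>, m} \<rightarrow> {0, \<dots>, n}\<close>,
  extensional outside \<open>{0, \<dots>, m}\<close>.
\<close>

type_synonym simplicial_map = "nat \<times> nat \<times> (nat \<Rightarrow> nat)"

definition Delta :: "(nat, simplicial_map) category" where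
  "Delta = \<lparr>objs = UNIV,
     arrs = {(m, n, \<phi>) | m n \<phi>. \<phi> \<in> {..m} \<rightarrow>\<^sub>E {..n} \<and> mono_on {..m} \<phi>},
     src = (\<lambda>(m, n, \<phi>). m), tgt = (\<lambda>(m, n, \<phi>). n),
     idn = (\<lambda>n. (n, n, \<lambda>i\<in>{..n}. i)),
     cmp = (\<lambda>(_, p, \<psi>) (m, _, \<phi>). (m, p, compose {..m} \<psi> \<phi>))\<rparr>"

abbreviation Delta_op :: "(nat, simplicial_map) category" where
  "Delta_op \<equiv> op_cat Delta"

text \<open>
  \<open>Face n i\<close> is \<open>d\<^sup>n\<^sub>i : n \<rightarrow> n - 1\<close> and \<open>Degen n i\<close> is \<open>s\<^sup>n\<^sub>i : n - 1 \<rightarrow> n\<close>, so the superscript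
  of a degeneracy is its target.  These are the non-identity basic arrows.  As identity members
  of sequences and shuffles may be inserted and deleted freely, a sequence is represented by
  the list of its non-identity members, written as in the composite (the head is applied last),
  and its source is carried separately.
\<close>

datatype basic = Face nat nat | Degen nat nat

fun basic_valid :: "basic \<Rightarrow> bool" where
  "basic_valid (Face n i) \<longleftrightarrow> 1 \<le> n \<and> i \<le> n"
| "basic_valid (Degen n i) \<longleftrightarrow> 1 \<le> n \<and> i \<le> n - 1"

fun bsrc :: "basic \<Rightarrow> nat" where
  "bsrc (Face n i) = n"
| "bsrc (Degen n i) = n - 1"

fun btgt :: "basic \<Rightarrow> nat" where
  "btgt (Face n i) = n - 1"
| "btgt (Degen n i) = n"

fun basic_arr :: "basic \<Rightarrow> simplicial_map" where
  "basic_arr (Face n i) = (n - 1, n, \<lambda>j\<in>{..n - 1}. if j < i then j else j + 1)"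
| "basic_arr (Degen n i) = (n, n - 1, \<lambda>j\<in>{..n}. if j \<le> i then j else j - 1)"

fun word_arr :: "nat \<Rightarrow> basic list \<Rightarrow> simplicial_map" where
  "word_arr n [] = idn Delta_op n"
| "word_arr n (b # w) = cmp Delta_op (basic_arr b) (word_arr n w)"

fun composable :: "nat \<Rightarrow> basic list \<Rightarrow> bool" where
  "composable n [] \<longleftrightarrow> True"
| "composable n (b # w) \<longleftrightarrow>
     basic_valid b \<and> composable n w \<and> bsrc b = tgt Delta_op (word_arr n w)"

definition normal_word :: "basic list \<Rightarrow> bool" where
  "normal_word w \<longleftrightarrow> (\<exists>ss ds.
     w = map (\<lambda>(n, i). Degen n i) ss @ map (\<lambda>(n, i). Face n i) ds
     \<and> sorted_wrt (>) (map snd ss) \<and> sorted_wrt (\<ge>) (map snd ds))"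

definition nf :: "simplicial_map \<Rightarrow> basic list" where
  "nf f = (THE w. normal_word w \<and> composable (src Delta_op f) w
     \<and> word_arr (src Delta_op f) w = f)"


section \<open>The reduced bar construction\<close>

definition face_list :: "('x \<Rightarrow> 'x \<Rightarrow> 'x) \<Rightarrow> nat \<Rightarrow> nat \<Rightarrow> 'x list \<Rightarrow> 'x list" where
  "face_list m n i xs = (if i = 0 then tl xs else if i = n then butlast xs
     else take (i - 1) xs @ [m (xs ! (i - 1)) (xs ! i)] @ drop (i + 1) xs)"

definition degen_list :: "'x \<Rightarrow> nat \<Rightarrow> 'x list \<Rightarrow> 'x list" where
  "degen_list e j xs = take j xs @ [e] @ drop j xs"

fun bar_basic :: "('o, 'a, 'm) monoidal_scheme \<Rightarrow> basic
    \<Rightarrow> ('o list, 'a list, 'o list, 'a list) funct" where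
  "bar_basic C (Face n i) =
     \<lparr>fobj = face_list (mulO C) n i, farr = face_list (mulA C) n i\<rparr>"
| "bar_basic C (Degen n j) =
     \<lparr>fobj = degen_list (unitO C) j, farr = degen_list (idn C (unitO C)) j\<rparr>"

text \<open>
  The functor on \<open>\<Delta>\<^sup>o\<^sup>p\<close> is determined by its values on basic arrows; its value at an arbitrary
  arrow is computed along the normal form.
\<close>

definition bar :: "('o, 'a, 'm) monoidal_scheme \<Rightarrow> simplicial_map
    \<Rightarrow> ('o list, 'a list, 'o list, 'a list) funct" where
  "bar C f = foldr (\<lambda>b F. bar_basic C b \<circ>\<^sub>F F) (nf f) fid"

text \<open>
  \<open>blocks n p\<close> cuts a list of length \<open>n * p\<close> into \<open>n\<close> blocks of length \<open>p\<close>; this is the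
  identification of the \<open>(n * p)\<close>-th power of a category with the \<open>n\<close>-th power of its
  \<open>p\<close>-th power, with inverse \<open>concat\<close>.
\<close>

definition blocks :: "nat \<Rightarrow> nat \<Rightarrow> 'x list \<Rightarrow> 'x list list" where
  "blocks n p xs = map (\<lambda>i. take p (drop (i * p) xs)) [0..<n]"

definition flatten_funct :: "nat \<Rightarrow> nat
    \<Rightarrow> ('o list list, 'a list list, 'o list list, 'a list list) funct
    \<Rightarrow> ('o list, 'a list, 'o list, 'a list) funct" where
  "flatten_funct n p F =
     \<lparr>fobj = concat \<circ> fobj F \<circ> blocks n p, farr = concat \<circ> farr F \<circ> blocks n p\<rparr>"

text \<open>The \<open>r\<close>-fold product with itself of a functor whose source is an \<open>a\<close>-th power.\<close>

definition funct_power :: "nat \<Rightarrow> nat \<Rightarrow> ('o list, 'a list, 'o list, 'a list) funct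
    \<Rightarrow> ('o list, 'a list, 'o list, 'a list) funct" where
  "funct_power r a F =
     \<lparr>fobj = concat \<circ> map (fobj F) \<circ> blocks r a, farr = concat \<circ> map (farr F) \<circ> blocks r a\<rparr>"

text \<open>
  \<open>Wbar M k p r f\<close> and \<open>Wbar_basic M k p r b\<close> are the \<open>r\<close>-fold products (outer power \<open>r\<close>) of the
  values, at \<open>f\<close> and at the basic arrow \<open>b\<close>, of the reduced bar construction of the \<open>p\<close>-th power
  of \<open>M\<close> (inner power \<open>p\<close>) with respect to the \<open>k\<close>-th monoidal structure.
\<close>

definition Wbar :: "('o, 'a, 'm) multi_monoidal_scheme \<Rightarrow> nat \<Rightarrow> nat \<Rightarrow> nat \<Rightarrow> simplicial_map
    \<Rightarrow> ('o list, 'a list, 'o list, 'a list) funct" where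
  "Wbar M k p r f = funct_power r (src Delta_op f * p)
     (flatten_funct (src Delta_op f) p (bar (power_monoidal p (monoidal_part M k)) f))"

definition Wbar_basic :: "('o, 'a, 'm) multi_monoidal_scheme \<Rightarrow> nat \<Rightarrow> nat \<Rightarrow> nat \<Rightarrow> basic
    \<Rightarrow> ('o list, 'a list, 'o list, 'a list) funct" where
  "Wbar_basic M k p r b = funct_power r (bsrc b * p)
     (flatten_funct (bsrc b) p (bar_basic (power_monoidal p (monoidal_part M k)) b))"

text \<open>Colour \<open>0\<close> is applied first.\<close>

definition N_fold_bar :: "nat \<Rightarrow> ('o, 'a, 'm) multi_monoidal_scheme \<Rightarrow> simplicial_map list
    \<Rightarrow> ('o list, 'a list, 'o list, 'a list) funct" where
  "N_fold_bar N M e = foldr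
     (\<lambda>k F. Wbar M k (\<Prod>l\<in>{k<..<N}. src Delta_op (e ! l)) (\<Prod>l<k. tgt Delta_op (e ! l)) (e ! k)
        \<circ>\<^sub>F F)
     (rev [0..<N]) fid"


section \<open>Shuffles\<close>

text \<open>
  A shuffle is a list of coloured basic arrows, the rightmost being applied first, considered
  together with the sources \<open>s l\<close> of its sequences.
\<close>

type_synonym shuffle = "(basic \<times> nat) list"

definition is_shuffle :: "nat \<Rightarrow> (nat \<Rightarrow> shuffle) \<Rightarrow> shuffle \<Rightarrow> bool" where
  "is_shuffle N \<Phi> \<Theta> \<longleftrightarrow>
     (\<forall>x \<in> set \<Theta>. snd x < N) \<and> (\<forall>k<N. filter (\<lambda>x. snd x = k) \<Theta> = \<Phi> k)"

fun colour_tgt :: "(nat \<Rightarrow> nat) \<Rightarrow> shuffle \<Rightarrow> nat \<Rightarrow> nat" where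
  "colour_tgt s [] l = s l"
| "colour_tgt s ((f, k) # \<Lambda>) l = (if l = k then btgt f else colour_tgt s \<Lambda> l)"

fun Wbar_shuffle :: "nat \<Rightarrow> ('o, 'a, 'm) multi_monoidal_scheme \<Rightarrow> (nat \<Rightarrow> nat) \<Rightarrow> shuffle
    \<Rightarrow> ('o list, 'a list, 'o list, 'a list) funct" where
  "Wbar_shuffle N M s [] = fid"
| "Wbar_shuffle N M s ((f, k) # \<Lambda>) =
     Wbar_basic M k (\<Prod>l\<in>{k<..<N}. colour_tgt s \<Lambda> l) (\<Prod>l<k. colour_tgt s \<Lambda> l) f
       \<circ>\<^sub>F Wbar_shuffle N M s \<Lambda>"


section \<open>The transformations \<open>\<chi>\<close>\<close>

definition lex_indices :: "nat \<Rightarrow> nat \<Rightarrow> nat \<Rightarrow> nat \<Rightarrow> nat \<Rightarrow> (nat \<times> nat \<times> nat \<times> nat \<times> nat) list" where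
  "lex_indices u n v m w = [(x, r, y, q, z). x \<leftarrow> [1..<u + 1], r \<leftarrow> [1..<n + 1],
     y \<leftarrow> [1..<v + 1], q \<leftarrow> [1..<m + 1], z \<leftarrow> [1..<w + 1]]"

text \<open>The coordinate \<open>(x, r, y, q, z)\<close>, counted from 1, of a list of length \<open>u * n * v * m * w\<close>.\<close>

definition coord :: "nat \<Rightarrow> nat \<Rightarrow> nat \<Rightarrow> nat \<Rightarrow> 'x list \<Rightarrow> nat \<Rightarrow> nat \<Rightarrow> nat \<Rightarrow> nat \<Rightarrow> nat \<Rightarrow> 'x" where
  "coord n v m w A x r y q z =
     A ! (((((x - 1) * n + (r - 1)) * v + (y - 1)) * m + (q - 1)) * w + (z - 1))"

text \<open>
  The component at \<open>(x, r, y, q, z)\<close>, where \<open>X\<close> is the corresponding coordinate of the value of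
  the source functor at \<open>A\<close> and \<open>At\<close> gives the coordinates of \<open>A\<close> itself.
\<close>

fun chi_coord :: "('o, 'a, 'm) multi_monoidal_scheme \<Rightarrow> nat \<Rightarrow> nat
    \<Rightarrow> (nat \<Rightarrow> nat \<Rightarrow> nat \<Rightarrow> nat \<Rightarrow> nat \<Rightarrow> 'o) \<Rightarrow> basic \<Rightarrow> basic
    \<Rightarrow> nat \<times> nat \<times> nat \<times> nat \<times> nat \<Rightarrow> 'o \<Rightarrow> 'a" where
  "chi_coord M k l At (Degen _ j) (Degen _ i) (x, r, y, q, z) X =
     (if r = j + 1 \<and> q = i + 1 then kap M k l else idn M X)"
| "chi_coord M k l At (Face n j) (Degen _ i) (x, r, y, q, z) X =
     (if 0 < j \<and> j < n \<and> r = j \<and> q = i + 1 then tau M k l else idn M X)"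
| "chi_coord M k l At (Degen _ j) (Face m i) (x, r, y, q, z) X =
     (if 0 < i \<and> i < m \<and> r = j + 1 \<and> q = i then bet M k l else idn M X)"
| "chi_coord M k l At (Face n j) (Face m i) (x, r, y, q, z) X =
     (if 0 < j \<and> j < n \<and> 0 < i \<and> i < m \<and> r = j \<and> q = i
      then iot M k l (At x j y i z) (At x j y (i + 1) z) (At x (j + 1) y i z) (At x (j + 1) y (i + 1) z)
      else idn M X)"

definition chi_source :: "('o, 'a, 'm) multi_monoidal_scheme \<Rightarrow> nat \<Rightarrow> nat \<Rightarrow> nat \<Rightarrow> nat \<Rightarrow> nat
    \<Rightarrow> basic \<Rightarrow> basic \<Rightarrow> ('o list, 'a list, 'o list, 'a list) funct" where
  "chi_source M k l u v w f g =
     Wbar_basic M k (v * btgt g * w) u f \<circ>\<^sub>F Wbar_basic M l w (u * bsrc f * v) g"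

definition chi :: "('o, 'a, 'm) multi_monoidal_scheme \<Rightarrow> nat \<Rightarrow> nat \<Rightarrow> nat \<Rightarrow> nat \<Rightarrow> nat
    \<Rightarrow> basic \<Rightarrow> basic \<Rightarrow> 'o list \<Rightarrow> 'a list" where
  "chi M k l u v w f g A =
     map2 (chi_coord M k l (coord (bsrc f) v (bsrc g) w A) f g)
       (lex_indices u (btgt f) v (btgt g) w)
       (fobj (chi_source M k l u v w f g) A)"


section \<open>Normalizing paths and \<open>\<omega>\<close>\<close>

definition phi_swap :: "nat \<Rightarrow> ('o, 'a, 'm) multi_monoidal_scheme \<Rightarrow> (nat \<Rightarrow> nat)
    \<Rightarrow> shuffle \<Rightarrow> basic \<times> nat \<Rightarrow> basic \<times> nat \<Rightarrow> shuffle \<Rightarrow> 'o list \<Rightarrow> 'a list" where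
  "phi_swap N M s \<Gamma> = (\<lambda>(f, k) (g, l) \<Lambda> A.
     let t = colour_tgt s \<Lambda>;
         u = \<Prod>z<k. t z; v = \<Prod>z\<in>{k<..<l}. t z; w = \<Prod>z\<in>{l<..<N}. t z
     in farr (Wbar_shuffle N M (colour_tgt s ((f, k) # (g, l) # \<Lambda>)) \<Gamma>)
          (chi M k l u v w f g (fobj (Wbar_shuffle N M s \<Lambda>) A)))"

definition is_swap :: "shuffle \<Rightarrow> shuffle \<Rightarrow> shuffle \<Rightarrow> basic \<times> nat \<Rightarrow> basic \<times> nat \<Rightarrow> shuffle \<Rightarrow> bool"
  where "is_swap \<Theta> \<Theta>' \<Gamma> x y \<Lambda> \<longleftrightarrow>
     snd x < snd y \<and> \<Theta> = \<Gamma> @ [x, y] @ \<Lambda> \<and> \<Theta>' = \<Gamma> @ [y, x] @ \<Lambda>"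

text \<open>The decomposition in \<open>is_swap\<close> is determined by the two shuffles, as \<open>x \<noteq> y\<close>.\<close>

definition phi_step :: "nat \<Rightarrow> ('o, 'a, 'm) multi_monoidal_scheme \<Rightarrow> (nat \<Rightarrow> nat)
    \<Rightarrow> shuffle \<Rightarrow> shuffle \<Rightarrow> 'o list \<Rightarrow> 'a list" where
  "phi_step N M s \<Theta> \<Theta>' =
     (THE \<phi>. \<exists>\<Gamma> x y \<Lambda>. is_swap \<Theta> \<Theta>' \<Gamma> x y \<Lambda> \<and> \<phi> = phi_swap N M s \<Gamma> x y \<Lambda>)"

definition normal_shuffle :: "nat \<Rightarrow> (nat \<Rightarrow> shuffle) \<Rightarrow> shuffle" where
  "normal_shuffle N \<Phi> = concat (map \<Phi> (rev [0..<N]))"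

definition normalizing_path :: "nat \<Rightarrow> (nat \<Rightarrow> shuffle) \<Rightarrow> shuffle \<Rightarrow> shuffle list \<Rightarrow> bool" where
  "normalizing_path N \<Phi> \<Theta> \<Theta>s \<longleftrightarrow>
     \<Theta>s \<noteq> [] \<and> (\<forall>\<Theta>' \<in> set \<Theta>s. is_shuffle N \<Phi> \<Theta>')
     \<and> hd \<Theta>s = \<Theta> \<and> last \<Theta>s = normal_shuffle N \<Phi>
     \<and> (\<forall>i < length \<Theta>s - 1. \<exists>\<Gamma> x y \<Lambda>. is_swap (\<Theta>s ! i) (\<Theta>s ! (i + 1)) \<Gamma> x y \<Lambda>)"

fun phi_path :: "nat \<Rightarrow> ('o, 'a, 'm) multi_monoidal_scheme \<Rightarrow> (nat \<Rightarrow> nat)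
    \<Rightarrow> shuffle list \<Rightarrow> 'o list \<Rightarrow> 'a list" where
  "phi_path N M s (\<Theta> # \<Theta>' # \<Theta>s) A =
     map2 (cmp M) (phi_path N M s (\<Theta>' # \<Theta>s) A) (phi_step N M s \<Theta> \<Theta>' A)"
| "phi_path N M s [\<Theta>] A = map (idn M) (fobj (Wbar_shuffle N M s \<Theta>) A)"
| "phi_path N M s [] A = []"

text \<open>The choice of the path is immaterial on objects of the source category.\<close>

definition phi :: "nat \<Rightarrow> ('o, 'a, 'm) multi_monoidal_scheme \<Rightarrow> (nat \<Rightarrow> nat)
    \<Rightarrow> (nat \<Rightarrow> shuffle) \<Rightarrow> shuffle \<Rightarrow> 'o list \<Rightarrow> 'a list" where
  "phi N M s \<Phi> \<Theta> = phi_path N M s (SOME \<Theta>s. normalizing_path N \<Phi> \<Theta> \<Theta>s)"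

definition nf_sequence :: "simplicial_map list \<Rightarrow> nat \<Rightarrow> shuffle" where
  "nf_sequence e k = map (\<lambda>b. (b, k)) (nf (e ! k))"

definition omega :: "nat \<Rightarrow> ('o, 'a, 'm) multi_monoidal_scheme
    \<Rightarrow> simplicial_map list \<Rightarrow> simplicial_map list \<Rightarrow> 'o list \<Rightarrow> 'a list" where
  "omega N M e\<^sub>2 e\<^sub>1 = phi N M (\<lambda>l. src Delta_op (e\<^sub>1 ! l))
     (\<lambda>k. nf_sequence e\<^sub>2 k @ nf_sequence e\<^sub>1 k)
     (normal_shuffle N (nf_sequence e\<^sub>2) @ normal_shuffle N (nf_sequence e\<^sub>1))"

end

theory Submission
  imports Defs
begin

text \<open>
  The coordinates of an object of a power of \<open>M\<close> are viewed as an infinite array indexed by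
  functions \<open>nat \<Rightarrow> nat\<close>, and a simplicial map as a monotone map \<open>nat \<Rightarrow> nat\<close>.  The bar construction
  of colour \<open>k\<close> at \<open>\<phi>\<close> then multiplies, in direction \<open>k\<close>, the entries with index in
  \<open>{\<phi> i..<\<phi> (i + 1)}\<close>, and axioms (1)--(12) extend \<open>\<chi>\<close> from basic arrows to all pairs of
  monotone maps, functorially in each of them, while axioms (13)--(20) give the hexagon for three
  colours.  Inserting the letters of a coloured word one after the other into a sorted word yields a
  canonical transformation for every word, which by the hexagon is compatible with swaps of
  letters of different colours and with composition of adjacent letters of the same colour.  Hence every
  normalizing path computes the canonical transformation, replacing words by their normal forms
  is harmless, and both sides of the associativity law are the canonical transformation of the
  word made of the letters of \<open>e\<^sub>3\<close>, \<open>e\<^sub>2\<close> and \<open>e\<^sub>1\<close>.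
\<close>

section \<open>Iterated products\<close>

text \<open>Two obstacles shape the proof. The normal form of a composite is not the concatenation
  of the normal forms of its factors, so \<omega> at a composite cannot be compared with \<omega> at
  the factors by swaps alone, and a check along the simplicial identities would meet every relation
  between faces and degeneracies separately. Once \<chi> is defined for arbitrary monotone maps,
  such a relation is an equality of maps, and joining letters of one colour is functoriality of the
  extended \<chi>. The other obstacle is size: the inner and outer powers change with every letter.
  Entries are therefore indexed without bounds, maps are continued by a shift beyond their domain,
  and sizes return only in the relation \<open>rep\<close> between lists and arrays. Independence of
  the path is a by-product: insertion involves no choice and is trivial on sorted words.\<close>

definition fprod :: "('x \<Rightarrow> 'x \<Rightarrow> 'x) \<Rightarrow> 'x \<Rightarrow> ('i \<Rightarrow> 'x) \<Rightarrow> 'i list \<Rightarrow> 'x" where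
  "fprod p e X is = foldr (\<lambda>i x. p (X i) x) is e"

lemma fprod_simps [simp]:
  "fprod p e X [] = e"
  "fprod p e X (i # is) = p (X i) (fprod p e X is)"
  by (simp_all add: fprod_def)

lemma fprod_cong [fundef_cong]:
  "(\<And>i. i \<in> set is \<Longrightarrow> X i = Y i) \<Longrightarrow> is = js \<Longrightarrow> fprod p e X is = fprod p e Y js"
proof -
  assume "\<And>i. i \<in> set is \<Longrightarrow> X i = Y i" "is = js"
  then show ?thesis by (induction "is" arbitrary: js) auto
qed

lemma fprod_map: "fprod p e X (map f is) = fprod p e (\<lambda>i. X (f i)) is"
  by (induction "is") auto

text \<open>Objects under \<open>tenO\<close> and arrows under \<open>tenA\<close> are both
  instances, so the translation of the list-level bar construction into arrays is carried out once
  for \<open>fobj\<close> and \<open>farr\<close> together.\<close>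

definition monoid_on :: "('x \<Rightarrow> 'x \<Rightarrow> 'x) \<Rightarrow> 'x \<Rightarrow> 'x set \<Rightarrow> bool" where
  "monoid_on p e S \<longleftrightarrow> e \<in> S \<and> (\<forall>x\<in>S. p e x = x \<and> p x e = x)
     \<and> (\<forall>x\<in>S. \<forall>y\<in>S. p x y \<in> S \<and> (\<forall>z\<in>S. p (p x y) z = p x (p y z)))"

lemma monoid_onD:
  assumes "monoid_on p e S"
  shows "e \<in> S" "x \<in> S \<Longrightarrow> p e x = x" "x \<in> S \<Longrightarrow> p x e = x"
    "x \<in> S \<Longrightarrow> y \<in> S \<Longrightarrow> p x y \<in> S"
    "x \<in> S \<Longrightarrow> y \<in> S \<Longrightarrow> z \<in> S \<Longrightarrow> p (p x y) z = p x (p y z)"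
  using assms by (auto simp: monoid_on_def)

lemma fprod_closed:
  assumes "monoid_on p e S" "\<And>i. i \<in> set is \<Longrightarrow> X i \<in> S"
  shows "fprod p e X is \<in> S"
  using assms(2) by (induction "is") (auto intro: monoid_onD[OF assms(1)])

lemma fprod_append:
  assumes "monoid_on p e S" "\<And>i. i \<in> set is \<union> set js \<Longrightarrow> X i \<in> S"
  shows "fprod p e X (is @ js) = p (fprod p e X is) (fprod p e X js)"
  using assms(2)
proof (induction "is")
  case Nil
  then show ?case by (simp add: monoid_onD(2)[OF assms(1)] fprod_closed[OF assms(1)])
next
  case (Cons i "is")
  then show ?case by (simp add: monoid_onD(5)[OF assms(1)] fprod_closed[OF assms(1)])
qed

lemma fprod_concat:
  assumes "monoid_on p e S" "\<And>i. i \<in> set (concat iss) \<Longrightarrow> X i \<in> S"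
  shows "fprod p e X (concat iss) = fprod p e (\<lambda>is. fprod p e X is) iss"
  using assms(2)
proof (induction iss)
  case (Cons "is" iss)
  then show ?case
    by (simp only: concat.simps fprod_simps) (subst fprod_append[OF assms(1)], auto)
qed simp


section \<open>Coherence for two monoidal structures\<close>

context N_fold_strict_monoidal_category
begin

section \<open>Calculus of arrows and tensor products\<close>

abbreviation ob where "ob A \<equiv> A \<in> objs M"
abbreviation arr where "arr f \<equiv> f \<in> arrs M"
abbreviation dom where "dom f \<equiv> src M f"
abbreviation cod where "cod f \<equiv> tgt M f"

lemma dom_ob [simp]: "arr f \<Longrightarrow> ob (dom f)"
  and cod_ob [simp]: "arr f \<Longrightarrow> ob (cod f)"
  using src_obj tgt_obj by auto

lemma idn_simps [simp]: "ob A \<Longrightarrow> arr (\<one> A)" "ob A \<Longrightarrow> dom (\<one> A) = A" "ob A \<Longrightarrow> cod (\<one> A) = A"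
  using idn_hom by (auto simp: hom_def)

lemma cmp_simps [simp]:
  assumes "arr f" "arr g" "cod f = dom g"
  shows "arr (g \<cdot> f)" "dom (g \<cdot> f) = dom f" "cod (g \<cdot> f) = cod g"
  using cmp_hom[of f "dom f" "dom g" g "cod g"] assms by (auto simp: hom_def)

lemma cmp_idn [simp]:
  "arr f \<Longrightarrow> cod f = B \<Longrightarrow> \<one> B \<cdot> f = f"
  "arr f \<Longrightarrow> dom f = A \<Longrightarrow> f \<cdot> \<one> A = f"
  using idn_left idn_right by (auto simp: hom_def)

lemma cmp_assoc' [simp]:
  "arr f \<Longrightarrow> arr g \<Longrightarrow> arr h \<Longrightarrow> cod f = dom g \<Longrightarrow> cod g = dom h \<Longrightarrow> (h \<cdot> g) \<cdot> f = h \<cdot> g \<cdot> f"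
  using cmp_assoc by (auto simp: hom_def)

lemma unt_ob [simp]: "k < N \<Longrightarrow> ob (\<I> k)"
  using strict_monoidal_category.unitO_obj[OF monoidal] by (simp add: monoidal_part_def)

lemma tenO_ob [simp]: "k < N \<Longrightarrow> ob A \<Longrightarrow> ob B \<Longrightarrow> ob (A \<otimes>[k] B)"
  using strict_monoidal_category.mulO_obj[OF monoidal, of k A B] by (simp add: monoidal_part_def)

lemma ten_simps [simp]:
  assumes "k < N" "arr f" "arr g"
  shows "arr (f \<boxtimes>[k] g)" "dom (f \<boxtimes>[k] g) = dom f \<otimes>[k] dom g" "cod (f \<boxtimes>[k] g) = cod f \<otimes>[k] cod g"
  using strict_monoidal_category.mulA_hom[OF monoidal, of k f "dom f" "cod f" g "dom g" "cod g"] assms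
  by (auto simp: monoidal_part_def hom_def)

lemma ten_idn: "k < N \<Longrightarrow> ob A \<Longrightarrow> ob B \<Longrightarrow> \<one> A \<boxtimes>[k] \<one> B = \<one> (A \<otimes>[k] B)"
  using strict_monoidal_category.mulA_idn[OF monoidal, of k A B] by (simp add: monoidal_part_def)

lemma ten_cmp:
  assumes "k < N" "arr f" "arr g" "arr f'" "arr g'" "cod f = dom f'" "cod g = dom g'"
  shows "(f' \<boxtimes>[k] g') \<cdot> (f \<boxtimes>[k] g) = (f' \<cdot> f) \<boxtimes>[k] (g' \<cdot> g)"
  using strict_monoidal_category.mulA_cmp[OF monoidal, of k f "dom f" "cod f" f' "cod f'" g "dom g"
      "cod g" g' "cod g'"] assms
  by (simp add: monoidal_part_def hom_def)

text \<open>Composites are normalized by bracketing to the right, which hides two adjacent tensors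
  inside a longer composite; the tail \<open>h\<close> makes the interchange law applicable
  there.\<close>

lemma ten_cmp2:
  assumes "k < N" "arr f" "arr g" "arr f'" "arr g'" "cod f = dom f'" "cod g = dom g'"
    "arr h" "cod h = dom f \<otimes>[k] dom g"
  shows "(f' \<boxtimes>[k] g') \<cdot> (f \<boxtimes>[k] g) \<cdot> h = ((f' \<cdot> f) \<boxtimes>[k] (g' \<cdot> g)) \<cdot> h"
  using assms by (simp add: ten_cmp[symmetric])

lemma tenO_assoc [simp]:
  "k < N \<Longrightarrow> ob A \<Longrightarrow> ob B \<Longrightarrow> ob C \<Longrightarrow> (A \<otimes>[k] B) \<otimes>[k] C = A \<otimes>[k] (B \<otimes>[k] C)"
  using strict_monoidal_category.mulO_assoc[OF monoidal, of k A B C] by (simp add: monoidal_part_def)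

lemma ten_assoc [simp]:
  "k < N \<Longrightarrow> arr f \<Longrightarrow> arr g \<Longrightarrow> arr h \<Longrightarrow> (f \<boxtimes>[k] g) \<boxtimes>[k] h = f \<boxtimes>[k] (g \<boxtimes>[k] h)"
  using strict_monoidal_category.mulA_assoc[OF monoidal, of k f g h] by (simp add: monoidal_part_def)

lemma tenO_unit [simp]: "k < N \<Longrightarrow> ob A \<Longrightarrow> \<I> k \<otimes>[k] A = A" "k < N \<Longrightarrow> ob A \<Longrightarrow> A \<otimes>[k] \<I> k = A"
  using strict_monoidal_category.mulO_unit[OF monoidal, of k A] by (simp_all add: monoidal_part_def)

lemma ten_unit [simp]:
  "k < N \<Longrightarrow> arr f \<Longrightarrow> \<one> (\<I> k) \<boxtimes>[k] f = f" "k < N \<Longrightarrow> arr f \<Longrightarrow> f \<boxtimes>[k] \<one> (\<I> k) = f"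
  using strict_monoidal_category.mulA_unit[OF monoidal, of k f] by (simp_all add: monoidal_part_def)

definition PO :: "nat \<Rightarrow> ('i \<Rightarrow> 'o) \<Rightarrow> 'i list \<Rightarrow> 'o" where
  "PO k X is = fprod (\<lambda>A B. A \<otimes>[k] B) (\<I> k) X is"

definition PA :: "nat \<Rightarrow> ('i \<Rightarrow> 'a) \<Rightarrow> 'i list \<Rightarrow> 'a" where
  "PA k F is = fprod (\<lambda>f g. f \<boxtimes>[k] g) (\<one> (\<I> k)) F is"

lemma monoid_on_O: "k < N \<Longrightarrow> monoid_on (\<lambda>A B. A \<otimes>[k] B) (\<I> k) (objs M)"
  by (simp add: monoid_on_def)

lemma monoid_on_A: "k < N \<Longrightarrow> monoid_on (\<lambda>f g. f \<boxtimes>[k] g) (\<one> (\<I> k)) (arrs M)"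
  by (simp add: monoid_on_def)

lemma PO_simps [simp]: "PO k X [] = \<I> k" "PO k X (i # is) = X i \<otimes>[k] PO k X is"
  by (simp_all add: PO_def)

lemma PA_simps [simp]: "PA k F [] = \<one> (\<I> k)" "PA k F (i # is) = F i \<boxtimes>[k] PA k F is"
  by (simp_all add: PA_def)

lemma PO_ob [simp]: "k < N \<Longrightarrow> (\<And>i. ob (X i)) \<Longrightarrow> ob (PO k X is)"
  by (induction "is") auto

lemma PA_arr [simp]:
  assumes "k < N" "\<And>i. arr (F i)"
  shows "arr (PA k F is)" "dom (PA k F is) = PO k (\<lambda>i. dom (F i)) is"
    "cod (PA k F is) = PO k (\<lambda>i. cod (F i)) is"
proof -
  have "arr (PA k F is) \<and> dom (PA k F is) = PO k (\<lambda>i. dom (F i)) is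
    \<and> cod (PA k F is) = PO k (\<lambda>i. cod (F i)) is"
    using assms by (induction "is") auto
  then show "arr (PA k F is)" "dom (PA k F is) = PO k (\<lambda>i. dom (F i)) is"
    "cod (PA k F is) = PO k (\<lambda>i. cod (F i)) is" by auto
qed

lemma PA_idn: "k < N \<Longrightarrow> (\<And>i. ob (X i)) \<Longrightarrow> PA k (\<lambda>i. \<one> (X i)) is = \<one> (PO k X is)"
  by (induction "is") (auto simp: ten_idn)

lemma PA_cmp:
  "k < N \<Longrightarrow> (\<And>i. arr (F i)) \<Longrightarrow> (\<And>i. arr (G i)) \<Longrightarrow> (\<And>i. cod (F i) = dom (G i)) \<Longrightarrow>
    PA k (\<lambda>i. G i \<cdot> F i) is = PA k G is \<cdot> PA k F is"
  by (induction "is") (auto simp: ten_cmp)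

lemma PO_append: "k < N \<Longrightarrow> (\<And>i. ob (X i)) \<Longrightarrow> PO k X (is @ js) = PO k X is \<otimes>[k] PO k X js"
  by (induction "is") auto

lemma PA_append: "k < N \<Longrightarrow> (\<And>i. arr (F i)) \<Longrightarrow> PA k F (is @ js) = PA k F is \<boxtimes>[k] PA k F js"
  by (induction "is") auto

lemma PO_concat: "k < N \<Longrightarrow> (\<And>i. ob (X i)) \<Longrightarrow> PO k X (concat iss) = PO k (\<lambda>is. PO k X is) iss"
  by (induction iss) (auto simp: PO_append)

lemma PA_concat: "k < N \<Longrightarrow> (\<And>i. arr (F i)) \<Longrightarrow> PA k F (concat iss) = PA k (\<lambda>is. PA k F is) iss"
  by (induction iss) (auto simp: PA_append)

text \<open>
  For \<open>k < l\<close>, the arrows \<open>J0\<close> and \<open>J2\<close> make the iterated product \<open>X \<mapsto> PO l X js\<close> lax monoidal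
  with respect to \<open>\<otimes>[k]\<close>, and \<open>GG\<close> is the resulting comparison of \<open>\<otimes>[k]\<close>-products of
  \<open>\<otimes>[l]\<close>-products; for index lists of length at most 2 it is \<open>\<kappa>\<close>, \<open>\<beta>\<close>, \<open>\<tau>\<close>, \<open>\<iota>\<close> or an identity.
\<close>

primrec J0 :: "nat \<Rightarrow> nat \<Rightarrow> 'j list \<Rightarrow> 'a" where
  "J0 k l [] = \<kappa> k l"
| "J0 k l (j # js) = (\<one> (\<I> k) \<boxtimes>[l] J0 k l js) \<cdot> \<beta> k l"

primrec J2 :: "nat \<Rightarrow> nat \<Rightarrow> ('j \<Rightarrow> 'o) \<Rightarrow> ('j \<Rightarrow> 'o) \<Rightarrow> 'j list \<Rightarrow> 'a" where
  "J2 k l X Y [] = \<tau> k l"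
| "J2 k l X Y (j # js) = (\<one> (X j \<otimes>[k] Y j) \<boxtimes>[l] J2 k l X Y js)
     \<cdot> \<iota> k l (X j) (PO l X js) (Y j) (PO l Y js)"

primrec GG :: "nat \<Rightarrow> nat \<Rightarrow> ('i \<Rightarrow> 'j \<Rightarrow> 'o) \<Rightarrow> 'i list \<Rightarrow> 'j list \<Rightarrow> 'a" where
  "GG k l A [] js = J0 k l js"
| "GG k l A (i # is) js = J2 k l (A i) (\<lambda>j. PO k (\<lambda>i. A i j) is) js
     \<cdot> (\<one> (PO l (A i) js) \<boxtimes>[k] GG k l A is js)"

end

locale color_pair = N_fold_strict_monoidal_category N M
  for N :: nat and M :: "('o, 'a, 'm) multi_monoidal_scheme" (structure) +
  fixes k l :: nat
  assumes kl [simp]: "k < l" and lN [simp]: "l < N"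
begin

lemma kN [simp]: "k < N" using kl lN by linarith

lemma k_neq_l [simp]: "k \<noteq> l" "l \<noteq> k" using kl by (metis less_irrefl)+

sublocale pair_axioms M k l by (rule pair) simp_all

lemma pair_simps [simp]:
  "arr (\<kappa> k l)" "dom (\<kappa> k l) = \<I> k" "cod (\<kappa> k l) = \<I> l"
  "arr (\<beta> k l)" "dom (\<beta> k l) = \<I> k" "cod (\<beta> k l) = \<I> k \<otimes>[l] \<I> k"
  "arr (\<tau> k l)" "dom (\<tau> k l) = \<I> l \<otimes>[k] \<I> l" "cod (\<tau> k l) = \<I> l"
  using kap_hom bet_hom tau_hom by (auto simp: hom_def)

lemma iot_simps [simp]:
  assumes "ob A" "ob B" "ob C" "ob D"
  shows "arr (\<iota> k l A B C D)" "dom (\<iota> k l A B C D) = (A \<otimes>[l] B) \<otimes>[k] (C \<otimes>[l] D)"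
    "cod (\<iota> k l A B C D) = (A \<otimes>[k] C) \<otimes>[l] (B \<otimes>[k] D)"
  using iot_hom[of A B C D] assms by (auto simp: hom_def)

lemma iot_nat:
  assumes "arr f1" "arr f2" "arr f3" "arr f4"
    "cod f1 = A'" "cod f2 = B'" "cod f3 = C'" "cod f4 = D'"
  shows "\<iota> k l A' B' C' D' \<cdot> ((f1 \<boxtimes>[l] f2) \<boxtimes>[k] (f3 \<boxtimes>[l] f4))
        = ((f1 \<boxtimes>[k] f3) \<boxtimes>[l] (f2 \<boxtimes>[k] f4)) \<cdot> \<iota> k l (dom f1) (dom f2) (dom f3) (dom f4)"
  by (rule iot_natural) (use assms in \<open>auto simp: hom_def\<close>)

lemma iot_nat2:
  assumes "arr f1" "arr f2" "arr f3" "arr f4" "arr h"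
    "cod f1 = A'" "cod f2 = B'" "cod f3 = C'" "cod f4 = D'"
    "cod h = (dom f1 \<otimes>[l] dom f2) \<otimes>[k] (dom f3 \<otimes>[l] dom f4)"
  shows "\<iota> k l A' B' C' D' \<cdot> ((f1 \<boxtimes>[l] f2) \<boxtimes>[k] (f3 \<boxtimes>[l] f4)) \<cdot> h
        = ((f1 \<boxtimes>[k] f3) \<boxtimes>[l] (f2 \<boxtimes>[k] f4)) \<cdot> \<iota> k l (dom f1) (dom f2) (dom f3) (dom f4) \<cdot> h"
proof -
  have "\<iota> k l A' B' C' D' \<cdot> ((f1 \<boxtimes>[l] f2) \<boxtimes>[k] (f3 \<boxtimes>[l] f4)) \<cdot> h
      = (\<iota> k l A' B' C' D' \<cdot> ((f1 \<boxtimes>[l] f2) \<boxtimes>[k] (f3 \<boxtimes>[l] f4))) \<cdot> h"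
    using assms by auto
  then show ?thesis
    unfolding iot_nat[OF assms(1-4,6-9)] using assms by auto
qed

section \<open>Unit and associativity laws of the lax multiplication\<close>

lemma J0_simps [simp]:
  "arr (J0 k l js)" "dom (J0 k l js) = \<I> k" "cod (J0 k l js) = PO l (\<lambda>_. \<I> k) js"
proof -
  have "arr (J0 k l js) \<and> dom (J0 k l js) = \<I> k \<and> cod (J0 k l js) = PO l (\<lambda>_. \<I> k) js"
    by (induction js) auto
  then show "arr (J0 k l js)" "dom (J0 k l js) = \<I> k" "cod (J0 k l js) = PO l (\<lambda>_. \<I> k) js" by auto
qed

lemma J2_simps [simp]:
  assumes "\<And>j. ob (X j)" "\<And>j. ob (Y j)"
  shows "arr (J2 k l X Y js)" "dom (J2 k l X Y js) = PO l X js \<otimes>[k] PO l Y js"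
    "cod (J2 k l X Y js) = PO l (\<lambda>j. X j \<otimes>[k] Y j) js"
proof -
  have "arr (J2 k l X Y js) \<and> dom (J2 k l X Y js) = PO l X js \<otimes>[k] PO l Y js
    \<and> cod (J2 k l X Y js) = PO l (\<lambda>j. X j \<otimes>[k] Y j) js"
    using assms by (induction js) auto
  then show "arr (J2 k l X Y js)" "dom (J2 k l X Y js) = PO l X js \<otimes>[k] PO l Y js"
    "cod (J2 k l X Y js) = PO l (\<lambda>j. X j \<otimes>[k] Y j) js" by auto
qed

lemma GG_simps [simp]:
  assumes "\<And>i j. ob (A i j)"
  shows "arr (GG k l A is js)" "dom (GG k l A is js) = PO k (\<lambda>i. PO l (A i) js) is"
    "cod (GG k l A is js) = PO l (\<lambda>j. PO k (\<lambda>i. A i j) is) js"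
proof -
  have "arr (GG k l A is js) \<and> dom (GG k l A is js) = PO k (\<lambda>i. PO l (A i) js) is
    \<and> cod (GG k l A is js) = PO l (\<lambda>j. PO k (\<lambda>i. A i j) is) js"
    using assms by (induction "is") auto
  then show "arr (GG k l A is js)" "dom (GG k l A is js) = PO k (\<lambda>i. PO l (A i) js) is"
    "cod (GG k l A is js) = PO l (\<lambda>j. PO k (\<lambda>i. A i j) is) js" by auto
qed

text \<open>Base case \<open>ax5\<close>. In the step, naturality carries the inner
  \<open>J0\<close> across \<iota>, which leaves exactly the composite of \<iota> and \<beta> that
  \<open>ax2\<close> cancels.\<close>

lemma J2_unit_right:
  assumes X: "\<And>j. ob (X j)"
  shows "J2 k l X (\<lambda>_. \<I> k) js \<cdot> (\<one> (PO l X js) \<boxtimes>[k] J0 k l js) = \<one> (PO l X js)"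
proof (induction js)
  case Nil
  then show ?case using ax5 by simp
next
  case (Cons j js)
  let ?x = "X j" and ?P = "PO l X js" and ?J = "J2 k l X (\<lambda>_. \<I> k) js"
  have "(\<one> ?x \<boxtimes>[l] \<one> ?P) \<boxtimes>[k] ((\<one> (\<I> k) \<boxtimes>[l] J0 k l js) \<cdot> \<beta> k l)
     = ((\<one> ?x \<boxtimes>[l] \<one> ?P) \<boxtimes>[k] (\<one> (\<I> k) \<boxtimes>[l] J0 k l js)) \<cdot> ((\<one> ?x \<boxtimes>[l] \<one> ?P) \<boxtimes>[k] \<beta> k l)"
    using X by (subst ten_cmp) (auto simp: ten_idn)
  then have "J2 k l X (\<lambda>_. \<I> k) (j # js) \<cdot> (\<one> (PO l X (j # js)) \<boxtimes>[k] J0 k l (j # js))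
    = (\<one> ?x \<boxtimes>[l] ?J) \<cdot> \<iota> k l ?x ?P (\<I> k) (PO l (\<lambda>_. \<I> k) js) \<cdot>
      (((\<one> ?x \<boxtimes>[l] \<one> ?P) \<boxtimes>[k] (\<one> (\<I> k) \<boxtimes>[l] J0 k l js)) \<cdot> ((\<one> ?x \<boxtimes>[l] \<one> ?P) \<boxtimes>[k] \<beta> k l))"
    using X by (simp add: ten_idn)
  also have "\<dots> = (\<one> ?x \<boxtimes>[l] ?J) \<cdot> (\<one> ?x \<boxtimes>[l] (\<one> ?P \<boxtimes>[k] J0 k l js)) \<cdot>
       \<iota> k l ?x ?P (\<I> k) (\<I> k) \<cdot> (\<one> (?x \<otimes>[l] ?P) \<boxtimes>[k] \<beta> k l)"
    using X by (subst iot_nat2) (auto simp: ten_idn)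
  also have "\<dots> = (\<one> ?x \<boxtimes>[l] ?J) \<cdot> (\<one> ?x \<boxtimes>[l] (\<one> ?P \<boxtimes>[k] J0 k l js))"
    using X by (subst ax2) auto
  also have "\<dots> = \<one> ?x \<boxtimes>[l] \<one> ?P"
    using X by (simp add: ten_cmp Cons.IH)
  finally show ?case using X by (simp add: ten_idn)
qed

text \<open>Mirror image, from \<open>ax6\<close> and \<open>ax3\<close>; it is what
  \<open>GG_append_left\<close> needs when its first list is empty.\<close>

lemma J2_unit_left:
  assumes X: "\<And>j. ob (X j)"
  shows "J2 k l (\<lambda>_. \<I> k) X js \<cdot> (J0 k l js \<boxtimes>[k] \<one> (PO l X js)) = \<one> (PO l X js)"
proof (induction js)
  case Nil
  then show ?case using ax6 by simp
next
  case (Cons j js)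
  let ?x = "X j" and ?P = "PO l X js" and ?J = "J2 k l (\<lambda>_. \<I> k) X js"
  have "((\<one> (\<I> k) \<boxtimes>[l] J0 k l js) \<cdot> \<beta> k l) \<boxtimes>[k] (\<one> ?x \<boxtimes>[l] \<one> ?P)
     = ((\<one> (\<I> k) \<boxtimes>[l] J0 k l js) \<boxtimes>[k] (\<one> ?x \<boxtimes>[l] \<one> ?P)) \<cdot> (\<beta> k l \<boxtimes>[k] (\<one> ?x \<boxtimes>[l] \<one> ?P))"
    using X by (subst ten_cmp) (auto simp: ten_idn)
  then have "J2 k l (\<lambda>_. \<I> k) X (j # js) \<cdot> (J0 k l (j # js) \<boxtimes>[k] \<one> (PO l X (j # js)))
    = (\<one> ?x \<boxtimes>[l] ?J) \<cdot> \<iota> k l (\<I> k) (PO l (\<lambda>_. \<I> k) js) ?x ?P \<cdot>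
      (((\<one> (\<I> k) \<boxtimes>[l] J0 k l js) \<boxtimes>[k] (\<one> ?x \<boxtimes>[l] \<one> ?P)) \<cdot> (\<beta> k l \<boxtimes>[k] (\<one> ?x \<boxtimes>[l] \<one> ?P)))"
    using X by (simp add: ten_idn)
  also have "\<dots> = (\<one> ?x \<boxtimes>[l] ?J) \<cdot> (\<one> ?x \<boxtimes>[l] (J0 k l js \<boxtimes>[k] \<one> ?P)) \<cdot>
       \<iota> k l (\<I> k) (\<I> k) ?x ?P \<cdot> (\<beta> k l \<boxtimes>[k] \<one> (?x \<otimes>[l] ?P))"
    using X by (subst iot_nat2) (auto simp: ten_idn)
  also have "\<dots> = (\<one> ?x \<boxtimes>[l] ?J) \<cdot> (\<one> ?x \<boxtimes>[l] (J0 k l js \<boxtimes>[k] \<one> ?P))"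
    using X by (subst ax3) auto
  also have "\<dots> = \<one> ?x \<boxtimes>[l] \<one> ?P"
    using X by (simp add: ten_cmp Cons.IH)
  finally show ?case using X by (simp add: ten_idn)
qed

lemma J2_nat:
  assumes [simp]: "\<And>j. arr (F j)" "\<And>j. arr (G j)"
  shows "J2 k l (\<lambda>j. cod (F j)) (\<lambda>j. cod (G j)) js \<cdot> (PA l F js \<boxtimes>[k] PA l G js)
    = PA l (\<lambda>j. F j \<boxtimes>[k] G j) js \<cdot> J2 k l (\<lambda>j. dom (F j)) (\<lambda>j. dom (G j)) js"
proof (induction js)
  case (Cons j js)
  show ?case
    by (simp add: iot_nat ten_cmp2 Cons.IH)
qed (simp add: ten_idn)

text \<open>Base \<open>ax4\<close>, step \<open>ax1\<close>. On both sides naturality of \<iota>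
  collects everything that concerns the tail \<open>js\<close> in the second factor of \<otimes>[l],
  where the induction hypothesis applies.\<close>

lemma J2_assoc:
  assumes [simp]: "\<And>j. ob (X j)" "\<And>j. ob (Y j)" "\<And>j. ob (Z j)"
  shows "J2 k l X (\<lambda>j. Y j \<otimes>[k] Z j) js \<cdot> (\<one> (PO l X js) \<boxtimes>[k] J2 k l Y Z js)
    = J2 k l (\<lambda>j. X j \<otimes>[k] Y j) Z js \<cdot> (J2 k l X Y js \<boxtimes>[k] \<one> (PO l Z js))"
proof (induction js)
  case Nil
  then show ?case using ax4 by simp
next
  case (Cons j js)
  let ?x = "X j" and ?y = "Y j" and ?z = "Z j"
  let ?X = "PO l X js" and ?Y = "PO l Y js" and ?Z = "PO l Z js"
  let ?YZ = "PO l (\<lambda>j. Y j \<otimes>[k] Z j) js" and ?XY = "PO l (\<lambda>j. X j \<otimes>[k] Y j) js"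
  let ?J1 = "J2 k l X (\<lambda>j. Y j \<otimes>[k] Z j) js" and ?J2 = "J2 k l Y Z js"
  let ?J3 = "J2 k l (\<lambda>j. X j \<otimes>[k] Y j) Z js" and ?J4 = "J2 k l X Y js"
  have "J2 k l X (\<lambda>j. Y j \<otimes>[k] Z j) (j # js) \<cdot> (\<one> (PO l X (j # js)) \<boxtimes>[k] J2 k l Y Z (j # js))
    = (\<one> (?x \<otimes>[k] (?y \<otimes>[k] ?z)) \<boxtimes>[l] ?J1) \<cdot> \<iota> k l ?x ?X (?y \<otimes>[k] ?z) ?YZ
      \<cdot> ((\<one> ?x \<boxtimes>[l] \<one> ?X) \<boxtimes>[k] (\<one> (?y \<otimes>[k] ?z) \<boxtimes>[l] ?J2)) \<cdot> (\<one> (?x \<otimes>[l] ?X) \<boxtimes>[k] \<iota> k l ?y ?Y ?z ?Z)"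
    by (simp add: ten_cmp ten_idn)
  also have "\<dots> = (\<one> (?x \<otimes>[k] (?y \<otimes>[k] ?z)) \<boxtimes>[l] (?J1 \<cdot> (\<one> ?X \<boxtimes>[k] ?J2)))
     \<cdot> \<iota> k l ?x ?X (?y \<otimes>[k] ?z) (?Y \<otimes>[k] ?Z) \<cdot> (\<one> (?x \<otimes>[l] ?X) \<boxtimes>[k] \<iota> k l ?y ?Y ?z ?Z)"
    by (subst iot_nat2) (auto simp: ten_idn ten_cmp2)
  also have "\<dots> = (\<one> (?x \<otimes>[k] (?y \<otimes>[k] ?z)) \<boxtimes>[l] (?J3 \<cdot> (?J4 \<boxtimes>[k] \<one> ?Z)))
     \<cdot> \<iota> k l (?x \<otimes>[k] ?y) (?X \<otimes>[k] ?Y) ?z ?Z \<cdot> (\<iota> k l ?x ?X ?y ?Y \<boxtimes>[k] \<one> (?z \<otimes>[l] ?Z))"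
    by (subst ax1) (auto simp: Cons.IH)
  also have "\<dots> = (\<one> (?x \<otimes>[k] (?y \<otimes>[k] ?z)) \<boxtimes>[l] ?J3) \<cdot> \<iota> k l (?x \<otimes>[k] ?y) ?XY ?z ?Z
     \<cdot> ((\<one> (?x \<otimes>[k] ?y) \<boxtimes>[l] ?J4) \<boxtimes>[k] (\<one> ?z \<boxtimes>[l] \<one> ?Z)) \<cdot> (\<iota> k l ?x ?X ?y ?Y \<boxtimes>[k] \<one> (?z \<otimes>[l] ?Z))"
    by (subst iot_nat2) (auto simp: ten_idn ten_cmp2)
  also have "\<dots> = J2 k l (\<lambda>j. X j \<otimes>[k] Y j) Z (j # js) \<cdot> (J2 k l X Y (j # js) \<boxtimes>[k] \<one> (PO l Z (j # js)))"
    by (simp add: ten_cmp ten_idn)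
  finally show ?case .
qed

end

section \<open>Cutting index lists, and the values on short lists\<close>

context color_pair
begin

text \<open>Coassociativity \<open>ax10\<close> of \<beta> moves the cut by one index; the counit
  law \<open>ax12\<close> starts the induction at an empty first list.\<close>

lemma J0_append: "J0 k l (js @ js') = (J0 k l js \<boxtimes>[l] J0 k l js') \<cdot> \<beta> k l"
proof (induction js)
  case Nil
  have "(\<kappa> k l \<boxtimes>[l] J0 k l js') \<cdot> \<beta> k l
      = (\<one> (\<I> l) \<boxtimes>[l] J0 k l js') \<cdot> (\<kappa> k l \<boxtimes>[l] \<one> (\<I> k)) \<cdot> \<beta> k l"
    by (subst ten_cmp2) auto
  then show ?case using ax12 by simp
next
  case (Cons j js)
  have "J0 k l ((j # js) @ js')
      = (\<one> (\<I> k) \<boxtimes>[l] (J0 k l js \<boxtimes>[l] J0 k l js')) \<cdot> (\<one> (\<I> k) \<boxtimes>[l] \<beta> k l) \<cdot> \<beta> k l"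
    by (subst ten_cmp2) (auto simp: Cons.IH)
  also have "\<dots> = ((\<one> (\<I> k) \<boxtimes>[l] J0 k l js) \<boxtimes>[l] J0 k l js') \<cdot> (\<beta> k l \<boxtimes>[l] \<one> (\<I> k)) \<cdot> \<beta> k l"
    using ax10 by simp
  also have "\<dots> = (J0 k l (j # js) \<boxtimes>[l] J0 k l js') \<cdot> \<beta> k l"
    by (subst ten_cmp2) auto
  finally show ?case .
qed

text \<open>The same pattern for \<iota>: \<open>ax7\<close> moves the cut by one index and
  \<open>ax9\<close> treats the empty first list.\<close>

lemma J2_append:
  assumes [simp]: "\<And>j. ob (X j)" "\<And>j. ob (Y j)"
  shows "J2 k l X Y (js @ js') = (J2 k l X Y js \<boxtimes>[l] J2 k l X Y js')
    \<cdot> \<iota> k l (PO l X js) (PO l X js') (PO l Y js) (PO l Y js')"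
proof (induction js)
  case Nil
  let ?X = "PO l X js'" and ?Y = "PO l Y js'"
  have "(\<tau> k l \<boxtimes>[l] J2 k l X Y js') \<cdot> \<iota> k l (\<I> l) ?X (\<I> l) ?Y
      = (\<one> (\<I> l) \<boxtimes>[l] J2 k l X Y js') \<cdot> (\<tau> k l \<boxtimes>[l] \<one> (?X \<otimes>[k] ?Y)) \<cdot> \<iota> k l (\<I> l) ?X (\<I> l) ?Y"
    by (subst ten_cmp2) auto
  then show ?case using ax9[of ?X ?Y] by simp
next
  case (Cons j js)
  let ?X = "PO l X js" and ?Y = "PO l Y js" and ?X' = "PO l X js'" and ?Y' = "PO l Y js'"
  let ?x = "X j" and ?y = "Y j" and ?J = "J2 k l X Y js" and ?J' = "J2 k l X Y js'"
  have "J2 k l X Y ((j # js) @ js')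
      = (\<one> (?x \<otimes>[k] ?y) \<boxtimes>[l] (?J \<boxtimes>[l] ?J')) \<cdot> (\<one> (?x \<otimes>[k] ?y) \<boxtimes>[l] \<iota> k l ?X ?X' ?Y ?Y')
         \<cdot> \<iota> k l ?x (?X \<otimes>[l] ?X') ?y (?Y \<otimes>[l] ?Y')"
    by (subst ten_cmp2) (auto simp: Cons.IH PO_append)
  also have "\<dots> = ((\<one> (?x \<otimes>[k] ?y) \<boxtimes>[l] ?J) \<boxtimes>[l] ?J') \<cdot> (\<iota> k l ?x ?X ?y ?Y \<boxtimes>[l] \<one> (?X' \<otimes>[k] ?Y'))
         \<cdot> \<iota> k l (?x \<otimes>[l] ?X) ?X' (?y \<otimes>[l] ?Y) ?Y'"
    by (subst ax7) auto
  also have "\<dots> = (J2 k l X Y (j # js) \<boxtimes>[l] ?J') \<cdot> \<iota> k l (?x \<otimes>[l] ?X) ?X' (?y \<otimes>[l] ?Y) ?Y'"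
    by (subst ten_cmp2) auto
  finally show ?case by simp
qed

lemma J0_concat: "J0 k l (concat jss) = PA l (J0 k l) jss \<cdot> J0 k l jss"
proof (induction jss)
  case (Cons js jss)
  then show ?case by (simp add: J0_append ten_cmp2)
qed simp

lemma J2_concat:
  assumes [simp]: "\<And>j. ob (X j)" "\<And>j. ob (Y j)"
  shows "J2 k l X Y (concat jss) = PA l (J2 k l X Y) jss \<cdot> J2 k l (PO l X) (PO l Y) jss"
proof (induction jss)
  case (Cons js jss)
  then show ?case by (simp add: J2_append ten_cmp2 PO_concat)
qed simp

lemma GG_nat:
  assumes [simp]: "\<And>i j. arr (F i j)"
  shows "GG k l (\<lambda>i j. cod (F i j)) is js \<cdot> PA k (\<lambda>i. PA l (F i) js) is
    = PA l (\<lambda>j. PA k (\<lambda>i. F i j) is) js \<cdot> GG k l (\<lambda>i j. dom (F i j)) is js"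
proof (induction "is")
  case Nil
  show ?case by (simp add: PA_idn)
next
  case (Cons i "is")
  let ?F = "PA l (F i) js" and ?C = "\<lambda>j. PA k (\<lambda>i. F i j) is"
  let ?G = "GG k l (\<lambda>i j. dom (F i j)) is js"
  have "GG k l (\<lambda>i j. cod (F i j)) (i # is) js \<cdot> PA k (\<lambda>i. PA l (F i) js) (i # is)
    = J2 k l (\<lambda>j. cod (F i j)) (\<lambda>j. cod (?C j)) js \<cdot> (?F \<boxtimes>[k] PA l ?C js) \<cdot> (\<one> (dom ?F) \<boxtimes>[k] ?G)"
    by (simp add: ten_cmp Cons.IH)
  also have "\<dots> = (J2 k l (\<lambda>j. cod (F i j)) (\<lambda>j. cod (?C j)) js \<cdot> (?F \<boxtimes>[k] PA l ?C js))
      \<cdot> (\<one> (dom ?F) \<boxtimes>[k] ?G)"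
    by (subst cmp_assoc') auto
  also have "\<dots> = (PA l (\<lambda>j. F i j \<boxtimes>[k] ?C j) js \<cdot> J2 k l (\<lambda>j. dom (F i j)) (\<lambda>j. dom (?C j)) js)
      \<cdot> (\<one> (dom ?F) \<boxtimes>[k] ?G)"
    by (subst J2_nat) auto
  finally show ?case by simp
qed

text \<open>Only the monoidal laws of \<open>J2\<close> are needed: \<open>J2_unit_left\<close> for
  the empty list and \<open>J2_assoc\<close> for each further index.\<close>

lemma GG_append_left:
  assumes [simp]: "\<And>i j. ob (A i j)"
  shows "GG k l A (is @ is') js = J2 k l (\<lambda>j. PO k (\<lambda>i. A i j) is) (\<lambda>j. PO k (\<lambda>i. A i j) is') js
    \<cdot> (GG k l A is js \<boxtimes>[k] GG k l A is' js)"
proof (induction "is")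
  case Nil
  let ?C = "\<lambda>j. PO k (\<lambda>i. A i j) is'"
  have "J2 k l (\<lambda>_. \<I> k) ?C js \<cdot> (J0 k l js \<boxtimes>[k] GG k l A is' js)
     = J2 k l (\<lambda>_. \<I> k) ?C js \<cdot> (J0 k l js \<boxtimes>[k] \<one> (PO l ?C js)) \<cdot> (\<one> (\<I> k) \<boxtimes>[k] GG k l A is' js)"
    by (subst ten_cmp) auto
  also have "\<dots> = (J2 k l (\<lambda>_. \<I> k) ?C js \<cdot> (J0 k l js \<boxtimes>[k] \<one> (PO l ?C js))) \<cdot> GG k l A is' js"
    by (subst cmp_assoc') auto
  finally show ?case by (subst (asm) J2_unit_left) auto
next
  case (Cons i "is")
  let ?C = "\<lambda>j. PO k (\<lambda>i. A i j) is" and ?C' = "\<lambda>j. PO k (\<lambda>i. A i j) is'"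
  let ?G = "GG k l A is js" and ?G' = "GG k l A is' js" and ?P = "PO l (A i) js"
  have "GG k l A ((i # is) @ is') js
      = J2 k l (A i) (\<lambda>j. ?C j \<otimes>[k] ?C' j) js \<cdot> (\<one> ?P \<boxtimes>[k] J2 k l ?C ?C' js) \<cdot> (\<one> ?P \<boxtimes>[k] (?G \<boxtimes>[k] ?G'))"
    by (subst ten_cmp) (auto simp: Cons.IH PO_append)
  also have "\<dots> = (J2 k l (A i) (\<lambda>j. ?C j \<otimes>[k] ?C' j) js \<cdot> (\<one> ?P \<boxtimes>[k] J2 k l ?C ?C' js))
      \<cdot> (\<one> ?P \<boxtimes>[k] (?G \<boxtimes>[k] ?G'))"
    by (subst cmp_assoc') auto
  also have "\<dots> = J2 k l (\<lambda>j. A i j \<otimes>[k] ?C j) ?C' js \<cdot> (J2 k l (A i) ?C js \<boxtimes>[k] \<one> (PO l ?C' js))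
      \<cdot> ((\<one> ?P \<boxtimes>[k] ?G) \<boxtimes>[k] ?G')"
    by (subst J2_assoc) auto
  also have "\<dots> = J2 k l (\<lambda>j. A i j \<otimes>[k] ?C j) ?C' js \<cdot> (GG k l A (i # is) js \<boxtimes>[k] ?G')"
    by (subst ten_cmp) auto
  finally show ?case by simp
qed

lemma GG_concat_left:
  assumes [simp]: "\<And>i j. ob (A i j)"
  shows "GG k l A (concat iss) js
    = GG k l (\<lambda>is j. PO k (\<lambda>i. A i j) is) iss js \<cdot> PA k (\<lambda>is. GG k l A is js) iss"
proof (induction iss)
  case (Cons "is" iss)
  then show ?case by (simp add: GG_append_left ten_cmp PO_concat)
qed simp

text \<open>\<open>GG\<close> recurses on the other list, so the blocks of \<open>jss\<close> have
  to be pulled through every layer: \<open>J0_concat\<close> and \<open>J2_concat\<close> cut a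
  layer into blocks, and naturality of \<open>J2\<close> slides the blocks of the remaining layers
  past it.\<close>

lemma GG_concat_right:
  assumes [simp]: "\<And>i j. ob (A i j)"
  shows "GG k l A is (concat jss)
    = PA l (\<lambda>js. GG k l A is js) jss \<cdot> GG k l (\<lambda>i js. PO l (A i) js) is jss"
proof (induction "is")
  case Nil
  show ?case by (simp add: J0_concat)
next
  case (Cons i "is")
  let ?C = "\<lambda>j. PO k (\<lambda>i. A i j) is" and ?P = "PO l (A i)"
  let ?Q = "\<lambda>js. PO k (\<lambda>i. PO l (A i) js) is"
  let ?G = "GG k l A is" and ?G' = "GG k l (\<lambda>i js. PO l (A i) js) is jss"
  have nat: "J2 k l ?P (PO l ?C) jss \<cdot> (\<one> (PO l ?P jss) \<boxtimes>[k] PA l ?G jss)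
      = PA l (\<lambda>js. \<one> (?P js) \<boxtimes>[k] ?G js) jss \<cdot> J2 k l ?P ?Q jss"
    using J2_nat[of "\<lambda>js. \<one> (?P js)" ?G jss] by (simp add: PA_idn)
  have "GG k l A (i # is) (concat jss)
     = PA l (J2 k l (A i) ?C) jss \<cdot> J2 k l ?P (PO l ?C) jss \<cdot>
       (\<one> (PO l ?P jss) \<boxtimes>[k] PA l ?G jss) \<cdot> (\<one> (PO l ?P jss) \<boxtimes>[k] ?G')"
    by (subst ten_cmp) (auto simp: Cons.IH PO_concat J2_concat)
  also have "\<dots> = PA l (J2 k l (A i) ?C) jss \<cdot> (J2 k l ?P (PO l ?C) jss \<cdot>
       (\<one> (PO l ?P jss) \<boxtimes>[k] PA l ?G jss)) \<cdot> (\<one> (PO l ?P jss) \<boxtimes>[k] ?G')"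
    by (subst cmp_assoc'[where h = "J2 k l ?P (PO l ?C) jss"]) auto
  also have "\<dots> = PA l (\<lambda>js. J2 k l (A i) ?C js \<cdot> (\<one> (?P js) \<boxtimes>[k] ?G js)) jss \<cdot> J2 k l ?P ?Q jss
      \<cdot> (\<one> (PO l ?P jss) \<boxtimes>[k] ?G')"
    unfolding nat by (subst PA_cmp) auto
  finally show ?case by simp
qed

text \<open>A single row leaves nothing to interchange; what \<open>J0\<close> contributes for the
  empty rest of the list cancels by the unit law of \<open>J2\<close>.\<close>

lemma GG_single_left:
  "(\<And>i j. ob (A i j)) \<Longrightarrow> GG k l A [i] js = \<one> (PO l (A i) js)"
  by (simp add: J2_unit_right)

lemma J0_single: "J0 k l [j] = \<one> (\<I> k)"
  using ax11 by simp

lemma J2_single: "(\<And>j. ob (X j)) \<Longrightarrow> (\<And>j. ob (Y j)) \<Longrightarrow> J2 k l X Y [j] = \<one> (X j \<otimes>[k] Y j)"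
  using ax8[of "X j" "Y j"] by simp

text \<open>For a single column the cancellation is given directly by \<open>ax11\<close> and
  \<open>ax8\<close>, through \<open>J0_single\<close> and \<open>J2_single\<close>.\<close>

lemma GG_single_right:
  "(\<And>i j. ob (A i j)) \<Longrightarrow> GG k l A is [j] = \<one> (PO k (\<lambda>i. A i j) is)"
proof (induction "is")
  case Nil
  show ?case by (simp add: J0_single del: J0.simps)
next
  case (Cons i "is")
  then show ?case by (simp add: J2_single ten_idn del: J2.simps)
qed

text \<open>The link to the given data: a basic map has intervals of length at most two, so these
  four values and the one-element lists account for every component of \<open>chi\<close>.\<close>

lemma GG_units:
  assumes [simp]: "\<And>i j. ob (A i j)"
  shows "GG k l A [] [] = \<kappa> k l" "GG k l A [i, i'] [] = \<tau> k l" "GG k l A [] [j, j'] = \<beta> k l"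
    "GG k l A [i, i'] [j, j'] = \<iota> k l (A i j) (A i j') (A i' j) (A i' j')"
proof -
  have *: "GG k l A [i, i'] js = J2 k l (A i) (A i') js" for js
    using GG_single_left[of A i' js] by (simp add: ten_idn)
  show "GG k l A [i, i'] [] = \<tau> k l" by (simp add: * del: GG.simps)
  show "GG k l A [i, i'] [j, j'] = \<iota> k l (A i j) (A i j') (A i' j) (A i' j')"
    using J2_append[of "A i" "A i'" "[j]" "[j']"] J2_single[of "A i" "A i'"]
    by (simp add: * ten_idn del: GG.simps J2.simps)
  show "GG k l A [] [j, j'] = \<beta> k l"
    using J0_append[of "[j]" "[j']"] by (simp add: J0_single ten_idn del: J0.simps)
qed simp

end

section \<open>Coherence for three monoidal structures\<close>

locale color_triple = N_fold_strict_monoidal_category N M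
  for N :: nat and M :: "('o, 'a, 'm) multi_monoidal_scheme" (structure) +
  fixes a b c :: nat
  assumes abN [simp]: "a < b" and bcN [simp]: "b < c" and cN [simp]: "c < N"
begin

lemma acN [simp]: "a < c" and bN [simp]: "b < N" and aN [simp]: "a < N"
  using abN bcN cN by linarith+

sublocale ab: color_pair N M a b by unfold_locales simp_all
sublocale ac: color_pair N M a c by unfold_locales simp_all
sublocale bc: color_pair N M b c by unfold_locales simp_all
sublocale triple_axioms M a b c by (rule triple) simp_all

text \<open>The digits in this name and the next three are the lengths of the lists in colours
  \<open>a\<close> and \<open>b\<close>, while the list \<open>hs\<close> of colour \<open>c\<close>
  is arbitrary. Here \<open>ax13\<close> is the case of empty \<open>hs\<close>, and
  \<open>ax14\<close> adds one index.\<close>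

lemma hex_00: "J0 b c hs \<cdot> \<kappa> a b = PA c (\<lambda>_. \<kappa> a b) hs \<cdot> J0 a c hs"
proof (induction hs)
  case Nil
  show ?case using ax13 by simp
next
  case (Cons h hs)
  have "J0 b c (h # hs) \<cdot> \<kappa> a b = (\<one> (\<I> b) \<boxtimes>[c] J0 b c hs) \<cdot> (\<kappa> a b \<boxtimes>[c] \<kappa> a b) \<cdot> \<beta> a c"
    using ax14 by simp
  also have "\<dots> = (\<kappa> a b \<boxtimes>[c] PA c (\<lambda>_. \<kappa> a b) hs) \<cdot> (\<one> (\<I> a) \<boxtimes>[c] J0 a c hs) \<cdot> \<beta> a c"
    by (simp add: ten_cmp2 Cons.IH)
  finally show ?case by simp
qed

text \<open>From \<open>ax15\<close> and \<open>ax16\<close>: naturality brings \<iota> of colours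
  \<open>b\<close> and \<open>c\<close> back to the unit objects at which \<open>ax16\<close>
  speaks.\<close>

lemma hex_02: "J2 b c (\<lambda>_. \<I> a) (\<lambda>_. \<I> a) hs \<cdot> (J0 a c hs \<boxtimes>[b] J0 a c hs) \<cdot> \<beta> a b
    = PA c (\<lambda>_. \<beta> a b) hs \<cdot> J0 a c hs"
proof (induction hs)
  case Nil
  show ?case using ax15 by simp
next
  case (Cons h hs)
  let ?I = "\<I> a" and ?J = "J0 a c hs" and ?K = "J2 b c (\<lambda>_. \<I> a) (\<lambda>_. \<I> a) hs"
  let ?P = "PO c (\<lambda>_. \<I> a) hs"
  have "J2 b c (\<lambda>_. ?I) (\<lambda>_. ?I) (h # hs) \<cdot> (J0 a c (h # hs) \<boxtimes>[b] J0 a c (h # hs)) \<cdot> \<beta> a b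
    = (\<one> (?I \<otimes>[b] ?I) \<boxtimes>[c] ?K) \<cdot> \<iota> b c ?I ?P ?I ?P
      \<cdot> ((\<one> ?I \<boxtimes>[c] ?J) \<boxtimes>[b] (\<one> ?I \<boxtimes>[c] ?J)) \<cdot> (\<beta> a c \<boxtimes>[b] \<beta> a c) \<cdot> \<beta> a b"
    by (simp add: ten_cmp2)
  also have "\<dots> = (\<one> (?I \<otimes>[b] ?I) \<boxtimes>[c] (?K \<cdot> (?J \<boxtimes>[b] ?J))) \<cdot> \<iota> b c ?I ?I ?I ?I \<cdot> (\<beta> a c \<boxtimes>[b] \<beta> a c) \<cdot> \<beta> a b"
    by (subst bc.iot_nat2) (auto simp: ten_idn ten_cmp2)
  also have "\<dots> = (\<one> (?I \<otimes>[b] ?I) \<boxtimes>[c] (?K \<cdot> (?J \<boxtimes>[b] ?J))) \<cdot> (\<beta> a b \<boxtimes>[c] \<beta> a b) \<cdot> \<beta> a c"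
    by (subst ax16) auto
  also have "\<dots> = (\<beta> a b \<boxtimes>[c] PA c (\<lambda>_. \<beta> a b) hs) \<cdot> (\<one> ?I \<boxtimes>[c] ?J) \<cdot> \<beta> a c"
    by (simp add: ten_cmp2 Cons.IH)
  finally show ?case by simp
qed

text \<open>From \<open>ax17\<close> and \<open>ax18\<close>; here \<iota> first appears at unit
  objects, and naturality leads away from them.\<close>

lemma hex_20: "J0 b c hs \<cdot> \<tau> a b
    = PA c (\<lambda>_. \<tau> a b) hs \<cdot> J2 a c (\<lambda>_. \<I> b) (\<lambda>_. \<I> b) hs \<cdot> (J0 b c hs \<boxtimes>[a] J0 b c hs)"
proof (induction hs)
  case Nil
  show ?case using ax17 by simp
next
  case (Cons h hs)
  let ?I = "\<I> b" and ?J = "J0 b c hs" and ?K = "J2 a c (\<lambda>_. \<I> b) (\<lambda>_. \<I> b) hs"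
  let ?P = "PO c (\<lambda>_. \<I> b) hs" and ?T = "PA c (\<lambda>_. \<tau> a b) hs"
  have "J0 b c (h # hs) \<cdot> \<tau> a b
    = (\<one> ?I \<boxtimes>[c] ?J) \<cdot> (\<tau> a b \<boxtimes>[c] \<tau> a b) \<cdot> \<iota> a c ?I ?I ?I ?I \<cdot> (\<beta> b c \<boxtimes>[a] \<beta> b c)"
    using ax18 by simp
  also have "\<dots> = (\<tau> a b \<boxtimes>[c] (?T \<cdot> ?K)) \<cdot> (\<one> (?I \<otimes>[a] ?I) \<boxtimes>[c] (?J \<boxtimes>[a] ?J))
      \<cdot> \<iota> a c ?I ?I ?I ?I \<cdot> (\<beta> b c \<boxtimes>[a] \<beta> b c)"
    by (simp add: ten_cmp2 Cons.IH)
  also have "\<dots> = (\<tau> a b \<boxtimes>[c] (?T \<cdot> ?K)) \<cdot> \<iota> a c ?I ?P ?I ?P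
      \<cdot> ((\<one> ?I \<boxtimes>[c] ?J) \<boxtimes>[a] (\<one> ?I \<boxtimes>[c] ?J)) \<cdot> (\<beta> b c \<boxtimes>[a] \<beta> b c)"
    by (subst ac.iot_nat2) (auto simp: ten_idn)
  also have "\<dots> = PA c (\<lambda>_. \<tau> a b) (h # hs) \<cdot> J2 a c (\<lambda>_. \<I> b) (\<lambda>_. \<I> b) (h # hs)
      \<cdot> (J0 b c (h # hs) \<boxtimes>[a] J0 b c (h # hs))"
    by (simp add: ten_cmp ten_cmp2)
  finally show ?case .
qed

text \<open>\<open>ax19\<close> is the case of empty \<open>hs\<close>, and \<open>ax20\<close>
  treats the head. Head and tail are separated by naturality of \<iota> of colours \<open>b\<close>,
  \<open>c\<close> before \<open>ax20\<close>, and joined again by naturality of \<iota> of colours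
  \<open>a\<close>, \<open>c\<close> after the induction hypothesis.\<close>

lemma hex_22:
  assumes [simp]: "\<And>h. ob (X h)" "\<And>h. ob (X' h)" "\<And>h. ob (Y h)" "\<And>h. ob (Y' h)"
  shows "J2 b c (\<lambda>h. X h \<otimes>[a] X' h) (\<lambda>h. Y h \<otimes>[a] Y' h) hs
     \<cdot> (J2 a c X X' hs \<boxtimes>[b] J2 a c Y Y' hs)
     \<cdot> \<iota> a b (PO c X hs) (PO c Y hs) (PO c X' hs) (PO c Y' hs)
    = PA c (\<lambda>h. \<iota> a b (X h) (Y h) (X' h) (Y' h)) hs
     \<cdot> J2 a c (\<lambda>h. X h \<otimes>[b] Y h) (\<lambda>h. X' h \<otimes>[b] Y' h) hs
     \<cdot> (J2 b c X Y hs \<boxtimes>[a] J2 b c X' Y' hs)"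
proof (induction hs)
  case Nil
  show ?case using ax19 by simp
next
  case (Cons h hs)
  let ?x = "X h" and ?y = "Y h" and ?x' = "X' h" and ?y' = "Y' h"
  let ?X = "PO c X hs" and ?Y = "PO c Y hs" and ?X' = "PO c X' hs" and ?Y' = "PO c Y' hs"
  let ?J1 = "J2 b c (\<lambda>h. X h \<otimes>[a] X' h) (\<lambda>h. Y h \<otimes>[a] Y' h) hs"
  let ?J2 = "J2 a c X X' hs" and ?J3 = "J2 a c Y Y' hs"
  let ?K1 = "J2 a c (\<lambda>h. X h \<otimes>[b] Y h) (\<lambda>h. X' h \<otimes>[b] Y' h) hs"
  let ?K2 = "J2 b c X Y hs" and ?K3 = "J2 b c X' Y' hs"
  let ?Pi = "PA c (\<lambda>h. \<iota> a b (X h) (Y h) (X' h) (Y' h)) hs"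
  let ?i1 = "\<iota> a c ?x ?X ?x' ?X' \<boxtimes>[b] \<iota> a c ?y ?Y ?y' ?Y'"
  let ?i2 = "\<iota> a b (?x \<otimes>[c] ?X) (?y \<otimes>[c] ?Y) (?x' \<otimes>[c] ?X') (?y' \<otimes>[c] ?Y')"
  let ?i3 = "\<iota> b c ?x ?X ?y ?Y \<boxtimes>[a] \<iota> b c ?x' ?X' ?y' ?Y'"
  let ?e = "\<one> ((?x \<otimes>[a] ?x') \<otimes>[b] (?y \<otimes>[a] ?y'))"
  let ?e' = "\<one> ((?x \<otimes>[b] ?y) \<otimes>[a] (?x' \<otimes>[b] ?y'))"
  have "J2 b c (\<lambda>h. X h \<otimes>[a] X' h) (\<lambda>h. Y h \<otimes>[a] Y' h) (h # hs)
     \<cdot> (J2 a c X X' (h # hs) \<boxtimes>[b] J2 a c Y Y' (h # hs))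
     \<cdot> \<iota> a b (PO c X (h # hs)) (PO c Y (h # hs)) (PO c X' (h # hs)) (PO c Y' (h # hs))
    = (?e \<boxtimes>[c] ?J1) \<cdot> \<iota> b c (?x \<otimes>[a] ?x') (PO c (\<lambda>h. X h \<otimes>[a] X' h) hs) (?y \<otimes>[a] ?y') (PO c (\<lambda>h. Y h \<otimes>[a] Y' h) hs)
      \<cdot> ((\<one> (?x \<otimes>[a] ?x') \<boxtimes>[c] ?J2) \<boxtimes>[b] (\<one> (?y \<otimes>[a] ?y') \<boxtimes>[c] ?J3)) \<cdot> ?i1 \<cdot> ?i2"
    by (simp add: ten_cmp2)
  also have "\<dots> = (?e \<boxtimes>[c] (?J1 \<cdot> (?J2 \<boxtimes>[b] ?J3)))
      \<cdot> \<iota> b c (?x \<otimes>[a] ?x') (?X \<otimes>[a] ?X') (?y \<otimes>[a] ?y') (?Y \<otimes>[a] ?Y') \<cdot> ?i1 \<cdot> ?i2"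
    by (subst bc.iot_nat2) (auto simp: ten_idn ten_cmp2)
  also have "\<dots> = (?e \<boxtimes>[c] (?J1 \<cdot> (?J2 \<boxtimes>[b] ?J3)))
      \<cdot> (\<iota> a b ?x ?y ?x' ?y' \<boxtimes>[c] \<iota> a b ?X ?Y ?X' ?Y')
      \<cdot> \<iota> a c (?x \<otimes>[b] ?y) (?X \<otimes>[b] ?Y) (?x' \<otimes>[b] ?y') (?X' \<otimes>[b] ?Y') \<cdot> ?i3"
    by (subst ax20) auto
  also have "\<dots> = (\<iota> a b ?x ?y ?x' ?y' \<boxtimes>[c] (?Pi \<cdot> ?K1 \<cdot> (?K2 \<boxtimes>[a] ?K3)))
      \<cdot> \<iota> a c (?x \<otimes>[b] ?y) (?X \<otimes>[b] ?Y) (?x' \<otimes>[b] ?y') (?X' \<otimes>[b] ?Y') \<cdot> ?i3"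
    by (simp add: ten_cmp2 Cons.IH)
  also have "\<dots> = (\<iota> a b ?x ?y ?x' ?y' \<boxtimes>[c] ?Pi) \<cdot> (?e' \<boxtimes>[c] ?K1) \<cdot>
      (?e' \<boxtimes>[c] (?K2 \<boxtimes>[a] ?K3))
      \<cdot> \<iota> a c (?x \<otimes>[b] ?y) (?X \<otimes>[b] ?Y) (?x' \<otimes>[b] ?y') (?X' \<otimes>[b] ?Y') \<cdot> ?i3"
    by (simp add: ten_cmp2)
  also have "\<dots> = (\<iota> a b ?x ?y ?x' ?y' \<boxtimes>[c] ?Pi) \<cdot> (?e' \<boxtimes>[c] ?K1)
      \<cdot> \<iota> a c (?x \<otimes>[b] ?y) (PO c (\<lambda>h. X h \<otimes>[b] Y h) hs) (?x' \<otimes>[b] ?y') (PO c (\<lambda>h. X' h \<otimes>[b] Y' h) hs)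
      \<cdot> ((\<one> (?x \<otimes>[b] ?y) \<boxtimes>[c] ?K2) \<boxtimes>[a] (\<one> (?x' \<otimes>[b] ?y') \<boxtimes>[c] ?K3)) \<cdot> ?i3"
    by (subst ac.iot_nat2) (auto simp: ten_idn)
  finally show ?case
    by (simp add: ten_cmp)
qed

text \<open>Induction over the list of colour \<open>b\<close>: \<open>hex_00\<close> for the empty
  list, and \<open>hex_02\<close> for each index attached by \<beta>.\<close>

lemma hex_0:
  "GG b c (\<lambda>_ _. \<I> a) js hs \<cdot> PA b (\<lambda>_. J0 a c hs) js \<cdot> J0 a b js
    = PA c (\<lambda>_. J0 a b js) hs \<cdot> J0 a c hs"
proof (induction js)
  case Nil
  show ?case by (simp add: hex_00)
next
  case (Cons j js)
  let ?I = "\<I> a" and ?J = "J0 a c hs" and ?L = "J0 a b js" and ?P = "PO b (\<lambda>_. \<I> a) js"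
  let ?G = "GG b c (\<lambda>_ _. ?I) js hs" and ?Q = "PA b (\<lambda>_. ?J) js"
  have nat: "J2 b c (\<lambda>_. ?I) (\<lambda>_. ?P) hs \<cdot> (\<one> (PO c (\<lambda>_. ?I) hs) \<boxtimes>[b] PA c (\<lambda>_. ?L) hs)
      = PA c (\<lambda>_. \<one> ?I \<boxtimes>[b] ?L) hs \<cdot> J2 b c (\<lambda>_. ?I) (\<lambda>_. ?I) hs"
    using bc.J2_nat[of "\<lambda>_. \<one> ?I" "\<lambda>_. ?L" hs] by (simp add: PA_idn)
  have "GG b c (\<lambda>_ _. ?I) (j # js) hs \<cdot> PA b (\<lambda>_. ?J) (j # js) \<cdot> J0 a b (j # js)
    = J2 b c (\<lambda>_. ?I) (\<lambda>_. ?P) hs \<cdot> (\<one> (PO c (\<lambda>_. ?I) hs) \<boxtimes>[b] ?G) \<cdot>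
       (?J \<boxtimes>[b] ?Q) \<cdot> (\<one> ?I \<boxtimes>[b] ?L) \<cdot> \<beta> a b"
    by simp
  also have "\<dots> = J2 b c (\<lambda>_. ?I) (\<lambda>_. ?P) hs \<cdot> (?J \<boxtimes>[b] (?G \<cdot> ?Q \<cdot> ?L)) \<cdot> \<beta> a b"
    by (simp add: ten_cmp2)
  also have "\<dots> = J2 b c (\<lambda>_. ?I) (\<lambda>_. ?P) hs \<cdot>
     (\<one> (PO c (\<lambda>_. ?I) hs) \<boxtimes>[b] PA c (\<lambda>_. ?L) hs) \<cdot> (?J \<boxtimes>[b] ?J) \<cdot> \<beta> a b"
    by (simp add: ten_cmp2 Cons.IH)
  also have "\<dots> = (J2 b c (\<lambda>_. ?I) (\<lambda>_. ?P) hs \<cdot>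
     (\<one> (PO c (\<lambda>_. ?I) hs) \<boxtimes>[b] PA c (\<lambda>_. ?L) hs)) \<cdot> (?J \<boxtimes>[b] ?J) \<cdot> \<beta> a b"
    by (subst cmp_assoc'[where h = "J2 b c (\<lambda>_. ?I) (\<lambda>_. ?P) hs"]) auto
  also have "\<dots> = PA c (\<lambda>_. \<one> ?I \<boxtimes>[b] ?L) hs \<cdot> J2 b c (\<lambda>_. ?I) (\<lambda>_. ?I) hs \<cdot> (?J \<boxtimes>[b] ?J) \<cdot> \<beta> a b"
    unfolding nat by simp
  also have "\<dots> = (PA c (\<lambda>_. \<one> ?I \<boxtimes>[b] ?L) hs \<cdot> PA c (\<lambda>_. \<beta> a b) hs) \<cdot> ?J"
    by (simp add: hex_02)
  also have "\<dots> = PA c (\<lambda>_. J0 a b (j # js)) hs \<cdot> ?J"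
    by (subst PA_cmp[symmetric]) auto
  finally show ?case .
qed

text \<open>The analogous induction over colour \<open>b\<close> for a binary product in colour
  \<open>a\<close>, from \<open>hex_20\<close> and \<open>hex_22\<close>.\<close>

lemma hex_2:
  assumes [simp]: "\<And>j h. ob (X j h)" "\<And>j h. ob (Y j h)"
  shows "GG b c (\<lambda>j h. X j h \<otimes>[a] Y j h) js hs \<cdot> PA b (\<lambda>j. J2 a c (X j) (Y j) hs) js
     \<cdot> J2 a b (\<lambda>j. PO c (X j) hs) (\<lambda>j. PO c (Y j) hs) js
    = PA c (\<lambda>h. J2 a b (\<lambda>j. X j h) (\<lambda>j. Y j h) js) hs
     \<cdot> J2 a c (\<lambda>h. PO b (\<lambda>j. X j h) js) (\<lambda>h. PO b (\<lambda>j. Y j h) js) hs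
     \<cdot> (GG b c X js hs \<boxtimes>[a] GG b c Y js hs)"
proof (induction js)
  case Nil
  show ?case by (simp add: hex_20)
next
  case (Cons j js)
  let ?x = "X j" and ?y = "Y j"
  let ?X = "\<lambda>h. PO b (\<lambda>j. X j h) js" and ?Y = "\<lambda>h. PO b (\<lambda>j. Y j h) js"
  let ?GX = "GG b c X js hs" and ?GY = "GG b c Y js hs" and ?G = "GG b c (\<lambda>j h. X j h \<otimes>[a] Y j h) js hs"
  let ?Q = "PA b (\<lambda>j. J2 a c (X j) (Y j) hs) js"
  let ?J = "J2 a c ?x ?y hs" and ?K = "J2 a b (\<lambda>j. PO c (X j) hs) (\<lambda>j. PO c (Y j) hs) js"
  let ?L = "\<lambda>h. J2 a b (\<lambda>j. X j h) (\<lambda>j. Y j h) js"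
  let ?Z = "\<lambda>h. PO b (\<lambda>j. X j h \<otimes>[a] Y j h) js"
  let ?PX = "PO b (\<lambda>j. PO c (X j) hs) js" and ?PY = "PO b (\<lambda>j. PO c (Y j) hs) js"
  let ?e = "\<one> (PO c (\<lambda>h. ?x h \<otimes>[a] ?y h) hs)"
  let ?ii = "\<iota> a b (PO c ?x hs) ?PX (PO c ?y hs) ?PY"
  let ?ij = "\<iota> a b (PO c ?x hs) (PO c ?X hs) (PO c ?y hs) (PO c ?Y hs)"
  let ?B = "J2 b c (\<lambda>h. ?x h \<otimes>[a] ?y h) ?Z hs"
  let ?M = "J2 a c ?X ?Y hs"
  have nat: "?B \<cdot> (?e \<boxtimes>[b] PA c ?L hs)
      = PA c (\<lambda>h. \<one> (?x h \<otimes>[a] ?y h) \<boxtimes>[b] ?L h) hs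
        \<cdot> J2 b c (\<lambda>h. ?x h \<otimes>[a] ?y h) (\<lambda>h. ?X h \<otimes>[a] ?Y h) hs"
    using bc.J2_nat[of "\<lambda>h. \<one> (?x h \<otimes>[a] ?y h)" ?L hs] by (simp add: PA_idn)
  have "GG b c (\<lambda>j h. X j h \<otimes>[a] Y j h) (j # js) hs \<cdot> PA b (\<lambda>j. J2 a c (X j) (Y j) hs) (j # js)
     \<cdot> J2 a b (\<lambda>j. PO c (X j) hs) (\<lambda>j. PO c (Y j) hs) (j # js)
    = ?B \<cdot> (?e \<boxtimes>[b] ?G) \<cdot> (?J \<boxtimes>[b] ?Q) \<cdot> (\<one> (PO c ?x hs \<otimes>[a] PO c ?y hs) \<boxtimes>[b] ?K) \<cdot> ?ii"
    by simp
  also have "\<dots> = ?B \<cdot> (?J \<boxtimes>[b] (?G \<cdot> ?Q \<cdot> ?K)) \<cdot> ?ii"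
    by (simp add: ten_cmp2)
  also have "\<dots> = ?B \<cdot> (?e \<boxtimes>[b] PA c ?L hs) \<cdot> (?J \<boxtimes>[b] ?M)
      \<cdot> ((\<one> (PO c ?x hs) \<boxtimes>[a] \<one> (PO c ?y hs)) \<boxtimes>[b] (?GX \<boxtimes>[a] ?GY)) \<cdot> ?ii"
    by (simp add: ten_cmp2 Cons.IH ten_idn)
  also have "\<dots> = ?B \<cdot> (?e \<boxtimes>[b] PA c ?L hs) \<cdot> (?J \<boxtimes>[b] ?M) \<cdot> ?ij
      \<cdot> ((\<one> (PO c ?x hs) \<boxtimes>[b] ?GX) \<boxtimes>[a] (\<one> (PO c ?y hs) \<boxtimes>[b] ?GY))"
    by (subst ab.iot_nat) auto
  also have "\<dots> = (?B \<cdot> (?e \<boxtimes>[b] PA c ?L hs)) \<cdot> (?J \<boxtimes>[b] ?M) \<cdot> ?ij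
      \<cdot> ((\<one> (PO c ?x hs) \<boxtimes>[b] ?GX) \<boxtimes>[a] (\<one> (PO c ?y hs) \<boxtimes>[b] ?GY))"
    by (subst cmp_assoc'[where h = ?B]) auto
  also have "\<dots> = PA c (\<lambda>h. \<one> (?x h \<otimes>[a] ?y h) \<boxtimes>[b] ?L h) hs
        \<cdot> (J2 b c (\<lambda>h. ?x h \<otimes>[a] ?y h) (\<lambda>h. ?X h \<otimes>[a] ?Y h) hs \<cdot> (?J \<boxtimes>[b] ?M) \<cdot> ?ij)
      \<cdot> ((\<one> (PO c ?x hs) \<boxtimes>[b] ?GX) \<boxtimes>[a] (\<one> (PO c ?y hs) \<boxtimes>[b] ?GY))"
    unfolding nat by simp
  also have "\<dots> = PA c (\<lambda>h. \<one> (?x h \<otimes>[a] ?y h) \<boxtimes>[b] ?L h) hs \<cdot>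
       PA c (\<lambda>h. \<iota> a b (?x h) (?X h) (?y h) (?Y h)) hs
       \<cdot> J2 a c (\<lambda>h. ?x h \<otimes>[b] ?X h) (\<lambda>h. ?y h \<otimes>[b] ?Y h) hs
       \<cdot> (J2 b c ?x ?X hs \<boxtimes>[a] J2 b c ?y ?Y hs)
       \<cdot> ((\<one> (PO c ?x hs) \<boxtimes>[b] ?GX) \<boxtimes>[a] (\<one> (PO c ?y hs) \<boxtimes>[b] ?GY))"
    by (subst hex_22) auto
  also have "\<dots> = (PA c (\<lambda>h. \<one> (?x h \<otimes>[a] ?y h) \<boxtimes>[b] ?L h) hs \<cdot>
       PA c (\<lambda>h. \<iota> a b (?x h) (?X h) (?y h) (?Y h)) hs)
       \<cdot> J2 a c (\<lambda>h. ?x h \<otimes>[b] ?X h) (\<lambda>h. ?y h \<otimes>[b] ?Y h) hs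
       \<cdot> (GG b c X (j # js) hs \<boxtimes>[a] GG b c Y (j # js) hs)"
    by (simp add: ten_cmp)
  also have "\<dots> = PA c (\<lambda>h. J2 a b (\<lambda>j. X j h) (\<lambda>j. Y j h) (j # js)) hs
       \<cdot> J2 a c (\<lambda>h. ?x h \<otimes>[b] ?X h) (\<lambda>h. ?y h \<otimes>[b] ?Y h) hs
       \<cdot> (GG b c X (j # js) hs \<boxtimes>[a] GG b c Y (j # js) hs)"
    by (subst PA_cmp[symmetric]) auto
  finally show ?case by simp
qed

text \<open>The last of three nested inductions, over the list of colour \<open>a\<close>, from
  \<open>hex_0\<close> and \<open>hex_2\<close>. Each of the three lists is thus reduced to the
  empty and the binary case, which accounts for the eight axioms \<open>ax13\<close> to
  \<open>ax20\<close>.\<close>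

lemma hexagon:
  assumes [simp]: "\<And>i j h. ob (A i j h)"
  shows "GG b c (\<lambda>j h. PO a (\<lambda>i. A i j h) is) js hs
      \<cdot> PA b (\<lambda>j. GG a c (\<lambda>i h. A i j h) is hs) js
      \<cdot> GG a b (\<lambda>i j. PO c (A i j) hs) is js
    = PA c (\<lambda>h. GG a b (\<lambda>i j. A i j h) is js) hs
      \<cdot> GG a c (\<lambda>i h. PO b (\<lambda>j. A i j h) js) is hs
      \<cdot> PA a (\<lambda>i. GG b c (A i) js hs) is"
proof (induction "is")
  case Nil
  show ?case by (simp add: hex_0)
next
  case (Cons i "is")
  let ?X = "A i" and ?B = "\<lambda>j h. PO a (\<lambda>i. A i j h) is"
  let ?Gac = "\<lambda>j. GG a c (\<lambda>i h. A i j h) is hs" and ?Gab = "GG a b (\<lambda>i j. PO c (A i j) hs) is js"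
  let ?Hab = "\<lambda>h. GG a b (\<lambda>i j. A i j h) is js" and ?Hac = "GG a c (\<lambda>i h. PO b (\<lambda>j. A i j h) js) is hs"
  let ?Hbc = "PA a (\<lambda>i. GG b c (A i) js hs) is"
  let ?GX = "GG b c ?X js hs" and ?GB = "GG b c ?B js hs"
  let ?PX = "PO b (\<lambda>j. PO c (?X j) hs) js" and ?QX = "PO c (\<lambda>h. PO b (\<lambda>j. ?X j h) js) hs"
  let ?G = "GG b c (\<lambda>j h. ?X j h \<otimes>[a] ?B j h) js hs"
  let ?J = "PA b (\<lambda>j. J2 a c (?X j) (?B j) hs) js"
  let ?K = "J2 a b (\<lambda>j. PO c (?X j) hs) (\<lambda>j. PO c (?B j) hs) js"
  let ?K' = "J2 a b (\<lambda>j. PO c (?X j) hs) (\<lambda>j. PO a (\<lambda>i. PO c (A i j) hs) is) js"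
  let ?L = "\<lambda>h. J2 a b (\<lambda>j. ?X j h) (\<lambda>j. ?B j h) js"
  let ?M = "J2 a c (\<lambda>h. PO b (\<lambda>j. ?X j h) js) (\<lambda>h. PO b (\<lambda>j. ?B j h) js) hs"
  let ?M' = "J2 a c (\<lambda>h. PO b (\<lambda>j. ?X j h) js) (\<lambda>h. PO a (\<lambda>i. PO b (\<lambda>j. A i j h) js) is) hs"
  let ?e = "\<lambda>j. \<one> (PO c (?X j) hs)" and ?f = "\<lambda>h. \<one> (PO b (\<lambda>j. ?X j h) js)"
  \<comment> \<open>The induction hypothesis concerns only the second factor of \<otimes>[a].
    \<open>nat1\<close> and \<open>nat2\<close> move its first and its last arrow past the
    multiplications \<open>J2\<close> into and out of that factor.\<close>
  have nat1: "PA b (\<lambda>j. ?e j \<boxtimes>[a] ?Gac j) js \<cdot> ?K' = ?K \<cdot> (\<one> ?PX \<boxtimes>[a] PA b ?Gac js)"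
    using ab.J2_nat[of ?e ?Gac js] by (simp add: PA_idn)
  have nat2: "?M \<cdot> (\<one> ?QX \<boxtimes>[a] PA c ?Hab hs) = PA c (\<lambda>h. ?f h \<boxtimes>[a] ?Hab h) hs \<cdot> ?M'"
    using ac.J2_nat[of ?f ?Hab hs] by (simp add: PA_idn)
  have "GG b c (\<lambda>j h. PO a (\<lambda>i. A i j h) (i # is)) js hs
      \<cdot> PA b (\<lambda>j. GG a c (\<lambda>i h. A i j h) (i # is) hs) js
      \<cdot> GG a b (\<lambda>i j. PO c (A i j) hs) (i # is) js
    = ?G \<cdot> PA b (\<lambda>j. J2 a c (?X j) (?B j) hs \<cdot> (?e j \<boxtimes>[a] ?Gac j)) js
      \<cdot> ?K' \<cdot> (\<one> ?PX \<boxtimes>[a] ?Gab)"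
    by simp
  also have "\<dots> = ?G \<cdot> ?J \<cdot> (PA b (\<lambda>j. ?e j \<boxtimes>[a] ?Gac j) js \<cdot> ?K') \<cdot> (\<one> ?PX \<boxtimes>[a] ?Gab)"
    by (subst PA_cmp) auto
  also have "\<dots> = (?G \<cdot> ?J \<cdot> ?K) \<cdot> (\<one> ?PX \<boxtimes>[a] PA b ?Gac js) \<cdot> (\<one> ?PX \<boxtimes>[a] ?Gab)"
    unfolding nat1 by simp
  also have "\<dots> = PA c ?L hs \<cdot> ?M \<cdot> (?GX \<boxtimes>[a] ?GB) \<cdot> (\<one> ?PX \<boxtimes>[a] PA b ?Gac js) \<cdot> (\<one> ?PX \<boxtimes>[a] ?Gab)"
    by (subst hex_2) auto
  also have "\<dots> = PA c ?L hs \<cdot> ?M \<cdot> (?GX \<boxtimes>[a] (PA c ?Hab hs \<cdot> ?Hac \<cdot> ?Hbc))"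
    by (simp add: ten_cmp Cons.IH)
  also have "\<dots> = PA c ?L hs \<cdot> (?M \<cdot> (\<one> ?QX \<boxtimes>[a] PA c ?Hab hs)) \<cdot> (\<one> ?QX \<boxtimes>[a] ?Hac) \<cdot> (?GX \<boxtimes>[a] ?Hbc)"
    by (simp add: ten_cmp ten_cmp2)
  also have "\<dots> = (PA c ?L hs \<cdot> PA c (\<lambda>h. ?f h \<boxtimes>[a] ?Hab h) hs) \<cdot> ?M' \<cdot> (\<one> ?QX \<boxtimes>[a] ?Hac) \<cdot> (?GX \<boxtimes>[a] ?Hbc)"
    unfolding nat2 by simp
  also have "\<dots> = PA c (\<lambda>h. GG a b (\<lambda>i j. A i j h) (i # is) js) hs \<cdot> ?M' \<cdot> (\<one> ?QX \<boxtimes>[a] ?Hac)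
      \<cdot> (?GX \<boxtimes>[a] ?Hbc)"
    by (subst PA_cmp[symmetric]) auto
  finally show ?case by simp
qed

end

section \<open>Infinite arrays\<close>

lemma mono_comp: "mono f \<Longrightarrow> mono g \<Longrightarrow> mono (f \<circ> g)"
  by (auto simp: mono_def)

lemma mono_id' [simp]: "mono (id :: nat \<Rightarrow> nat)"
  by (simp add: mono_def)

lemma concat_upt:
  fixes \<phi> :: "nat \<Rightarrow> nat"
  assumes "mono \<phi>" "a \<le> b"
  shows "concat (map (\<lambda>i. [\<phi> i..<\<phi> (Suc i)]) [a..<b]) = [\<phi> a..<\<phi> b]"
  using assms(2)
proof (induction b rule: dec_induct)
  case (step b)
  have "[\<phi> a..<\<phi> (Suc b)] = [\<phi> a..<\<phi> b] @ [\<phi> b..<\<phi> (Suc b)]"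
    using step(1) assms(1) upt_add_eq_append[of "\<phi> a" "\<phi> b" "\<phi> (Suc b) - \<phi> b"]
    by (simp add: monoD)
  then show ?case using step by simp
qed simp

text \<open>The list identity behind functoriality of the bar construction: a product over one
  interval of the composite is a product of products over intervals of \<open>\<phi>\<close>.
  Monotonicity makes these consecutive.\<close>

lemma concat_upt_comp:
  fixes \<phi> \<psi> :: "nat \<Rightarrow> nat"
  assumes "mono \<phi>" "mono \<psi>"
  shows "[(\<phi> \<circ> \<psi>) x..<(\<phi> \<circ> \<psi>) (Suc x)] = concat (map (\<lambda>i. [\<phi> i..<\<phi> (Suc i)]) [\<psi> x..<\<psi> (Suc x)])"
  using assms by (subst concat_upt) (auto simp: monoD)

context N_fold_strict_monoidal_category
begin

lemma PO_map: "PO k X (map f is) = PO k (\<lambda>i. X (f i)) is"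
  by (simp add: PO_def fprod_map)

lemma PA_map: "PA k X (map f is) = PA k (\<lambda>i. X (f i)) is"
  by (simp add: PA_def fprod_map)

lemma J0_map: "J0 k l (map f js) = J0 k l js"
  by (induction js) auto

lemma J2_map: "J2 k l X Y (map f js) = J2 k l (\<lambda>j. X (f j)) (\<lambda>j. Y (f j)) js"
  by (induction js) (auto simp: PO_map)

lemma GG_map_left: "GG k l A (map f is) js = GG k l (\<lambda>i. A (f i)) is js"
  by (induction "is") (auto simp: PO_map)

lemma GG_map_right: "GG k l A is (map g js) = GG k l (\<lambda>i j. A i (g j)) is js"
  by (induction "is") (auto simp: PO_map J0_map J2_map)

text \<open>The requirement is imposed at all indices and not just in a box, so no bounds enter the
  algebra of arrays; \<open>array_of\<close> later supplies such total arrays by padding.\<close>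

definition obA :: "('r \<Rightarrow> 'o) \<Rightarrow> bool" where
  "obA X \<longleftrightarrow> (\<forall>r. ob (X r))"
definition arA :: "('r \<Rightarrow> 'a) \<Rightarrow> bool" where
  "arA F \<longleftrightarrow> (\<forall>r. arr (F r))"
definition dmA :: "('r \<Rightarrow> 'a) \<Rightarrow> 'r \<Rightarrow> 'o" where
  "dmA F = (\<lambda>r. dom (F r))"
definition cdA :: "('r \<Rightarrow> 'a) \<Rightarrow> 'r \<Rightarrow> 'o" where
  "cdA F = (\<lambda>r. cod (F r))"
definition idA :: "('r \<Rightarrow> 'o) \<Rightarrow> 'r \<Rightarrow> 'a" where
  "idA X = (\<lambda>r. \<one> (X r))"
definition cpA :: "('r \<Rightarrow> 'a) \<Rightarrow> ('r \<Rightarrow> 'a) \<Rightarrow> 'r \<Rightarrow> 'a" (infixr "\<odot>" 70) where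
  "G \<odot> F = (\<lambda>r. G r \<cdot> F r)"

lemma obA_D [simp]: "obA X \<Longrightarrow> ob (X r)" by (simp add: obA_def)
lemma arA_D [simp]: "arA F \<Longrightarrow> arr (F r)" by (simp add: arA_def)

lemma obA_dm_cd [simp]: "arA F \<Longrightarrow> obA (dmA F)" "arA F \<Longrightarrow> obA (cdA F)"
  by (auto simp: obA_def dmA_def cdA_def)

lemma idA_simps [simp]:
  "obA X \<Longrightarrow> arA (idA X)" "obA X \<Longrightarrow> dmA (idA X) = X" "obA X \<Longrightarrow> cdA (idA X) = X"
  by (auto simp: arA_def dmA_def cdA_def idA_def)

lemma cpA_simps [simp]:
  assumes "arA F" "arA G" "cdA F = dmA G"
  shows "arA (G \<odot> F)" "dmA (G \<odot> F) = dmA F" "cdA (G \<odot> F) = cdA G"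
  using assms(1,2) fun_cong[OF assms(3)]
  by (auto simp: arA_def dmA_def cdA_def cpA_def)

lemma cpA_id [simp]:
  "arA F \<Longrightarrow> cdA F = X \<Longrightarrow> idA X \<odot> F = F" "arA F \<Longrightarrow> dmA F = X \<Longrightarrow> F \<odot> idA X = F"
  by (auto simp: dmA_def cdA_def cpA_def idA_def)

lemma cpA_assoc [simp]:
  assumes "arA F" "arA G" "arA H" "cdA F = dmA G" "cdA G = dmA H"
  shows "(H \<odot> G) \<odot> F = H \<odot> G \<odot> F"
  using assms(1-3) fun_cong[OF assms(4)] fun_cong[OF assms(5)]
  by (auto simp: dmA_def cdA_def cpA_def)

text \<open>Index \<open>i\<close> stands for the edge from vertex \<open>i\<close> to vertex
  \<open>i + 1\<close>. An empty interval inserts the unit, as a degeneracy does, and an interval of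
  length two multiplies neighbours. An outer face deletes an end entry because that entry lies in no
  interval whose index belongs to the smaller box.\<close>

definition TO :: "nat \<Rightarrow> (nat \<Rightarrow> nat) \<Rightarrow> ((nat \<Rightarrow> nat) \<Rightarrow> 'o) \<Rightarrow> (nat \<Rightarrow> nat) \<Rightarrow> 'o" where
  "TO k \<phi> X = (\<lambda>r. PO k (\<lambda>i. X (r(k := i))) [\<phi> (r k)..<\<phi> (Suc (r k))])"

definition TA :: "nat \<Rightarrow> (nat \<Rightarrow> nat) \<Rightarrow> ((nat \<Rightarrow> nat) \<Rightarrow> 'a) \<Rightarrow> (nat \<Rightarrow> nat) \<Rightarrow> 'a" where
  "TA k \<phi> F = (\<lambda>r. PA k (\<lambda>i. F (r(k := i))) [\<phi> (r k)..<\<phi> (Suc (r k))])"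

definition chiA :: "nat \<Rightarrow> (nat \<Rightarrow> nat) \<Rightarrow> nat \<Rightarrow> (nat \<Rightarrow> nat)
    \<Rightarrow> ((nat \<Rightarrow> nat) \<Rightarrow> 'o) \<Rightarrow> (nat \<Rightarrow> nat) \<Rightarrow> 'a" where
  "chiA k \<phi> l \<psi> X = (\<lambda>r. GG k l (\<lambda>i j. X (r(k := i, l := j)))
     [\<phi> (r k)..<\<phi> (Suc (r k))] [\<psi> (r l)..<\<psi> (Suc (r l))])"

lemma TO_ob [simp]: "k < N \<Longrightarrow> obA X \<Longrightarrow> obA (TO k \<phi> X)"
  by (auto simp: obA_def TO_def)

lemma TA_simps [simp]:
  assumes "k < N" "arA F"
  shows "arA (TA k \<phi> F)" "dmA (TA k \<phi> F) = TO k \<phi> (dmA F)" "cdA (TA k \<phi> F) = TO k \<phi> (cdA F)"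
  using assms by (auto simp: arA_def dmA_def cdA_def TA_def TO_def)

lemma TA_idA [simp]: "k < N \<Longrightarrow> obA X \<Longrightarrow> TA k \<phi> (idA X) = idA (TO k \<phi> X)"
  by (auto simp: TA_def TO_def idA_def PA_idn)

lemma TA_cpA:
  "k < N \<Longrightarrow> arA F \<Longrightarrow> arA G \<Longrightarrow> cdA F = dmA G \<Longrightarrow> TA k \<phi> (G \<odot> F) = TA k \<phi> G \<odot> TA k \<phi> F"
  by (auto simp: TA_def cpA_def dmA_def cdA_def intro!: PA_cmp ext dest: fun_cong)

text \<open>The map applied first stands on the left of the composite: arrays transform
  contravariantly, as functors on the opposite of the simplicial category should.\<close>

lemma TO_comp:
  "k < N \<Longrightarrow> obA X \<Longrightarrow> mono \<phi> \<Longrightarrow> mono \<psi> \<Longrightarrow> TO k \<psi> (TO k \<phi> X) = TO k (\<phi> \<circ> \<psi>) X"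
  unfolding TO_def by (subst concat_upt_comp) (auto simp: PO_concat PO_map)

lemma TA_comp:
  "k < N \<Longrightarrow> arA X \<Longrightarrow> mono \<phi> \<Longrightarrow> mono \<psi> \<Longrightarrow> TA k \<psi> (TA k \<phi> X) = TA k (\<phi> \<circ> \<psi>) X"
  unfolding TA_def by (subst concat_upt_comp) (auto simp: PA_concat PA_map)

lemma TO_id [simp]: "k < N \<Longrightarrow> obA X \<Longrightarrow> TO k id X = X"
  by (simp add: TO_def)

lemma TA_id [simp]: "k < N \<Longrightarrow> arA F \<Longrightarrow> TA k id F = F"
  by (simp add: TA_def)

lemma color_pairI: "k < l \<Longrightarrow> l < N \<Longrightarrow> color_pair N M k l"
  by unfold_locales simp_all

lemma chiA_simps [simp]:
  assumes "k < l" "l < N" "obA X"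
  shows "arA (chiA k \<phi> l \<psi> X)" "dmA (chiA k \<phi> l \<psi> X) = TO k \<phi> (TO l \<psi> X)"
    "cdA (chiA k \<phi> l \<psi> X) = TO l \<psi> (TO k \<phi> X)"
proof -
  interpret color_pair N M k l using assms by (simp add: color_pairI)
  show "arA (chiA k \<phi> l \<psi> X)" using assms by (simp add: arA_def chiA_def)
  show "dmA (chiA k \<phi> l \<psi> X) = TO k \<phi> (TO l \<psi> X)" "cdA (chiA k \<phi> l \<psi> X) = TO l \<psi> (TO k \<phi> X)"
    using assms by (auto simp: dmA_def cdA_def chiA_def TO_def fun_upd_twist)
qed

lemma chiA_nat:
  assumes "k < l" "l < N" "arA F"
  shows "chiA k \<phi> l \<psi> (cdA F) \<odot> TA k \<phi> (TA l \<psi> F) = TA l \<psi> (TA k \<phi> F) \<odot> chiA k \<phi> l \<psi> (dmA F)"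
proof -
  interpret color_pair N M k l using assms by (simp add: color_pairI)
  show ?thesis
    using assms GG_nat[of "\<lambda>i j. F (r(k := i, l := j))" for r]
    by (auto simp: dmA_def cdA_def chiA_def TA_def fun_upd_twist cpA_def)
qed

text \<open>Crossing a composite amounts to crossing its factors one after the other:
  \<open>GG_concat_left\<close> on the intervals tiled by \<open>concat_upt_comp\<close>.
  \<open>chiA_comp_right\<close> is the counterpart for the other map.\<close>

lemma chiA_comp_left:
  assumes "k < l" "l < N" "obA X" "mono \<phi>" "mono \<phi>'"
  shows "chiA k (\<phi> \<circ> \<phi>') l \<psi> X = chiA k \<phi>' l \<psi> (TO k \<phi> X) \<odot> TA k \<phi>' (chiA k \<phi> l \<psi> X)"
proof
  fix r
  interpret color_pair N M k l using assms by (simp add: color_pairI)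
  show "chiA k (\<phi> \<circ> \<phi>') l \<psi> X r = (chiA k \<phi>' l \<psi> (TO k \<phi> X) \<odot> TA k \<phi>' (chiA k \<phi> l \<psi> X)) r"
    using assms unfolding chiA_def
    by (subst concat_upt_comp) (auto simp: GG_concat_left GG_map_left PA_map TO_def TA_def fun_upd_twist cpA_def)
qed

lemma chiA_comp_right:
  assumes "k < l" "l < N" "obA X" "mono \<psi>" "mono \<psi>'"
  shows "chiA k \<phi> l (\<psi> \<circ> \<psi>') X = TA l \<psi>' (chiA k \<phi> l \<psi> X) \<odot> chiA k \<phi> l \<psi>' (TO l \<psi> X)"
proof
  fix r
  interpret color_pair N M k l using assms by (simp add: color_pairI)
  show "chiA k \<phi> l (\<psi> \<circ> \<psi>') X r = (TA l \<psi>' (chiA k \<phi> l \<psi> X) \<odot> chiA k \<phi> l \<psi>' (TO l \<psi> X)) r"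
    using assms unfolding chiA_def
    by (subst concat_upt_comp[where x = "r l"]) (auto simp: GG_concat_right GG_map_right PA_map TO_def TA_def fun_upd_twist cpA_def)
qed

text \<open>All intervals of \<open>id\<close> have exactly one element, so
  \<open>GG_single_left\<close> and \<open>GG_single_right\<close> apply.\<close>

lemma chiA_id [simp]:
  assumes "k < l" "l < N" "obA X"
  shows "chiA k id l \<psi> X = idA (TO l \<psi> X)" "chiA k \<phi> l id X = idA (TO k \<phi> X)"
proof -
  interpret color_pair N M k l using assms by (simp add: color_pairI)
  have "chiA k id l \<psi> X r = idA (TO l \<psi> X) r" for r
    using assms GG_single_left[of "\<lambda>i j. X (r(k := i, l := j))" "r k"]
    by (simp add: chiA_def idA_def TO_def del: GG.simps)
  then show "chiA k id l \<psi> X = idA (TO l \<psi> X)" by blast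
  have upd: "r(k := i, l := r l) = r(k := i)" for r :: "nat \<Rightarrow> nat" and i by (rule ext) simp
  have "chiA k \<phi> l id X r = idA (TO k \<phi> X) r" for r
    using assms GG_single_right[of "\<lambda>i j. X (r(k := i, l := j))" _ "r l"]
    by (simp add: chiA_def idA_def TO_def upd del: GG.simps)
  then show "chiA k \<phi> l id X = idA (TO k \<phi> X)" by blast
qed

text \<open>\<open>hexagon\<close> on the three-dimensional slice through \<open>r\<close>: both
  ways of reversing three letters by adjacent crossings agree.\<close>

lemma chiA_hexagon:
  assumes "a < b" "b < c" "c < N" "obA X"
  shows "chiA b g c h (TO a f X) \<odot> TA b g (chiA a f c h X) \<odot> chiA a f b g (TO c h X)
    = TA c h (chiA a f b g X) \<odot> chiA a f c h (TO b g X) \<odot> TA a f (chiA b g c h X)"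
proof
  fix r
  interpret color_triple N M a b c using assms by unfold_locales
  show "(chiA b g c h (TO a f X) \<odot> TA b g (chiA a f c h X) \<odot> chiA a f b g (TO c h X)) r
    = (TA c h (chiA a f b g X) \<odot> chiA a f c h (TO b g X) \<odot> TA a f (chiA b g c h X)) r"
    using hexagon[of "\<lambda>i j h. X (r(a := i, b := j, c := h))" "[f (r a)..<f (Suc (r a))]"
        "[g (r b)..<g (Suc (r b))]" "[h (r c)..<h (Suc (r c))]"] assms
    by (simp add: chiA_def cpA_def TO_def TA_def fun_upd_twist)
qed

end

section \<open>Coherence for words of coloured maps\<close>

context N_fold_strict_monoidal_category
begin

text \<open>The full value \<open>WO N e\<close> is the array form of \<open>N_fold_bar\<close>; the
  truncation to colours below \<open>n\<close> serves inductions over the colours.\<close>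

fun WO :: "nat \<Rightarrow> (nat \<Rightarrow> nat \<Rightarrow> nat) \<Rightarrow> ((nat \<Rightarrow> nat) \<Rightarrow> 'o) \<Rightarrow> (nat \<Rightarrow> nat) \<Rightarrow> 'o" where
  "WO 0 e X = X"
| "WO (Suc n) e X = TO n (e n) (WO n e X)"

fun WA :: "nat \<Rightarrow> (nat \<Rightarrow> nat \<Rightarrow> nat) \<Rightarrow> ((nat \<Rightarrow> nat) \<Rightarrow> 'a) \<Rightarrow> (nat \<Rightarrow> nat) \<Rightarrow> 'a" where
  "WA 0 e F = F"
| "WA (Suc n) e F = TA n (e n) (WA n e F)"

text \<open>
  \<open>ins n k f e X\<close> moves the map \<open>f\<close> of colour \<open>k\<close>, which is applied last, past the maps \<open>e l\<close> of
  colours \<open>k < l < n\<close> and composes it with \<open>e k\<close>.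
\<close>

fun ins :: "nat \<Rightarrow> nat \<Rightarrow> (nat \<Rightarrow> nat) \<Rightarrow> (nat \<Rightarrow> nat \<Rightarrow> nat)
    \<Rightarrow> ((nat \<Rightarrow> nat) \<Rightarrow> 'o) \<Rightarrow> (nat \<Rightarrow> nat) \<Rightarrow> 'a" where
  "ins 0 k f e X = idA X"
| "ins (Suc n) k f e X =
    (if k = n then idA (TO n (e n \<circ> f) (WO n e X))
     else TA n (e n) (ins n k f e X) \<odot> chiA k f n (e n) (WO n e X))"

text \<open>The new letter is applied last to arrays, hence composed on the right by
  contravariance.\<close>

definition upd :: "(nat \<Rightarrow> nat \<Rightarrow> nat) \<Rightarrow> nat \<Rightarrow> (nat \<Rightarrow> nat) \<Rightarrow> nat \<Rightarrow> nat \<Rightarrow> nat" where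
  "upd e k f = e(k := e k \<circ> f)"

lemma upd_simps [simp]: "upd e k f k = e k \<circ> f" "n \<noteq> k \<Longrightarrow> upd e k f n = e n"
  by (simp_all add: upd_def)

lemma upd_twist: "k \<noteq> l \<Longrightarrow> upd (upd e k f) l g = upd (upd e l g) k f"
  by (auto simp: upd_def)

lemma upd_upd: "upd (upd e k f) k g = upd e k (f \<circ> g)"
  by (auto simp: upd_def comp_assoc)

lemma upd_id [simp]: "upd e k id = e"
  by (auto simp: upd_def)

lemma mono_upd [simp]: "(\<And>k. mono (e k)) \<Longrightarrow> mono f \<Longrightarrow> mono (upd e k f n)"
  by (auto simp: upd_def mono_comp)

lemma WO_simps [simp]: "n \<le> N \<Longrightarrow> obA X \<Longrightarrow> obA (WO n e X)"
  by (induction n) auto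

lemma WA_simps [simp]:
  assumes "n \<le> N" "arA F"
  shows "arA (WA n e F)" "dmA (WA n e F) = WO n e (dmA F)" "cdA (WA n e F) = WO n e (cdA F)"
proof -
  have "arA (WA n e F) \<and> dmA (WA n e F) = WO n e (dmA F) \<and> cdA (WA n e F) = WO n e (cdA F)"
    using assms by (induction n) auto
  then show "arA (WA n e F)" "dmA (WA n e F) = WO n e (dmA F)" "cdA (WA n e F) = WO n e (cdA F)"
    by auto
qed

lemma WO_upd [simp]: "n \<le> k \<Longrightarrow> WO n (upd e k f) X = WO n e X"
  by (induction n) auto

lemma WA_upd [simp]: "n \<le> k \<Longrightarrow> WA n (upd e k f) X = WA n e X"
  by (induction n) auto

lemma WA_idA [simp]: "n \<le> N \<Longrightarrow> obA X \<Longrightarrow> WA n e (idA X) = idA (WO n e X)"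
  by (induction n) auto

lemma WA_cpA:
  "n \<le> N \<Longrightarrow> arA F \<Longrightarrow> arA G \<Longrightarrow> cdA F = dmA G \<Longrightarrow> WA n e (G \<odot> F) = WA n e G \<odot> WA n e F"
  by (induction n) (auto simp: TA_cpA)

lemma ins_simps:
  assumes "k < n" "n \<le> N" "obA X" "mono f" "\<And>k. mono (e k)"
  shows "arA (ins n k f e X) \<and> dmA (ins n k f e X) = TO k f (WO n e X)
    \<and> cdA (ins n k f e X) = WO n (upd e k f) X"
  using assms(1,2)
proof (induction n)
  case (Suc n)
  show ?case
  proof (cases "k = n")
    case True
    then show ?thesis using Suc.prems assms by (simp add: TO_comp)
  next
    case False
    then show ?thesis using Suc assms by simp
  qed
qed simp

lemmas ins_simps' [simp] =
  ins_simps[THEN conjunct1] ins_simps[THEN conjunct2, THEN conjunct1]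
  ins_simps[THEN conjunct2, THEN conjunct2]

lemma ins_upd [simp]: "n \<le> l \<Longrightarrow> ins n k f (upd e l g) X = ins n k f e X"
  by (induction n) auto

text \<open>Replaces the first two arrows of a composite bracketed to the right. Associativity of
  \<open>cpA\<close> holds only for matching boundaries, whence the list of hypotheses.\<close>

lemma cpA_cong_left:
  assumes "A \<odot> B = C \<odot> D" "arA B" "arA A" "arA C" "arA D" "arA E" "cdA B = dmA A" "cdA D = dmA C"
    "cdA E = dmA B" "cdA E = dmA D"
  shows "A \<odot> B \<odot> E = C \<odot> D \<odot> E"
proof -
  have "A \<odot> B \<odot> E = (A \<odot> B) \<odot> E" using assms(2-) by simp
  also have "\<dots> = C \<odot> D \<odot> E" unfolding assms(1) using assms(2-) by simp
  finally show ?thesis .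
qed

lemma ins_nat:
  assumes "k < n" "n \<le> N" "arA F" "mono f" "\<And>k. mono (e k)"
  shows "ins n k f e (cdA F) \<odot> TA k f (WA n e F) = WA n (upd e k f) F \<odot> ins n k f e (dmA F)"
  using assms(1,2)
proof (induction n)
  case (Suc n)
  show ?case
  proof (cases "k = n")
    case True
    then show ?thesis using Suc.prems assms by (simp add: TO_comp TA_comp mono_comp)
  next
    case False
    then have *: "k < n" "n < N" "k < N" "n \<le> N" using Suc.prems by auto
    have "ins (Suc n) k f e (cdA F) \<odot> TA k f (WA (Suc n) e F)
      = TA n (e n) (ins n k f e (cdA F)) \<odot> chiA k f n (e n) (cdA (WA n e F))
          \<odot> TA k f (TA n (e n) (WA n e F))"
      using * assms by simp
    also have "\<dots> = TA n (e n) (ins n k f e (cdA F)) \<odot> TA n (e n) (TA k f (WA n e F))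
        \<odot> chiA k f n (e n) (dmA (WA n e F))"
      using * assms by (subst chiA_nat) auto
    also have "\<dots> = TA n (e n) (WA n (upd e k f) F) \<odot> TA n (e n) (ins n k f e (dmA F))
        \<odot> chiA k f n (e n) (dmA (WA n e F))"
      by (rule cpA_cong_left) (use * assms in \<open>auto simp: TA_cpA[symmetric] Suc.IH\<close>)
    also have "\<dots> = WA (Suc n) (upd e k f) F \<odot> ins (Suc n) k f e (dmA F)"
      using * assms by simp
    finally show ?thesis .
  qed
qed simp

lemma ins_id: "k < n \<Longrightarrow> n \<le> N \<Longrightarrow> obA X \<Longrightarrow> ins n k id e X = idA (WO n e X)"
  by (induction n) auto

text \<open>A letter passes only higher colours; if those carry identities, every crossing is an
  identity by \<open>chiA_id\<close>.\<close>

lemma ins_triv: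
  "k < n \<Longrightarrow> n \<le> N \<Longrightarrow> obA X \<Longrightarrow> mono f \<Longrightarrow> mono (e k) \<Longrightarrow> (\<And>l. k < l \<Longrightarrow> e l = id) \<Longrightarrow>
    ins n k f e X = idA (TO k f (WO n e X))"
  by (induction n) (auto simp: TO_comp)

text \<open>Each crossing of \<open>f \<circ> f'\<close> splits by \<open>chiA_comp_left\<close>;
  the insertion of \<open>f\<close> into the lower colours is then exchanged with the crossing of
  \<open>f'\<close> by naturality of \<open>chiA\<close>.\<close>

lemma ins_comp:
  assumes "k < n" "n \<le> N" "obA X" "mono f" "mono f'" "\<And>k. mono (e k)"
  shows "ins n k (f \<circ> f') e X = ins n k f' (upd e k f) X \<odot> TA k f' (ins n k f e X)"
  using assms(1,2)
proof (induction n)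
  case (Suc n)
  show ?case
  proof (cases "k = n")
    case True
    then have "ins (Suc n) k (f \<circ> f') e X = ins (Suc n) k f' (upd e k f) X \<odot> TA k f' (ins (Suc n) k f e X)"
      using Suc.prems assms by (simp add: TO_comp mono_comp comp_assoc)
    then show ?thesis .
  next
    case False
    then have *: "k < n" "n < N" "k < N" "n \<le> N" using Suc.prems by auto
    let ?W = "WO n e X" and ?T = "TA n (e n)"
    have IH: "ins n k (f \<circ> f') e X = ins n k f' (upd e k f) X \<odot> TA k f' (ins n k f e X)"
      by (rule Suc.IH) (use * in auto)
    have "ins (Suc n) k (f \<circ> f') e X
       = ?T (ins n k f' (upd e k f) X) \<odot> ?T (TA k f' (ins n k f e X))
          \<odot> chiA k f' n (e n) (TO k f ?W) \<odot> TA k f' (chiA k f n (e n) ?W)"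
      using * assms by (simp add: IH chiA_comp_left TA_cpA mono_comp)
    also have "?T (TA k f' (ins n k f e X)) \<odot> chiA k f' n (e n) (TO k f ?W) \<odot> TA k f' (chiA k f n (e n) ?W)
       = chiA k f' n (e n) (WO n (upd e k f) X) \<odot> TA k f' (?T (ins n k f e X))
           \<odot> TA k f' (chiA k f n (e n) ?W)"
      by (rule cpA_cong_left) (use * assms chiA_nat[of k n "ins n k f e X" f' "e n"] in auto)
    finally show ?thesis using * assms by (simp add: TA_cpA)
  qed
qed simp

text \<open>At the colour \<open>l\<close> itself, \<open>g\<close> merges with \<open>e l\<close>
  and \<open>chiA_comp_right\<close> splits the crossing of \<open>f\<close> with the merged letter.
  At each colour above \<open>l\<close> the two letters and \<open>e n\<close> form a
  hexagon.\<close>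

lemma ins_swap:
  assumes "k < l" "l < n" "n \<le> N" "obA X" "mono f" "mono g" "\<And>k. mono (e k)"
  shows "ins n k f (upd e l g) X \<odot> TA k f (ins n l g e X)
    = ins n l g (upd e k f) X \<odot> TA l g (ins n k f e X) \<odot> chiA k f l g (WO n e X)"
  using assms(2,3)
proof (induction n)
  case (Suc n)
  let ?W = "WO n e X" and ?T = "TA n (e n)"
  show ?case
  proof (cases "l = n")
    case True
    then have *: "k < n" "n < N" "k < N" "n \<le> N" "k \<noteq> n" using Suc.prems assms by auto
    have "TA n (e n \<circ> g) (ins n k f e X) = TA n g (?T (ins n k f e X))"
      using * assms by (simp add: TA_comp)
    then show ?thesis using * True assms
      by (simp add: chiA_comp_right TA_cpA TO_comp mono_comp)
  next
    case False
    then have *: "k < l" "k < n" "l < n" "n < N" "k < N" "l < N" "n \<le> N" "k \<noteq> n" "l \<noteq> n"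
      using Suc.prems assms by auto
    let ?ik = "ins n k f (upd e l g) X" and ?il = "ins n l g (upd e k f) X"
    let ?jk = "ins n k f e X" and ?jl = "ins n l g e X"
    let ?s = "chiA k f l g ?W"
    have "ins (Suc n) k f (upd e l g) X \<odot> TA k f (ins (Suc n) l g e X)
      = ?T ?ik \<odot> chiA k f n (e n) (WO n (upd e l g) X) \<odot> TA k f (?T ?jl) \<odot> TA k f (chiA l g n (e n) ?W)"
      using * assms by (simp add: TA_cpA)
    also have "chiA k f n (e n) (WO n (upd e l g) X) \<odot> TA k f (?T ?jl) \<odot> TA k f (chiA l g n (e n) ?W)
      = ?T (TA k f ?jl) \<odot> chiA k f n (e n) (TO l g ?W) \<odot> TA k f (chiA l g n (e n) ?W)"
      by (rule cpA_cong_left) (use * assms chiA_nat[of k n "?jl" f "e n"] in auto)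
    also have "?T ?ik \<odot> \<dots> = ?T (?ik \<odot> TA k f ?jl) \<odot> chiA k f n (e n) (TO l g ?W)
        \<odot> TA k f (chiA l g n (e n) ?W)"
      using * assms by (simp add: TA_cpA)
    also have "\<dots> = ?T ?il \<odot> ?T (TA l g ?jk) \<odot> (?T ?s \<odot> chiA k f n (e n) (TO l g ?W)
        \<odot> TA k f (chiA l g n (e n) ?W))"
      using * assms Suc.IH by (simp add: TA_cpA)
    \<comment> \<open>This is where three-colour coherence enters, for the letters \<open>f\<close>,
      \<open>g\<close> and \<open>e n\<close>; naturality handles everything around it.\<close>
    also have "?T ?s \<odot> chiA k f n (e n) (TO l g ?W) \<odot> TA k f (chiA l g n (e n) ?W)
      = chiA l g n (e n) (TO k f ?W) \<odot> TA l g (chiA k f n (e n) ?W) \<odot> chiA k f l g (TO n (e n) ?W)"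
      using * assms by (simp add: chiA_hexagon)
    also have "?T (TA l g ?jk) \<odot> \<dots>
      = chiA l g n (e n) (WO n (upd e k f) X) \<odot> TA l g (?T ?jk) \<odot> (TA l g (chiA k f n (e n) ?W)
          \<odot> chiA k f l g (TO n (e n) ?W))"
      by (rule cpA_cong_left) (use * assms chiA_nat[of l n "?jk" g "e n"] in auto)
    finally show ?thesis using * assms by (simp add: TA_cpA)
  qed
qed simp

text \<open>
  A letter \<open>(f, k)\<close> is a monotone map of colour \<open>k\<close>; as for shuffles, the head of a word is
  applied last.
\<close>

fun ev :: "((nat \<Rightarrow> nat) \<times> nat) list \<Rightarrow> nat \<Rightarrow> nat \<Rightarrow> nat" where
  "ev [] = (\<lambda>_. id)"
| "ev (x # \<Theta>) = upd (ev \<Theta>) (snd x) (fst x)"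

fun TW :: "((nat \<Rightarrow> nat) \<times> nat) list \<Rightarrow> ((nat \<Rightarrow> nat) \<Rightarrow> 'o) \<Rightarrow> (nat \<Rightarrow> nat) \<Rightarrow> 'o" where
  "TW [] X = X"
| "TW (x # \<Theta>) X = TO (snd x) (fst x) (TW \<Theta> X)"

fun TWA :: "((nat \<Rightarrow> nat) \<times> nat) list \<Rightarrow> ((nat \<Rightarrow> nat) \<Rightarrow> 'a) \<Rightarrow> (nat \<Rightarrow> nat) \<Rightarrow> 'a" where
  "TWA [] F = F"
| "TWA (x # \<Theta>) F = TA (snd x) (fst x) (TWA \<Theta> F)"

text \<open>The tail is sorted before the head is inserted, so no sequence of swaps is chosen. The
  price is that sorting a prefix first is not built in; \<open>coh_left\<close> recovers it.\<close>

fun coh :: "((nat \<Rightarrow> nat) \<times> nat) list \<Rightarrow> ((nat \<Rightarrow> nat) \<Rightarrow> 'o) \<Rightarrow> (nat \<Rightarrow> nat) \<Rightarrow> 'a" where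
  "coh [] X = idA X"
| "coh (x # \<Theta>) X = ins N (snd x) (fst x) (ev \<Theta>) X \<odot> TA (snd x) (fst x) (coh \<Theta> X)"

definition vword :: "((nat \<Rightarrow> nat) \<times> nat) list \<Rightarrow> bool" where
  "vword \<Theta> \<longleftrightarrow> (\<forall>x\<in>set \<Theta>. mono (fst x) \<and> snd x < N)"

text \<open>Every colour below \<open>n\<close> receives one letter, identities included, and the
  highest colour stands leftmost because colour \<open>0\<close> acts first.\<close>

fun sword :: "nat \<Rightarrow> (nat \<Rightarrow> nat \<Rightarrow> nat) \<Rightarrow> ((nat \<Rightarrow> nat) \<times> nat) list" where
  "sword 0 e = []"
| "sword (Suc n) e = (e n, n) # sword n e"

lemma sword_cong: "(\<And>k. k < n \<Longrightarrow> e k = e' k) \<Longrightarrow> sword n e = sword n e'"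
  by (induction n) auto

lemma sword_upd: "n \<le> k \<Longrightarrow> sword n (upd e k f) = sword n e"
  by (rule sword_cong) simp

lemma vword_simps [simp]: "vword []" "vword (x # \<Theta>) \<longleftrightarrow> mono (fst x) \<and> snd x < N \<and> vword \<Theta>"
  "vword (\<Theta> @ \<Theta>') \<longleftrightarrow> vword \<Theta> \<and> vword \<Theta>'"
  by (auto simp: vword_def)

lemma vword_sword [simp]: "n \<le> N \<Longrightarrow> (\<And>k. mono (e k)) \<Longrightarrow> vword (sword n e)"
  by (induction n) auto

lemma mono_ev [simp]: "vword \<Theta> \<Longrightarrow> mono (ev \<Theta> k)"
  by (induction \<Theta> arbitrary: k) auto

lemma ev_append: "ev (\<Gamma> @ \<Lambda>) k = ev \<Lambda> k \<circ> ev \<Gamma> k"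
  by (induction \<Gamma> arbitrary: k) (auto simp: upd_def comp_assoc)

lemma ev_sword: "ev (sword n e) k = (if k < n then e k else id)"
  by (induction n) (auto simp: upd_def)

lemma ev_outside: "vword \<Theta> \<Longrightarrow> N \<le> k \<Longrightarrow> ev \<Theta> k = id"
  by (induction \<Theta>) (auto simp: upd_def)

lemma ev_sword_ev [simp]: "vword \<Theta> \<Longrightarrow> ev (sword N (ev \<Theta>)) = ev \<Theta>"
  using ev_outside by (fastforce simp: ev_sword)

lemma TW_append: "TW (\<Gamma> @ \<Lambda>) X = TW \<Gamma> (TW \<Lambda> X)"
  by (induction \<Gamma>) auto

lemma TWA_append: "TWA (\<Gamma> @ \<Lambda>) X = TWA \<Gamma> (TWA \<Lambda> X)"
  by (induction \<Gamma>) auto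

lemma TW_sword [simp]: "TW (sword n e) X = WO n e X"
  by (induction n) auto

lemma TWA_sword [simp]: "TWA (sword n e) X = WA n e X"
  by (induction n) auto

lemma TW_ob [simp]: "vword \<Theta> \<Longrightarrow> obA X \<Longrightarrow> obA (TW \<Theta> X)"
  by (induction \<Theta>) auto

lemma TWA_simps [simp]:
  assumes "vword \<Theta>" "arA F"
  shows "arA (TWA \<Theta> F)" "dmA (TWA \<Theta> F) = TW \<Theta> (dmA F)" "cdA (TWA \<Theta> F) = TW \<Theta> (cdA F)"
proof -
  have "arA (TWA \<Theta> F) \<and> dmA (TWA \<Theta> F) = TW \<Theta> (dmA F) \<and> cdA (TWA \<Theta> F) = TW \<Theta> (cdA F)"
    using assms by (induction \<Theta>) auto
  then show "arA (TWA \<Theta> F)" "dmA (TWA \<Theta> F) = TW \<Theta> (dmA F)" "cdA (TWA \<Theta> F) = TW \<Theta> (cdA F)"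
    by auto
qed

lemma TWA_idA [simp]: "vword \<Theta> \<Longrightarrow> obA X \<Longrightarrow> TWA \<Theta> (idA X) = idA (TW \<Theta> X)"
  by (induction \<Theta>) auto

lemma WO_id [simp]: "n \<le> N \<Longrightarrow> obA X \<Longrightarrow> WO n (\<lambda>_. id) X = X"
  by (induction n) auto

lemma WA_id [simp]: "n \<le> N \<Longrightarrow> arA X \<Longrightarrow> WA n (\<lambda>_. id) X = X"
  by (induction n) auto

lemma coh_simps [simp]:
  assumes "vword \<Theta>" "obA X"
  shows "arA (coh \<Theta> X)" "dmA (coh \<Theta> X) = TW \<Theta> X" "cdA (coh \<Theta> X) = WO N (ev \<Theta>) X"
proof -
  have "arA (coh \<Theta> X) \<and> dmA (coh \<Theta> X) = TW \<Theta> X \<and> cdA (coh \<Theta> X) = WO N (ev \<Theta>) X"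
    using assms by (induction \<Theta>) auto
  then show "arA (coh \<Theta> X)" "dmA (coh \<Theta> X) = TW \<Theta> X" "cdA (coh \<Theta> X) = WO N (ev \<Theta>) X"
    by auto
qed

section \<open>Invariance of the canonical transformation\<close>

lemma coh_nat:
  assumes "vword \<Theta>" "arA F"
  shows "coh \<Theta> (cdA F) \<odot> TWA \<Theta> F = WA N (ev \<Theta>) F \<odot> coh \<Theta> (dmA F)"
  using assms(1)
proof (induction \<Theta>)
  case Nil
  have "coh [] (cdA F) \<odot> TWA [] F = WA N (ev []) F \<odot> coh [] (dmA F)" using assms by simp
  then show ?case .
next
  case (Cons x \<Theta>)
  let ?k = "snd x" and ?f = "fst x"
  have "coh (x # \<Theta>) (cdA F) \<odot> TWA (x # \<Theta>) F
     = ins N ?k ?f (ev \<Theta>) (cdA F) \<odot> TA ?k ?f (WA N (ev \<Theta>) F) \<odot> TA ?k ?f (coh \<Theta> (dmA F))"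
    using Cons assms by (simp add: TA_cpA[symmetric])
  also have "\<dots> = WA N (upd (ev \<Theta>) ?k ?f) F \<odot> ins N ?k ?f (ev \<Theta>) (dmA F) \<odot> TA ?k ?f (coh \<Theta> (dmA F))"
    by (rule cpA_cong_left) (use Cons assms ins_nat in auto)
  finally show ?case by simp
qed

text \<open>Without a prefix this is \<open>ins_swap\<close>, followed by naturality of the crossing
  along the sorting of \<open>\<Lambda>\<close>. Letters of the prefix see the rest only through
  \<open>ev\<close>, which the swap does not change.\<close>

lemma coh_swap:
  assumes "vword \<Gamma>" "vword \<Lambda>" "mono f" "mono g" "k < l" "l < N" "obA X"
  shows "coh (\<Gamma> @ (f, k) # (g, l) # \<Lambda>) X
    = coh (\<Gamma> @ (g, l) # (f, k) # \<Lambda>) X \<odot> TWA \<Gamma> (chiA k f l g (TW \<Lambda> X))"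
  using assms(1)
proof (induction \<Gamma>)
  case Nil
  have kN: "k < N" using assms by simp
  let ?e = "ev \<Lambda>" and ?C = "coh \<Lambda> X"
  have "coh ((f, k) # (g, l) # \<Lambda>) X
     = ins N k f (upd ?e l g) X \<odot> TA k f (ins N l g ?e X) \<odot> TA k f (TA l g ?C)"
    using assms kN by (simp add: TA_cpA)
  also have "\<dots> = ins N l g (upd ?e k f) X \<odot> (TA l g (ins N k f ?e X) \<odot> chiA k f l g (WO N ?e X))
     \<odot> TA k f (TA l g ?C)"
    by (rule cpA_cong_left) (use assms kN ins_swap in \<open>auto simp: upd_twist\<close>)
  also have "\<dots> = ins N l g (upd ?e k f) X \<odot> TA l g (ins N k f ?e X) \<odot> (chiA k f l g (cdA ?C)
     \<odot> TA k f (TA l g ?C))"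
    using assms kN by simp
  also have "\<dots> = ins N l g (upd ?e k f) X \<odot> TA l g (ins N k f ?e X) \<odot> TA l g (TA k f ?C)
      \<odot> chiA k f l g (TW \<Lambda> X)"
    by (subst chiA_nat) (use assms kN in auto)
  finally show ?case using assms kN by (simp add: TA_cpA)
next
  case (Cons x \<Gamma>)
  have kN: "k < N" using assms by simp
  have "ev (\<Gamma> @ (f, k) # (g, l) # \<Lambda>) = ev (\<Gamma> @ (g, l) # (f, k) # \<Lambda>)"
    using assms(5) by (induction \<Gamma>) (auto simp: upd_twist)
  then show ?case using Cons assms kN by (simp add: TA_cpA TW_append)
qed

text \<open>A consequence of \<open>ins_comp\<close>. It replaces all relations between faces and
  degeneracies of one colour, since only the composite map survives.\<close>

lemma coh_merge:
  assumes "vword \<Gamma>" "vword \<Lambda>" "mono f" "mono g" "k < N" "obA X"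
  shows "coh (\<Gamma> @ (g, k) # (f, k) # \<Lambda>) X = coh (\<Gamma> @ (f \<circ> g, k) # \<Lambda>) X"
proof -
  define h where "h = f \<circ> g"
  have "coh (\<Gamma> @ (g, k) # (f, k) # \<Lambda>) X = coh (\<Gamma> @ (h, k) # \<Lambda>) X"
    using assms(1)
  proof (induction \<Gamma>)
    case Nil
    have "coh ([] @ (g, k) # (f, k) # \<Lambda>) X = coh ([] @ (h, k) # \<Lambda>) X"
      using assms by (simp add: h_def ins_comp TA_cpA TA_comp TO_comp)
    then show ?case .
  next
    case (Cons x \<Gamma>)
    have "ev (\<Gamma> @ (g, k) # (f, k) # \<Lambda>) = ev (\<Gamma> @ (h, k) # \<Lambda>)"
      by (auto simp: h_def ev_append upd_upd)
    then show ?case using Cons by simp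
  qed
  then show ?thesis by (simp add: h_def)
qed

lemma coh_sword:
  assumes "n \<le> N" "\<And>k. mono (e k)" "obA X"
  shows "coh (sword n e) X = idA (WO n e X)"
  using assms(1)
proof (induction n)
  case (Suc n)
  then have "ins N n (e n) (ev (sword n e)) X = idA (TO n (e n) (WO N (ev (sword n e)) X))"
    using assms by (intro ins_triv) (auto simp: ev_sword)
  moreover have "WO N (ev (sword n e)) X = WO n e X"
    using Suc assms coh_simps(3)[of "sword n e" X] by simp
  ultimately show ?case using Suc assms by simp
qed simp

text \<open>Inserting the letters of \<open>\<Gamma>\<close> uses only the total effect
  \<open>ev \<Lambda>\<close>, and the sorted word with the same effect has trivial
  \<open>coh\<close>.\<close>

lemma coh_right:
  assumes "vword \<Gamma>" "vword \<Lambda>" "obA X"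
  shows "coh (\<Gamma> @ \<Lambda>) X = coh (\<Gamma> @ sword N (ev \<Lambda>)) X \<odot> TWA \<Gamma> (coh \<Lambda> X)"
  using assms(1)
proof (induction \<Gamma>)
  case Nil
  then show ?case using assms by (simp add: coh_sword)
next
  case (Cons x \<Gamma>)
  have "ev (\<Gamma> @ \<Lambda>) = ev (\<Gamma> @ sword N (ev \<Lambda>))" using assms by (auto simp: ev_append)
  then show ?case using Cons assms by (simp add: TA_cpA TW_append)
qed

text \<open>Walks a letter through a sorted word in the presence of a suffix:
  \<open>coh_swap\<close> at every higher colour, \<open>coh_merge\<close> at its own. This is the
  inductive step of \<open>coh_left\<close>.\<close>

lemma coh_ins:
  assumes "vword \<Lambda>" "obA X" "mono f" "\<And>k. mono (e k)" "k < n" "n \<le> N"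
  shows "coh ((f, k) # sword n e @ \<Lambda>) X = coh (sword n (upd e k f) @ \<Lambda>) X \<odot> ins n k f e (TW \<Lambda> X)"
  using assms(5,6)
proof (induction n)
  case (Suc n)
  show ?case
  proof (cases "k = n")
    case True
    have "sword n (upd e n f) = sword n e" by (rule sword_upd) simp
    then show ?thesis
      using True Suc.prems assms coh_merge[of "[]" "sword n e @ \<Lambda>" "e n" f n X]
      by (simp add: TO_comp mono_comp TW_append ev_append comp_assoc del: coh.simps)
  next
    case False
    then have *: "k < n" "n < N" "k < N" "n \<le> N" "k \<noteq> n" using Suc.prems by auto
    let ?e' = "upd e k f"
    have ev: "ev ((f, k) # sword n e @ \<Lambda>) = ev (sword n ?e' @ \<Lambda>)"
      using * by (auto simp: ev_append ev_sword upd_def comp_assoc)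
    have "coh ((f, k) # sword (Suc n) e @ \<Lambda>) X
      = coh ((e n, n) # (f, k) # sword n e @ \<Lambda>) X \<odot> chiA k f n (e n) (TW (sword n e @ \<Lambda>) X)"
      using coh_swap[of "[]" "sword n e @ \<Lambda>" f "e n" k n X] * assms by simp
    also have "\<dots> = ins N n (e n) (ev (sword n ?e' @ \<Lambda>)) X \<odot> TA n (e n) (coh (sword n ?e' @ \<Lambda>) X)
       \<odot> TA n (e n) (ins n k f e (TW \<Lambda> X)) \<odot> chiA k f n (e n) (TW (sword n e @ \<Lambda>) X)"
      using * assms Suc.IH ev by (simp add: TA_cpA TW_append del: ev.simps)
    finally show ?thesis using * assms by (simp add: TW_append)
  qed
qed simp

lemma coh_left:
  assumes "vword \<Gamma>" "vword \<Lambda>" "obA X"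
  shows "coh (\<Gamma> @ \<Lambda>) X = coh (sword N (ev \<Gamma>) @ \<Lambda>) X \<odot> coh \<Gamma> (TW \<Lambda> X)"
  using assms(1)
proof (induction \<Gamma>)
  case Nil
  \<comment> \<open>The empty prefix is replaced by one identity letter for each colour, and
    inserting an identity is trivial by \<open>ins_id\<close>.\<close>
  have "coh (sword n (\<lambda>_. id) @ \<Lambda>) X = coh \<Lambda> X" if "n \<le> N" for n
    using that assms
  proof (induction n)
    case (Suc n)
    have "ev (sword n (\<lambda>_. id) @ \<Lambda>) = ev \<Lambda>" by (auto simp: ev_append ev_sword)
    moreover have "coh (sword n (\<lambda>_. id) @ \<Lambda>) X = coh \<Lambda> X" by (rule Suc.IH) (use Suc.prems in auto)
    ultimately have "coh (sword (Suc n) (\<lambda>_. id) @ \<Lambda>) X = coh \<Lambda> X" using Suc.prems by (simp add: ins_id)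
    then show ?case .
  qed simp
  then have "coh ([] @ \<Lambda>) X = coh (sword N (ev []) @ \<Lambda>) X \<odot> coh [] (TW \<Lambda> X)"
    using assms by simp
  then show ?case .
next
  case (Cons x \<Gamma>)
  let ?k = "snd x" and ?f = "fst x" and ?n = "sword N (ev \<Gamma>)"
  have ev: "ev (\<Gamma> @ \<Lambda>) = ev (?n @ \<Lambda>)" using Cons assms by (auto simp: ev_append)
  have "coh ((x # \<Gamma>) @ \<Lambda>) X = coh (x # ?n @ \<Lambda>) X \<odot> TA ?k ?f (coh \<Gamma> (TW \<Lambda> X))"
    using Cons assms by (simp add: ev TA_cpA TW_append)
  also have "coh (x # ?n @ \<Lambda>) X = coh (sword N (upd (ev \<Gamma>) ?k ?f) @ \<Lambda>) X \<odot> ins N ?k ?f (ev \<Gamma>) (TW \<Lambda> X)"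
    using coh_ins[of \<Lambda> X ?f "ev \<Gamma>" ?k N] Cons assms by simp
  finally show ?case using Cons assms by (simp add: TW_append)
qed

text \<open>Both sides are the canonical transformation of the word formed by all three factors.\<close>

lemma coh_assoc:
  assumes "\<And>k. mono (e1 k)" "\<And>k. mono (e2 k)" "\<And>k. mono (e3 k)" "obA X"
  shows "coh (sword N (\<lambda>k. e2 k \<circ> e3 k) @ sword N e1) X \<odot> coh (sword N e3 @ sword N e2) (WO N e1 X)
    = coh (sword N e3 @ sword N (\<lambda>k. e1 k \<circ> e2 k)) X \<odot> WA N e3 (coh (sword N e2 @ sword N e1) X)"
proof -
  have sword: "sword N (ev (sword N e @ sword N e')) = sword N (\<lambda>k. e' k \<circ> e k)" for e e'
    by (rule sword_cong) (simp add: ev_append ev_sword)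
  \<comment> \<open>The one word \<open>sword N e3 @ sword N e2 @ sword N e1\<close> is split before
    its last block by \<open>coh_left\<close> and after its first block by
    \<open>coh_right\<close>.\<close>
  show ?thesis
    using coh_left[of "sword N e3 @ sword N e2" "sword N e1" X] coh_right[of "sword N e3" "sword N e2
        @ sword N e1" X] assms
    by (simp add: sword)
qed

end

section \<open>Normal forms in the simplicial category\<close>

text \<open>
  A simplicial map is extended beyond its domain by a shift, which makes \<open>tmap\<close> functorial and
  turns identities into \<open>id\<close>.
\<close>

definition tmap :: "simplicial_map \<Rightarrow> nat \<Rightarrow> nat" where
  "tmap = (\<lambda>(m, n, \<phi>) j. if j \<le> m then \<phi> j else n + (j - m))"

lemma Delta_sel [simp]:
  "objs Delta = UNIV" "src Delta (m, n, \<phi>) = m" "tgt Delta (m, n, \<phi>) = n"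
  "idn Delta p = (p, p, \<lambda>i\<in>{..p}. i)"
  "cmp Delta (n, p, \<psi>) (m, n', \<phi>) = (m, p, compose {..m} \<psi> \<phi>)"
  by (simp_all add: Delta_def)

lemma Delta_arr_iff [simp]:
  "(m, n, \<phi>) \<in> arrs Delta \<longleftrightarrow> \<phi> \<in> {..m} \<rightarrow>\<^sub>E {..n} \<and> mono_on {..m} \<phi>"
  by (simp add: Delta_def)

lemma op_cat_sel [simp]:
  "objs (op_cat C) = objs C" "arrs (op_cat C) = arrs C" "src (op_cat C) = tgt C"
  "tgt (op_cat C) = src C" "idn (op_cat C) = idn C" "cmp (op_cat C) g f = cmp C f g"
  by (simp_all add: op_cat_def)

lemma Delta_cmp_arr:
  assumes "f \<in> arrs Delta" "g \<in> arrs Delta" "tgt Delta f = src Delta g"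
  shows "cmp Delta g f \<in> arrs Delta"
  using assms by (cases f; cases g) (auto simp: compose_def mono_on_def PiE_iff Pi_iff)

lemma Delta_cmp_src_tgt [simp]:
  "src Delta (cmp Delta g f) = src Delta f" "tgt Delta (cmp Delta g f) = tgt Delta g"
  by (cases f; cases g; simp)+

lemma category_Delta: "category Delta"
proof
  fix f A B
  assume "f \<in> hom Delta A B"
  then show "cmp Delta (idn Delta B) f = f" "cmp Delta f (idn Delta A) = f"
    by (cases f; auto simp: hom_def compose_def PiE_iff Pi_iff extensional_def)+
next
  fix f g h A B D E
  assume "f \<in> hom Delta A B" "g \<in> hom Delta B D" "h \<in> hom Delta D E"
  then show "cmp Delta (cmp Delta h g) f = cmp Delta h (cmp Delta g f)"
    by (cases f; cases g; cases h) (auto simp: hom_def compose_def PiE_iff Pi_iff)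
qed (auto simp: hom_def Delta_cmp_arr mono_on_def)

lemma category_op: "category C \<Longrightarrow> category (op_cat C)"
  unfolding category_def by (auto simp: hom_def)

lemma tmap_idn [simp]: "tmap (p, p, \<lambda>i\<in>{..p}. i) = id"
  by (auto simp: tmap_def)

lemma tmap_cmp:
  assumes "f \<in> arrs Delta" "g \<in> arrs Delta" "tgt Delta f = src Delta g"
  shows "tmap (cmp Delta g f) = tmap g \<circ> tmap f"
  using assms by (cases f; cases g) (auto simp: tmap_def compose_def PiE_iff Pi_iff fun_eq_iff)

lemma tmap_mono: "f \<in> arrs Delta \<Longrightarrow> mono (tmap f)"
proof (cases f)
  case (fields m n \<phi>)
  assume f: "f \<in> arrs Delta"
  show ?thesis
  proof
    fix r s :: nat assume "r \<le> s"
    consider "s \<le> m" | "r \<le> m" "m < s" | "m < r" by linarith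
    then show "tmap f r \<le> tmap f s"
    proof cases
      case 2
      then have "\<phi> r \<le> n" using f fields by auto
      then show ?thesis using 2 fields by (simp add: tmap_def)
    qed (use f fields \<open>r \<le> s\<close> in \<open>auto simp: tmap_def mono_on_def\<close>)
  qed
qed

lemma tmap_le: "f \<in> arrs Delta \<Longrightarrow> j \<le> src Delta f \<Longrightarrow> tmap f j \<le> tgt Delta f"
  by (cases f) (auto simp: tmap_def PiE_iff Pi_iff)

lemma tmap_inj:
  assumes "f \<in> arrs Delta" "g \<in> arrs Delta" "src Delta f = src Delta g" "tgt Delta f = tgt Delta g"
    "tmap f = tmap g"
  shows "f = g"
proof -
  obtain m n \<phi> \<psi> where fg: "f = (m, n, \<phi>)" "g = (m, n, \<psi>)"
    using assms(3,4) by (cases f; cases g) auto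
  have "\<phi> j = \<psi> j" for j
    using assms(1,2) fun_cong[OF assms(5), of j]
    by (cases "j \<le> m") (auto simp: fg tmap_def PiE_iff extensional_def)
  then show ?thesis by (auto simp: fg)
qed

text \<open>Continued by a shift, cofaces and codegeneracies keep the same formula everywhere, so
  the dimension \<open>n\<close> leaves no trace in the map.\<close>

fun bmap :: "basic \<Rightarrow> nat \<Rightarrow> nat" where
  "bmap (Face n i) j = (if j < i then j else Suc j)"
| "bmap (Degen n i) j = (if j \<le> i then j else j - 1)"

lemma bmap_mono: "mono (bmap b)"
  by (cases b) (auto simp: mono_def)

lemma basic_arr_simps:
  assumes "basic_valid b"
  shows "basic_arr b \<in> arrs Delta" "src Delta (basic_arr b) = btgt b" "tgt Delta (basic_arr b) = bsrc b"
    "tmap (basic_arr b) = bmap b"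
  using assms by (cases b; auto simp: mono_on_def tmap_def fun_eq_iff PiE_iff Pi_iff extensional_def)+

section \<open>Words of faces and degeneracies as monotone maps\<close>

fun wmap :: "basic list \<Rightarrow> nat \<Rightarrow> nat" where
  "wmap [] = id"
| "wmap (b # w) = wmap w \<circ> bmap b"

fun wtgt :: "nat \<Rightarrow> basic list \<Rightarrow> nat" where
  "wtgt n [] = n"
| "wtgt n (b # w) = btgt b"

lemma word_arr_simps:
  assumes "composable n w"
  shows "word_arr n w \<in> arrs Delta \<and> src Delta (word_arr n w) = wtgt n w
    \<and> tgt Delta (word_arr n w) = n \<and> tmap (word_arr n w) = wmap w"
  using assms
proof (induction w)
  case Nil
  then show ?case by (auto simp: mono_on_def)
next
  case (Cons b w)
  then show ?case by (auto simp: Delta_cmp_arr tmap_cmp basic_arr_simps)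
qed

lemma composable_Cons:
  "composable n (b # w) \<longleftrightarrow> basic_valid b \<and> composable n w \<and> bsrc b = wtgt n w"
  using word_arr_simps[of n w] by auto

text \<open>A pairwise form of normality: \<open>sorted_wrt\<close> with this relation passes to
  tails, so letters can be peeled off by induction.\<close>

fun normal_order :: "basic \<Rightarrow> basic \<Rightarrow> bool" where
  "normal_order (Degen _ i) (Degen _ j) \<longleftrightarrow> j < i"
| "normal_order (Degen _ _) (Face _ _) \<longleftrightarrow> True"
| "normal_order (Face _ i) (Face _ j) \<longleftrightarrow> j \<le> i"
| "normal_order (Face _ _) (Degen _ _) \<longleftrightarrow> False"

lemma normal_word_iff: "normal_word w \<longleftrightarrow> sorted_wrt normal_order w"
proof
  assume "normal_word w"
  then show "sorted_wrt normal_order w"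
    by (auto simp: normal_word_def sorted_wrt_append sorted_wrt_map split_beta)
next
  show "sorted_wrt normal_order w \<Longrightarrow> normal_word w"
  proof (induction w)
    case Nil
    then show ?case by (simp add: normal_word_def)
  next
    case (Cons b w)
    then obtain ss ds where w: "w = map (\<lambda>(n, i). Degen n i) ss @ map (\<lambda>(n, i). Face n i) ds"
      "sorted_wrt (>) (map snd ss)" "sorted_wrt (\<ge>) (map snd ds)"
      by (auto simp: normal_word_def)
    show ?case
    proof (cases b)
      case (Face n i)
      have "ss = []" using Cons.prems by (cases ss) (auto simp: w Face)
      then show ?thesis
        unfolding normal_word_def using w Cons.prems
        by (intro exI[of _ "[]"] exI[of _ "(n, i) # ds"]) (auto simp: Face)
    next
      case (Degen n i)
      have "snd x < i" if "x \<in> set ss" for x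
      proof -
        have "Degen (fst x) (snd x) \<in> set w" using that by (force simp: w(1) split_beta)
        then show ?thesis using Cons.prems Degen by fastforce
      qed
      then show ?thesis
        unfolding normal_word_def using w
        by (intro exI[of _ "(n, i) # ss"] exI[of _ ds]) (auto simp: Degen)
    qed
  qed
qed

text \<open>A word of faces is eventually the shift by its length. Since face indices decrease
  weakly, the leading index \<open>j\<close> is the least point from which this shift holds; length
  and leading letter can thus be read off from the map.\<close>

lemma faces_word:
  assumes "sorted_wrt normal_order w" "\<And>b. b \<in> set w \<Longrightarrow> \<exists>n i. b = Face n i"
  shows "(\<forall>i. i \<le> wmap w i \<and> wmap w i \<le> i + length w) \<and> (\<forall>i. wmap w i < wmap w (Suc i))
    \<and> (w = [] \<or> (\<exists>n j w'. w = Face n j # w' \<and> (\<forall>i\<ge>j. wmap w i = i + length w)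
       \<and> (\<forall>i<j. wmap w i < i + length w)))"
  using assms
proof (induction w)
  case (Cons b w)
  from Cons.prems(2)[of b] obtain n j where b: "b = Face n j" by auto
  have IH: "i \<le> wmap w i" "wmap w i \<le> i + length w" "wmap w i < wmap w (Suc i)" for i
    using Cons by auto
  have mono: "wmap w i < wmap w i'" if "i < i'" for i i'
    using IH(3) that by (rule lift_Suc_mono_less)
  have *: "wmap w i = i + length w" if "j < i" for i
  proof (cases w)
    case (Cons b' w')
    have "\<exists>n' j'. b' = Face n' j'" using Cons.prems Cons by auto
    then obtain n' j' where b': "b' = Face n' j'" by auto
    then have "j' \<le> j" using Cons.prems Cons b by auto
    then show ?thesis using Cons.IH Cons.prems b' that Cons by auto
  qed simp
  have "i \<le> wmap (b # w) i \<and> wmap (b # w) i \<le> i + length (b # w)" for i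
    using IH[of i] IH[of "Suc i"] by (simp add: b)
  moreover have "wmap (b # w) i < wmap (b # w) (Suc i)" for i
    using mono by (auto simp: b)
  moreover have "wmap (b # w) i = i + length (b # w)" if "j \<le> i" for i
    using *[of "Suc i"] that by (simp add: b)
  moreover have "wmap (b # w) i < i + length (b # w)" if "i < j" for i
    using IH(2)[of i] that by (simp add: b)
  ultimately show ?case using b by blast
qed simp

lemma faces_wordI:
  assumes "sorted_wrt normal_order (Face n j # w)" "b \<in> set (Face n j # w)"
  shows "\<exists>n i. b = Face n i"
  using assms by (cases b) auto

text \<open>Degeneracy indices decrease strictly, so the leading one is the last place where the map
  repeats a value, and the map determines it.\<close>

lemma degen_word:
  assumes "sorted_wrt normal_order (Degen n l # w)"
  shows "wmap (Degen n l # w) l = wmap (Degen n l # w) (Suc l)"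
    "l < i \<Longrightarrow> wmap (Degen n l # w) i < wmap (Degen n l # w) (Suc i)"
proof -
  have "\<forall>i>l. wmap (Degen n l # w) i < wmap (Degen n l # w) (Suc i)"
    using assms
  proof (induction w arbitrary: n l)
    case Nil
    then show ?case by auto
  next
    case (Cons b w)
    show ?case
    proof (cases b)
      case (Degen n' l')
      then have "l' < l" "sorted_wrt normal_order (Degen n' l' # w)" using Cons.prems by auto
      then have "wmap (b # w) i < wmap (b # w) (Suc i)" if "l \<le> i" for i
        using Cons.IH[of n' l'] Degen that by auto
      then have "wmap (b # w) (i - 1) < wmap (b # w) i" if "l < i" for i
        using that by (metis Suc_pred' gr_implies_not0 less_Suc_eq_le neq0_conv)
      then show ?thesis by (simp del: wmap.simps(2) add: wmap.simps(2)[of "Degen n l"])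
    next
      case (Face n' j)
      then have "\<forall>i. wmap (b # w) i < wmap (b # w) (Suc i)"
        using faces_word[of "b # w"] faces_wordI[of n' j w] Cons.prems by auto
      then have "wmap (b # w) (i - 1) < wmap (b # w) i" if "l < i" for i
        using that by (metis Suc_pred' gr_implies_not0 neq0_conv)
      then show ?thesis by (simp del: wmap.simps(2) add: wmap.simps(2)[of "Degen n l"])
    qed
  qed
  then show "l < i \<Longrightarrow> wmap (Degen n l # w) i < wmap (Degen n l # w) (Suc i)" by blast
qed simp

text \<open>The leading letter is read off from the map by \<open>faces_word\<close> or
  \<open>degen_word\<close>. The tails then induce equal maps and the induction hypothesis applies;
  the dimension of the leading letter follows from composability.\<close>

lemma normal_word_unique:
  assumes "sorted_wrt normal_order w" "sorted_wrt normal_order w'" "composable n w" "composable n w'"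
      "wmap w = wmap w'"
  shows "w = w'"
  using assms
proof (induction w arbitrary: w')
  case Nil
  show ?case
  proof (cases w')
    case (Cons b w1)
    show ?thesis
    proof (cases b)
      case (Face m j)
      then have "wmap w' j = j + length w'"
        using faces_word[of w'] faces_wordI[of m j w1] Nil.prems Cons by auto
      then show ?thesis using fun_cong[OF Nil.prems(5), of j] Cons by simp
    next
      case (Degen m l)
      then have "wmap w' l = wmap w' (Suc l)" using degen_word(1)[of m l w1] Nil.prems Cons by simp
      then show ?thesis
        using fun_cong[OF Nil.prems(5), of l] fun_cong[OF Nil.prems(5), of "Suc l"] by simp
    qed
  qed simp
next
  case (Cons b w)
  have IH: "w = w1" if "sorted_wrt normal_order w1" "composable n w1" "wmap w = wmap w1" for w1
    using Cons.prems(1,3) by (intro Cons.IH that) simp_all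
  have eq: "wmap (b # w) i = wmap w' i" for i by (simp only: Cons.prems(5))
  show ?case
  proof (cases b)
    case b: (Face m j)
    have fw: "(\<forall>i\<ge>j. wmap (b # w) i = i + length (b # w))"
        "(\<forall>i<j. wmap (b # w) i < i + length (b # w))" "\<forall>i. wmap (b # w) i < wmap (b # w) (Suc i)"
      using faces_word[of "b # w"] faces_wordI[of m j w] Cons.prems b by auto
    show ?thesis
    proof (cases w')
      case Nil
      then have "wmap (b # w) j = j" using eq[of j] by simp
      then show ?thesis using fw(1) by fastforce
    next
      case w': (Cons b' w1)
      show ?thesis
      proof (cases b')
        case b': (Face m' j')
        have fw': "(\<forall>i\<ge>j'. wmap w' i = i + length w')" "(\<forall>i<j'. wmap w' i < i + length w')"
          using faces_word[of w'] faces_wordI[of m' j' w1] Cons.prems b' w' by auto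
        \<comment> \<open>At a point beyond both leading indices the two words act as shifts by
          their lengths.\<close>
        have len: "length (b # w) = length w'"
          using fw(1)[rule_format, of "max j j'"] fw'(1)[rule_format, of "max j j'"] eq[of "max j j'"]
          by linarith
        have jj: "j = j'"
        proof (rule linorder_cases[of j j'])
          assume "j < j'"
          then show ?thesis using fw(1)[rule_format, of j] fw'(2)[rule_format, of j] eq[of j] len by linarith
        next
          assume "j' < j"
          then show ?thesis using fw(2)[rule_format, of j'] fw'(1)[rule_format, of j'] eq[of j'] len by linarith
        qed
        \<comment> \<open>A coface omits \<open>j\<close>, so the composite says nothing about the
          tail at \<open>j\<close>. That value is forced all the same: the indices in the tail are
          at most \<open>j\<close>, so the tail is already a full shift there.\<close>
        have tail: "wmap v j = j + length v" if tl: "sorted_wrt normal_order (Face k j # v)" for v k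
        proof (cases v)
          case (Cons c u)
          then obtain p i where c: "c = Face p i" using faces_wordI[OF tl, of c] by auto
          then have "i \<le> j" using tl Cons by auto
          then show ?thesis using faces_word[of v] faces_wordI[of p i u] tl Cons c by auto
        qed simp
        have "wmap w i = wmap w1 i" for i
        proof -
          consider "i < j" | "i = j" | "j < i" by linarith
          then show ?thesis
          proof cases
            case 1
            then show ?thesis using fun_cong[OF Cons.prems(5), of i] b b' w' jj by simp
          next
            case 2
            then show ?thesis using tail[of m w] tail[of m' w1] len Cons.prems b b' w' jj by simp
          next
            case 3
            then obtain k where "i = Suc k" "j \<le> k" by (cases i) auto
            then show ?thesis using fun_cong[OF Cons.prems(5), of k] b b' w' jj by simp
          qed
        qed
        then have "w = w1" using Cons.prems(2,4) w' by (intro IH) auto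
        moreover have "m = m'"
          using \<open>w = w1\<close> Cons.prems b b' w' by (simp add: composable_Cons del: composable.simps)
        ultimately show ?thesis using b b' w' jj by simp
      next
        case (Degen m' l)
        then have "wmap w' l = wmap w' (Suc l)" using degen_word(1)[of m' l w1] Cons.prems(2) w' by blast
        then show ?thesis using fw(3)[rule_format, of l] eq[of l] eq[of "Suc l"] by linarith
      qed
    qed
  next
    case b: (Degen m l)
    have dw: "wmap w' l = wmap w' (Suc l)" "l < i \<Longrightarrow> wmap w' i < wmap w' (Suc i)" for i
      using degen_word(1)[of m l w] degen_word(2)[of m l w i] Cons.prems(1)
      unfolding eq[symmetric] b by blast+
    show ?thesis
    proof (cases w')
      case Nil
      then show ?thesis using dw(1) by simp
    next
      case w': (Cons b' w1)
      show ?thesis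
      proof (cases b')
        case b': (Face m' j')
        then have "wmap w' l < wmap w' (Suc l)"
          using faces_word[of w'] faces_wordI[of m' j' w1] Cons.prems(2) w' by blast
        then show ?thesis using dw(1) by simp
      next
        case b': (Degen m' l')
        have dw': "wmap w' l' = wmap w' (Suc l')" "l' < i \<Longrightarrow> wmap w' i < wmap w' (Suc i)" for i
          using degen_word[of m' l' w1] Cons.prems(2) w' b' by blast+
        have ll: "l = l'"
          using dw(1) dw(2)[of l'] dw'(1) dw'(2)[of l] by (cases l l' rule: linorder_cases) simp_all
        \<comment> \<open>A codegeneracy is surjective: the value at \<open>i\<close> is seen at
          \<open>i\<close> itself if \<open>i \<le> l\<close>, and at \<open>Suc i\<close>
          otherwise.\<close>
        have "wmap w i = wmap w1 i" for i
          using fun_cong[OF Cons.prems(5), of i] fun_cong[OF Cons.prems(5), of "Suc i"] b b' w' ll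
          by (cases "i \<le> l") auto
        then have "w = w1" using Cons.prems(2,4) w' by (intro IH) auto
        moreover have "m = m'"
          using \<open>w = w1\<close> Cons.prems b b' w' by (auto simp: composable_Cons simp del: composable.simps)
        ultimately show ?thesis using b b' w' ll by simp
      qed
    qed
  qed
qed

text \<open>Describes the values of \<open>tmap\<close> on simplicial maps intrinsically, so that a
  letter can be split off without rebuilding an extensional map at each step.\<close>

definition tsimplicial :: "nat \<Rightarrow> nat \<Rightarrow> (nat \<Rightarrow> nat) \<Rightarrow> bool" where
  "tsimplicial m n \<phi> \<longleftrightarrow> mono \<phi> \<and> \<phi> m \<le> n \<and> (\<forall>j>m. \<phi> j = n + (j - m))"

text \<open>Induction on the number \<open>n - m\<close> of missed values. The leading face has to
  be the least \<open>j\<close> from which \<open>\<phi>\<close> is the full shift, as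
  \<open>faces_word\<close> dictates.\<close>

lemma faces_exist:
  assumes "tsimplicial m n \<phi>" "\<And>i. \<phi> i < \<phi> (Suc i)"
  shows "\<exists>w. sorted_wrt normal_order w \<and> (\<forall>b\<in>set w. \<exists>n i. b = Face n i) \<and> composable n w \<and> wtgt n w = m
      \<and> wmap w = \<phi>"
  using assms
proof (induction "n - m" arbitrary: m \<phi>)
  case 0
  have mono: "\<phi> i < \<phi> i'" if "i < i'" for i i'
    using 0(3) that by (rule lift_Suc_mono_less)
  have ge: "i \<le> \<phi> i" for i
  proof (induction i)
    case (Suc i)
    then show ?case using 0(3)[of i] by linarith
  qed simp
  have mn: "m = n" using 0(1,2) ge[of m] by (simp add: tsimplicial_def)
  have "\<phi> i = i" for i
  proof (cases "i < m")
    case True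
    have "\<phi> i + (m - i) \<le> \<phi> m"
      using True
    proof (induction "m - i" arbitrary: i)
      case (Suc k)
      then have "\<phi> (Suc i) + (m - Suc i) \<le> \<phi> m" by (cases "Suc i = m") auto
      then show ?case using 0(3)[of i] Suc by linarith
    qed simp
    moreover have "\<phi> m \<le> m" using 0(2) mn by (simp add: tsimplicial_def)
    ultimately show ?thesis using ge[of i] True by linarith
  next
    case False
    then show ?thesis using 0(2) ge[of i] mn by (cases "i = m") (auto simp: tsimplicial_def)
  qed
  then show ?case using mn by (intro exI[of _ "[]"]) auto
next
  case (Suc d)
  have mono: "\<phi> i < \<phi> i'" if "i < i'" for i i'
    using Suc(4) that by (rule lift_Suc_mono_less)
  have d: "n = m + Suc d" using Suc(2) by simp
  define Q where "Q j \<longleftrightarrow> (\<forall>i\<ge>j. \<phi> i = i + Suc d)" for j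
  have Qm: "Q (Suc m)" using Suc(3) d by (auto simp: Q_def tsimplicial_def)
  define j where "j = (LEAST j. Q j)"
  have Qj: "Q j" and jm: "j \<le> Suc m" unfolding j_def using Qm by (auto intro: LeastI Least_le)
  have least: "\<phi> (j - 1) < j + d" if "0 < j"
  proof -
    have "\<not> Q (j - 1)" using that not_less_Least[of "j - 1" Q] by (simp add: j_def)
    then have "\<phi> (j - 1) \<noteq> (j - 1) + Suc d"
      using Qj that unfolding Q_def
      by (metis Suc_diff_1 Suc_leI le_neq_implies_less)
    moreover have "\<phi> (j - 1) < \<phi> j" using that by (intro mono) auto
    ultimately show ?thesis using Qj that unfolding Q_def by force
  qed
  \<comment> \<open>The domain grows by the point \<open>j\<close>, which receives the value
    \<open>j + d\<close>. This value is free: \<open>\<phi> j = j + Suc d\<close>, and by minimality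
    of \<open>j\<close> the preceding value is below \<open>j + d\<close>.\<close>
  define \<psi> where "\<psi> i = (if i < j then \<phi> i else i + d)" for i
  have comp: "\<psi> \<circ> bmap (Face k j) = \<phi>" for k
    using Qj by (auto simp: \<psi>_def Q_def fun_eq_iff)
  have inc: "\<psi> i < \<psi> (Suc i)" for i
  proof (cases "Suc i = j")
    case True
    then show ?thesis using least by (auto simp: \<psi>_def)
  qed (use mono in \<open>auto simp: \<psi>_def\<close>)
  have "tsimplicial (Suc m) n \<psi>"
    using inc jm d by (auto simp: tsimplicial_def \<psi>_def intro!: mono_iff_le_Suc[THEN iffD2] less_imp_le)
  then obtain w where w: "sorted_wrt normal_order w" "\<forall>b\<in>set w. \<exists>n i. b = Face n i" "composable n w"
      "wtgt n w = Suc m" "wmap w = \<psi>"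
    using Suc(1)[of "Suc m" \<psi>] d inc by auto
  have "normal_order (Face (Suc m) j) b" if "b \<in> set w" for b
  proof (cases w)
    case Nil
    then show ?thesis using that by simp
  next
    case (Cons c v)
    then obtain p i where c: "c = Face p i" using w by auto
    have fw: "(\<forall>x\<ge>i. wmap w x = x + length w)" "(\<forall>x<i. wmap w x < x + length w)"
      using faces_word[of w] w Cons c by auto
    have "wmap w (max i j) = max i j + d" by (simp add: w(5) \<psi>_def)
    then have len: "length w = d" using fw(1) by auto
    have "i \<le> j"
    proof (rule ccontr)
      assume "\<not> i \<le> j"
      then have "wmap w j < j + d" using fw(2) len by simp
      then show False by (simp add: w(5) \<psi>_def)
    qed
    moreover have "\<exists>q x. b = Face q x \<and> x \<le> i" using w that Cons c by fastforce
    ultimately show ?thesis by auto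
  qed
  then show ?case
    using w comp jm
    by (intro exI[of _ "Face (Suc m) j # w"]) (auto simp: composable_Cons simp del: composable.simps bmap.simps)
qed

text \<open>Degeneracies are split off by induction on \<open>m\<close>, at the last repeated value;
  when no value repeats, only faces remain and \<open>faces_exist\<close> takes over.\<close>

lemma normal_exists:
  assumes "tsimplicial m n \<phi>"
  shows "\<exists>w. sorted_wrt normal_order w \<and> composable n w \<and> wtgt n w = m \<and> wmap w = \<phi>"
  using assms
proof (induction m arbitrary: \<phi>)
  case 0
  have "\<phi> i < \<phi> (Suc i)" for i using 0 by (cases i) (auto simp: tsimplicial_def)
  then show ?case using faces_exist[OF 0] by blast
next
  case (Suc m)
  show ?case
  proof (cases "\<exists>i. \<phi> i = \<phi> (Suc i)")
    case False
    then have "\<phi> i < \<phi> (Suc i)" for i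
      using Suc.prems by (metis le_neq_implies_less le_SucI order_refl monoD tsimplicial_def)
    then show ?thesis using faces_exist[OF Suc.prems] by blast
  next
    case True
    have bound: "i \<le> m" if "\<phi> i = \<phi> (Suc i)" for i
      using that Suc.prems by (cases "i = Suc m") (auto simp: tsimplicial_def not_le[symmetric] intro: ccontr)
    \<comment> \<open>The greatest repetition is taken because degeneracy indices in a normal word
      decrease: a repetition of \<open>\<psi>\<close> at some \<open>i \<ge> l\<close> would give
      one of \<open>\<phi>\<close> at \<open>Suc i\<close>, beyond \<open>l\<close>.\<close>
    define l where "l = (GREATEST i. \<phi> i = \<phi> (Suc i))"
    have l: "\<phi> l = \<phi> (Suc l)"
      using GreatestI_ex_nat[of "\<lambda>i. \<phi> i = \<phi> (Suc i)" m] True bound unfolding l_def by blast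
    have max: "i \<le> l" if "\<phi> i = \<phi> (Suc i)" for i
      using Greatest_le_nat[of "\<lambda>i. \<phi> i = \<phi> (Suc i)" i m] that bound unfolding l_def by blast
    define \<psi> where "\<psi> i = (if i \<le> l then \<phi> i else \<phi> (Suc i))" for i
    have comp: "\<psi> \<circ> bmap (Degen k l) = \<phi>" for k
    proof
      fix i
      show "(\<psi> \<circ> bmap (Degen k l)) i = \<phi> i"
        using l by (cases "i = Suc l") (auto simp: \<psi>_def)
    qed
    have "tsimplicial m n \<psi>"
      using Suc.prems bound[OF l] unfolding tsimplicial_def
      by (auto simp: \<psi>_def mono_def intro: le_trans[of _ "\<phi> (Suc m)"])
    then obtain w where w: "sorted_wrt normal_order w" "composable n w" "wtgt n w = m" "wmap w = \<psi>"
      using Suc.IH by blast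
    have "normal_order (Degen (Suc m) l) b" if "b \<in> set w" for b
    proof (cases w)
      case (Cons c v)
      show ?thesis
      proof (cases c)
        case (Face p i)
        then show ?thesis using faces_wordI[of p i v b] w that Cons by auto
      next
        case (Degen p i)
        then have "\<psi> i = \<psi> (Suc i)" using degen_word(1)[of p i v] w(1) Cons
            unfolding w(4)[symmetric] by blast
        have "i < l"
        proof (rule ccontr)
          assume "\<not> i < l"
          then have "\<phi> (Suc i) = \<phi> (Suc (Suc i))"
            using \<open>\<psi> i = \<psi> (Suc i)\<close> l by (cases "i = l") (auto simp: \<psi>_def)
          then show False using max[of "Suc i"] \<open>\<not> i < l\<close> by simp
        qed
        then show ?thesis using w that Cons Degen by (cases b) auto
      qed
    qed (use that in simp)
    then show ?thesis
      using w comp bound[OF l]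
      by (intro exI[of _ "Degen (Suc m) l # w"]) (auto simp: composable_Cons simp del: composable.simps bmap.simps)
  qed
qed

text \<open>Existence and uniqueness together resolve the definite description in \<open>nf\<close>;
  injectivity of \<open>tmap\<close> turns equal extended maps into equal simplicial maps.\<close>

lemma nf_simps:
  assumes "f \<in> arrs Delta"
  shows "composable (tgt Delta f) (nf f)" "wtgt (tgt Delta f) (nf f) = src Delta f" "wmap (nf f) = tmap f"
    "word_arr (tgt Delta f) (nf f) = f" "sorted_wrt normal_order (nf f)"
proof -
  let ?n = "tgt Delta f"
  have "tsimplicial (src Delta f) ?n (tmap f)"
    using assms tmap_mono[OF assms] by (cases f) (auto simp: tsimplicial_def tmap_def PiE_iff Pi_iff)
  then obtain w where w: "sorted_wrt normal_order w" "composable ?n w" "wtgt ?n w = src Delta f" "wmap w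
      = tmap f"
    using normal_exists by blast
  have "word_arr ?n w = f"
    using word_arr_simps[OF w(2)] w assms by (intro tmap_inj) auto
  moreover have "v = w" if "sorted_wrt normal_order v" "composable ?n v" "word_arr ?n v = f" for v
    using normal_word_unique[of v w ?n] word_arr_simps[OF that(2)] w that by simp
  ultimately have "nf f = w"
    unfolding nf_def normal_word_iff op_cat_sel using w(1,2) by (intro the_equality) blast+
  then show "composable ?n (nf f)" "wtgt ?n (nf f) = src Delta f" "wmap (nf f) = tmap f"
      "word_arr ?n (nf f) = f"
    "sorted_wrt normal_order (nf f)"
    using w \<open>word_arr ?n w = f\<close> by auto
qed

lemma nf_idn [simp]: "nf (n, n, \<lambda>i\<in>{..n}. i) = []"
proof -
  have "(n, n, \<lambda>i\<in>{..n}. i) \<in> arrs Delta" by (auto simp: mono_on_def)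
  note nf = nf_simps[OF this]
  show ?thesis
    by (rule normal_word_unique[of _ "[]" n]) (use nf in auto)
qed

section \<open>Lists as arrays\<close>

text \<open>\<open>lex_pos a n s r\<close> is the position of the multi-index \<open>r a, \<dots>, r (n - 1)\<close> in the lexicographic
  order on the box with sides \<open>s a, \<dots>, s (n - 1)\<close>.\<close>

fun lex_pos :: "nat \<Rightarrow> nat \<Rightarrow> (nat \<Rightarrow> nat) \<Rightarrow> (nat \<Rightarrow> nat) \<Rightarrow> nat" where
  "lex_pos a 0 s r = 0"
| "lex_pos a (Suc n) s r = (if n < a then 0 else lex_pos a n s r * s n + r n)"

definition in_box :: "nat \<Rightarrow> (nat \<Rightarrow> nat) \<Rightarrow> (nat \<Rightarrow> nat) \<Rightarrow> bool" where
  "in_box n s r \<longleftrightarrow> (\<forall>l<n. r l < s l)"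

text \<open>Only entries inside the box are constrained, so different arrays may represent one list.
  An array and its box sizes determine the list, however, and by \<open>rep_eqI\<close> identities
  of arrays descend to lists.\<close>

definition rep :: "nat \<Rightarrow> (nat \<Rightarrow> nat) \<Rightarrow> 'x list \<Rightarrow> ((nat \<Rightarrow> nat) \<Rightarrow> 'x) \<Rightarrow> bool" where
  "rep n s L X \<longleftrightarrow> length L = (\<Prod>l<n. s l) \<and> (\<forall>r. in_box n s r \<longrightarrow> L ! lex_pos 0 n s r = X r)"

lemma lex_pos_self [simp]: "lex_pos a a s r = 0"
  by (cases a) auto

lemma digit_less: "x < (u::nat) \<Longrightarrow> i < n \<Longrightarrow> x * n + i < u * n"
proof -
  assume "x < u" "i < n"
  then have "x * n + i < Suc x * n" by simp
  also have "\<dots> \<le> u * n" using \<open>x < u\<close> by (intro mult_right_mono) auto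
  finally show ?thesis .
qed

lemma lex_pos_less: "(\<And>l. a \<le> l \<Longrightarrow> l < n \<Longrightarrow> r l < s l) \<Longrightarrow> lex_pos a n s r < (\<Prod>l\<in>{a..<n}. s l)"
proof (induction n)
  case (Suc n)
  show ?case
  proof (cases "n < a")
    case False
    then have "lex_pos a n s r * s n + r n < (\<Prod>l\<in>{a..<n}. s l) * s n"
      using Suc by (intro digit_less) auto
    then show ?thesis using False by (simp add: atLeastLessThanSuc mult.commute)
  qed simp
qed simp

text \<open>Positions are numerals in mixed radix: the digits before \<open>m\<close> are weighted
  by the product of the later sizes.\<close>

lemma lex_pos_split: "a \<le> m \<Longrightarrow> m \<le> n \<Longrightarrow> lex_pos a n s r
    = lex_pos a m s r * (\<Prod>l\<in>{m..<n}. s l) + lex_pos m n s r"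
proof (induction n)
  case (Suc n)
  show ?case
  proof (cases "m = Suc n")
    case False
    then have "m \<le> n" using Suc.prems by simp
    then have "\<not> n < m" "\<not> n < a" "{m..<Suc n} = insert n {m..<n}" using Suc.prems by auto
    then show ?thesis using Suc.IH[OF Suc.prems(1) \<open>m \<le> n\<close>] by (simp add: algebra_simps)
  qed simp
qed simp

lemma lex_pos_split_color:
  assumes "k < n"
  shows "lex_pos 0 n s r = (lex_pos 0 k s r * s k + r k) * (\<Prod>l\<in>{k<..<n}. s l) + lex_pos (Suc k) n s r"
  using lex_pos_split[of 0 "Suc k" n s r] assms by (simp add: atLeastSucLessThan_greaterThanLessThan)

lemma lex_pos_cong:
  "(\<And>l. a \<le> l \<Longrightarrow> l < n \<Longrightarrow> r l = r' l) \<Longrightarrow> (\<And>l. a \<le> l \<Longrightarrow> l < n \<Longrightarrow> s l = s' l) \<Longrightarrow>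
    lex_pos a n s r = lex_pos a n s' r'"
  by (induction n) auto

lemma lex_pos_upd [simp]:
  "n \<le> k \<or> k < a \<Longrightarrow> lex_pos a n (s(k := t)) r = lex_pos a n s r"
  "n \<le> k \<or> k < a \<Longrightarrow> lex_pos a n s (r(k := i)) = lex_pos a n s r"
  by (rule lex_pos_cong; auto)+

text \<open>Division with remainder extracts the last digit, so every position of a list is met by
  an index in the box.\<close>

lemma lex_pos_surj: "i < (\<Prod>l<n. s l) \<Longrightarrow> \<exists>r. in_box n s r \<and> lex_pos 0 n s r = i"
proof (induction n arbitrary: i)
  case (Suc n)
  then have pos: "0 < s n" by (auto intro: Nat.gr0I)
  have "i div s n < (\<Prod>l<n. s l)"
    using Suc.prems by (simp add: less_mult_imp_div_less mult.commute)
  then obtain r where r: "in_box n s r" "lex_pos 0 n s r = i div s n" using Suc.IH by blast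
  then have "in_box (Suc n) s (r(n := i mod s n))" "lex_pos 0 (Suc n) s (r(n := i mod s n)) = i"
    using pos by (auto simp: in_box_def less_Suc_eq lex_pos_upd(2)[OF disjI1] simp del: fun_upd_apply
        simp: fun_upd_same fun_upd_other)
  then show ?case by blast
qed (simp add: in_box_def)

lemma lex_pos_bound: "in_box n s r \<Longrightarrow> lex_pos 0 n s r < (\<Prod>l<n. s l)"
  using lex_pos_less[of 0 n r s] by (simp add: in_box_def atLeast0LessThan)

lemma rep_cong: "rep n s L X \<Longrightarrow> (\<And>l. l < n \<Longrightarrow> s l = s' l) \<Longrightarrow> rep n s' L X"
proof -
  assume *: "rep n s L X" and s: "\<And>l. l < n \<Longrightarrow> s l = s' l"
  have "lex_pos 0 n s r = lex_pos 0 n s' r" for r using s by (intro lex_pos_cong) auto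
  moreover have "in_box n s r = in_box n s' r" for r using s by (auto simp: in_box_def)
  moreover have "(\<Prod>l<n. s l) = (\<Prod>l<n. s' l)" using s by (intro prod.cong) auto
  ultimately show ?thesis using * by (simp add: rep_def)
qed

lemma rep_eqI: "rep n s L X \<Longrightarrow> rep n s L' X \<Longrightarrow> L = L'"
proof (rule nth_equalityI)
  assume *: "rep n s L X" "rep n s L' X"
  then show "length L = length L'" by (simp add: rep_def)
  fix i assume "i < length L"
  then obtain r where "in_box n s r" "lex_pos 0 n s r = i" using lex_pos_surj[of i s n] *
      by (auto simp: rep_def)
  then show "L ! i = L' ! i" using * by (auto simp: rep_def)
qed

lemma rep_set: "rep n s L X \<Longrightarrow> (\<And>r. in_box n s r \<Longrightarrow> X r \<in> S) \<Longrightarrow> set L \<subseteq> S"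
proof
  fix x assume *: "rep n s L X" "\<And>r. in_box n s r \<Longrightarrow> X r \<in> S" "x \<in> set L"
  then obtain i where "i < length L" "x = L ! i" by (auto simp: in_set_conv_nth)
  then show "x \<in> S" using lex_pos_surj[of i s n] * by (auto simp: rep_def)
qed

lemma rep_map: "rep n s L X \<Longrightarrow> rep n s (map f L) (\<lambda>r. f (X r))"
  by (auto simp: rep_def lex_pos_bound)

lemma rep_map2: "rep n s L X \<Longrightarrow> rep n s L' X' \<Longrightarrow> rep n s (map2 f L L') (\<lambda>r. f (X r) (X' r))"
  by (auto simp: rep_def lex_pos_bound)

section \<open>Lists cut into blocks\<close>

lemma nth_concat_uniform:
  "(\<And>i. i < length xss \<Longrightarrow> length (xss ! i) = p) \<Longrightarrow> i < length xss \<Longrightarrow> z < p \<Longrightarrow>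
    concat xss ! (i * p + z) = xss ! i ! z"
proof (induction xss arbitrary: i)
  case (Cons xs xss)
  have len: "length xs = p" using Cons.prems(1)[of 0] by simp
  show ?case
  proof (cases i)
    case (Suc i')
    have "concat xss ! (i' * p + z) = xss ! i' ! z"
      using Cons.prems(1)[of "Suc _"] Cons.prems(2,3) Suc by (intro Cons.IH) auto
    then show ?thesis using Suc len by (simp add: nth_append algebra_simps)
  qed (use len Cons.prems in \<open>simp add: nth_append\<close>)
qed simp

lemma length_concat_uniform:
  "(\<And>i. i < length xss \<Longrightarrow> length (xss ! i) = p) \<Longrightarrow> length (concat xss) = length xss * p"
proof (induction xss)
  case (Cons xs xss)
  then show ?case using Cons.prems(1)[of 0] Cons.prems(1)[of "Suc _"] by auto
qed simp

lemma length_blocks [simp]: "length (blocks n p L) = n"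
  by (simp add: blocks_def)

lemma nth_blocks:
  assumes "length L = n * p" "i < n"
  shows "length (blocks n p L ! i) = p" "z < p \<Longrightarrow> blocks n p L ! i ! z = L ! (i * p + z)"
proof -
  have "i * p + p \<le> n * p" using mult_le_mono1[of "Suc i" n p] assms(2) by simp
  then show "length (blocks n p L ! i) = p" "z < p \<Longrightarrow> blocks n p L ! i ! z = L ! (i * p + z)"
    using assms by (auto simp: blocks_def)
qed

fun basic_list :: "('x \<Rightarrow> 'x \<Rightarrow> 'x) \<Rightarrow> 'x \<Rightarrow> basic \<Rightarrow> 'x list \<Rightarrow> 'x list" where
  "basic_list p e (Face n i) = face_list p n i"
| "basic_list p e (Degen n j) = degen_list e j"

definition word_list :: "('x \<Rightarrow> 'x \<Rightarrow> 'x) \<Rightarrow> 'x \<Rightarrow> basic list \<Rightarrow> 'x list \<Rightarrow> 'x list" where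
  "word_list p e w = foldr (\<lambda>b F. basic_list p e b \<circ> F) w (\<lambda>x. x)"

lemma word_list_simps [simp]: "word_list p e [] L = L" "word_list p e (b # w) L
    = basic_list p e b (word_list p e w L)"
  by (simp_all add: word_list_def)

definition rep_blocks :: "nat \<Rightarrow> nat \<Rightarrow> 'x list list \<Rightarrow> (nat \<Rightarrow> nat \<Rightarrow> 'x) \<Rightarrow> bool" where
  "rep_blocks n p B Y \<longleftrightarrow> length B = n \<and> (\<forall>i<n. length (B ! i) = p \<and> (\<forall>z<p. B ! i ! z = Y i z))"

lemma rep_blocks_basic_list:
  assumes "monoid_on op e S" "basic_valid b" "rep_blocks (bsrc b) p B Y" "\<And>i z. Y i z \<in> S"
  shows "rep_blocks (btgt b) p (basic_list (map2 op) (replicate p e) b B)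
    (\<lambda>i z. fprod op e (\<lambda>j. Y j z) [bmap b i..<bmap b (Suc i)])"
proof (cases b)
  case (Degen n j)
  have [simp]: "op (Y i z) e = Y i z" for i z using monoid_onD(3)[OF assms(1)] assms(4) by blast
  have n: "1 \<le> n" "j \<le> n - 1" and B: "length B = n - 1" using assms Degen by (auto simp: rep_blocks_def)
  let ?R = "take j B @ [replicate p e] @ drop j B"
  have "?R ! i = (if i < j then B ! i else if i = j then replicate p e else B ! (i - 1))" if "i < n" for i
    using n B that by (auto simp: nth_append nth_Cons' min_def)
  moreover have "[bmap (Degen n j) i..<bmap (Degen n j) (Suc i)]
     = (if i < j then [i] else if i = j then [] else [i - 1])" for i
    by (auto simp: upt_rec)
  ultimately show ?thesis
    using assms n B unfolding rep_blocks_def Degen basic_list.simps degen_list_def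
    by (auto simp del: bmap.simps split: if_splits)
next
  case (Face n j)
  have [simp]: "op (Y i z) e = Y i z" for i z using monoid_onD(3)[OF assms(1)] assms(4) by blast
  have n: "1 \<le> n" "j \<le> n" and B: "length B = n" using assms Face by (auto simp: rep_blocks_def)
  let ?R = "face_list (map2 op) n j B"
  have len: "length ?R = n - 1" using n B by (auto simp: face_list_def)
  have R: "?R ! i = (if j = 0 then B ! Suc i else if j = n \<or> i < j - 1 then B ! i
      else if i = j - 1 then map2 op (B ! (j - 1)) (B ! j) else B ! Suc i)" if "i < n - 1" for i
    using n B that by (auto simp: face_list_def nth_tl nth_butlast nth_append nth_Cons' min_def)
  \<comment> \<open>For \<open>j = n\<close> the interval of length two sits at
    \<open>i = n - 1\<close>, just outside the range \<open>i < n - 1\<close>, so the last block is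
    dropped and not multiplied.\<close>
  have I: "[bmap (Face n j) i..<bmap (Face n j) (Suc i)]
     = (if j = 0 then [Suc i] else if i < j - 1 then [i] else if i
         = j - 1 then [j - 1, j] else [Suc i])" for i
    by (auto simp: upt_rec)
  have "length (?R ! i) = p \<and> (\<forall>z<p. ?R ! i ! z
      = fprod op e (\<lambda>j. Y j z) [bmap (Face n j) i..<bmap (Face n j) (Suc i)])"
    if "i < n - 1" for i
    using assms(3) n that unfolding R[OF that] I rep_blocks_def Face by auto
  then show ?thesis
    using len unfolding rep_blocks_def Face basic_list.simps by simp
qed

text \<open>The nested products that arise letter by letter are flattened by
  \<open>concat_upt_comp\<close> and \<open>fprod_concat\<close>, so only the composite map of the
  word remains.\<close>

lemma rep_blocks_word_list:
  assumes "monoid_on op e S" "composable n w" "rep_blocks n p B Y" "\<And>i z. Y i z \<in> S"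
  shows "rep_blocks (wtgt n w) p (word_list (map2 op) (replicate p e) w B)
    (\<lambda>i z. fprod op e (\<lambda>j. Y j z) [wmap w i..<wmap w (Suc i)])"
  using assms(2)
proof (induction w)
  case Nil
  have "fprod op e (\<lambda>j. Y j z) [id i..<id (Suc i)] = Y i z" for i z
    using monoid_onD(3)[OF assms(1)] assms(4) by simp
  then have "rep_blocks (wtgt n []) p (word_list (map2 op) (replicate p e) [] B)
    (\<lambda>i z. fprod op e (\<lambda>j. Y j z) [wmap [] i..<wmap [] (Suc i)])"
    using assms(3) unfolding wmap.simps wtgt.simps word_list_simps by (simp only: eta_contract_eq)
  then show ?case .
next
  case (Cons b w)
  let ?Y = "\<lambda>i z. fprod op e (\<lambda>j. Y j z) [wmap w i..<wmap w (Suc i)]"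
  have c: "basic_valid b" "composable n w" "bsrc b = wtgt n w"
    using Cons.prems unfolding composable_Cons by auto
  have Y: "?Y i z \<in> S" for i z by (rule fprod_closed[OF assms(1)]) (rule assms(4))
  have mw: "mono (wmap w)" using word_arr_simps[OF c(2)] tmap_mono by metis
  have eq: "fprod op e (\<lambda>j. ?Y j z) [bmap b i..<bmap b (Suc i)]
    = fprod op e (\<lambda>j. Y j z) [(wmap w \<circ> bmap b) i..<(wmap w \<circ> bmap b) (Suc i)]" for i z
    unfolding concat_upt_comp[OF mw bmap_mono]
    by (subst fprod_concat[OF assms(1)]) (auto simp: fprod_map assms(4))
  have "rep_blocks (btgt b) p (basic_list (map2 op) (replicate p e) b (word_list (map2 op) (replicate p e) w B))
    (\<lambda>i z. fprod op e (\<lambda>j. ?Y j z) [bmap b i..<bmap b (Suc i)])"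
    by (rule rep_blocks_basic_list[OF assms(1) c(1)]) (use Cons.IH[OF c(2)] c(3) Y in auto)
  then show ?case unfolding eq wmap.simps wtgt.simps word_list_simps by simp
qed

text \<open>Combines \<open>flatten_funct\<close> and \<open>funct_power\<close>: \<open>u\<close>
  outer copies, each with \<open>n\<close> blocks of length \<open>p\<close>.\<close>

definition power_list :: "nat \<Rightarrow> nat \<Rightarrow> nat \<Rightarrow> ('x list list \<Rightarrow> 'x list list) \<Rightarrow> 'x list \<Rightarrow> 'x list" where
  "power_list u n p G L = concat (map (\<lambda>L. concat (G (blocks n p L))) (blocks u (n * p) L))"

lemma power_list_word_list:
  assumes "monoid_on op e S" "composable n w" "length L = u * (n * p)" "set L \<subseteq> S"
  shows "length (power_list u n p (word_list (map2 op) (replicate p e) w) L) = u * (wtgt n w * p)"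
    "x < u \<Longrightarrow> i < wtgt n w \<Longrightarrow> z < p \<Longrightarrow>
      power_list u n p (word_list (map2 op) (replicate p e) w) L ! ((x * wtgt n w + i) * p + z)
      = fprod op e (\<lambda>j. L ! ((x * n + j) * p + z)) [wmap w i..<wmap w (Suc i)]"
proof -
  let ?m = "wtgt n w" and ?G = "word_list (map2 op) (replicate p e) w"
  let ?b = "\<lambda>x. blocks n p (blocks u (n * p) L ! x)"
  have wa: "word_arr n w \<in> arrs Delta" "src Delta (word_arr n w) = ?m" "tgt Delta (word_arr n w) = n"
    "tmap (word_arr n w) = wmap w" using word_arr_simps[OF assms(2)] by auto
  \<comment> \<open>The family of entries must lie in \<open>S\<close> for all indices, so it is
    filled with the unit \<open>e\<close> outside the list. The bound
    \<open>wmap w (Suc i) \<le> n\<close> later shows that no filled entry is used.\<close>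
  have B: "rep_blocks ?m p (?G (?b x)) (\<lambda>i z. fprod op e (\<lambda>j. if x < u \<and> j < n
      \<and> z < p then L ! ((x * n + j) * p + z) else e) [wmap w i..<wmap w (Suc i)])"
    if "x < u" for x
  proof (rule rep_blocks_word_list[OF assms(1,2)])
    have "?b x ! j ! z = L ! ((x * n + j) * p + z)" if "j < n" "z < p" for j z
    proof -
      have "?b x ! j ! z = L ! (x * (n * p) + (j * p + z))"
        using nth_blocks[OF assms(3) \<open>x < u\<close>] that by (simp add: nth_blocks digit_less)
      then show ?thesis by (simp add: algebra_simps)
    qed
    then show "rep_blocks n p (?b x) (\<lambda>j z. if x < u \<and> j < n \<and> z < p then L ! ((x * n + j) * p + z) else e)"
      using that nth_blocks(1)[OF assms(3) that] by (simp add: rep_blocks_def nth_blocks(1))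
    show "(if x < u \<and> j < n \<and> z < p then L ! ((x * n + j) * p + z) else e) \<in> S" for j z
      using assms(3,4) monoid_onD(1)[OF assms(1)] digit_less[of "x * n + j"
          "u * n" z p] digit_less[of x u j n]
      by (auto simp: mult.assoc)
  qed
  have len: "length (concat (?G (?b x))) = ?m * p" if "x < u" for x
    using B[OF that] length_concat_uniform[of "?G (?b x)" p] by (simp add: rep_blocks_def)
  then have *: "length (map (\<lambda>L. concat (?G (blocks n p L))) (blocks u (n * p) L) ! x) = ?m * p" if
      "x < u" for x
    using that by simp
  then show "length (power_list u n p ?G L) = u * (?m * p)"
    unfolding power_list_def by (subst length_concat_uniform) auto
  assume xiz: "x < u" "i < ?m" "z < p"
  have "wmap w (Suc i) \<le> n" using tmap_le[OF wa(1), of "Suc i"] wa xiz by simp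
  then have "fprod op e (\<lambda>j. if x < u \<and> j < n
      \<and> z < p then L ! ((x * n + j) * p + z) else e) [wmap w i..<wmap w (Suc i)]
      = fprod op e (\<lambda>j. L ! ((x * n + j) * p + z)) [wmap w i..<wmap w (Suc i)]"
    using xiz by (intro fprod_cong) auto
  moreover have "power_list u n p ?G L ! (x * (?m * p) + (i * p + z)) = concat (?G (?b x)) ! (i * p + z)"
    unfolding power_list_def using xiz * by (subst nth_concat_uniform) (auto simp: digit_less)
  moreover have "concat (?G (?b x)) ! (i * p + z) = ?G (?b x) ! i ! z"
    using B[OF xiz(1)] xiz by (intro nth_concat_uniform) (auto simp: rep_blocks_def)
  ultimately show "power_list u n p ?G L ! ((x * ?m + i) * p + z)
      = fprod op e (\<lambda>j. L ! ((x * n + j) * p + z)) [wmap w i..<wmap w (Suc i)]"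
    using B[OF xiz(1)] xiz by (simp add: rep_blocks_def algebra_simps)
qed

text \<open>Separating the digits below colour \<open>k\<close>, at \<open>k\<close> and above
  \<open>k\<close> is the same as cutting into outer copies, blocks and entries of a block; this is
  why the outer and inner powers are products of the sizes of the lower and higher colours.\<close>

lemma rep_power_list:
  assumes "monoid_on op e S" "composable (s k) w" "k < N" "rep N s L X" "\<And>r. X r \<in> S"
    "u = (\<Prod>l<k. s l)" "p = (\<Prod>l\<in>{k<..<N}. s l)"
  shows "rep N (s(k := wtgt (s k) w)) (power_list u (s k) p (word_list (map2 op) (replicate p e) w) L)
    (\<lambda>r. fprod op e (\<lambda>i. X (r(k := i))) [wmap w (r k)..<wmap w (Suc (r k))])"
proof -
  let ?n = "s k" and ?m = "wtgt (s k) w" and ?s = "s(k := wtgt (s k) w)"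
  have split: "{..<N} = {..<k} \<union> {k} \<union> {k<..<N}" using assms(3) by auto
  have prod: "(\<Prod>l<N. t l) = (\<Prod>l<k. t l) * (t k * (\<Prod>l\<in>{k<..<N}. t l))" for t :: "nat \<Rightarrow> nat"
    unfolding split by (subst prod.union_disjoint; (auto simp: mult.assoc)?)+
  have L: "length L = u * (?n * p)" "set L \<subseteq> S"
    using assms prod[of s] rep_set[OF assms(4)] by (auto simp: rep_def)
  note R = power_list_word_list[OF assms(1,2) L]
  have wa: "word_arr ?n w \<in> arrs Delta" "src Delta (word_arr ?n w) = ?m" "tgt Delta (word_arr ?n w) = ?n"
    "tmap (word_arr ?n w) = wmap w" using word_arr_simps[OF assms(2)] by auto
  have ps: "(\<Prod>l<k. ?s l) = u" "(\<Prod>l\<in>{k<..<N}. ?s l) = p" using assms by auto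
  show ?thesis
    unfolding rep_def
  proof (intro conjI allI impI)
    show "length (power_list u ?n p (word_list (map2 op) (replicate p e) w) L) = (\<Prod>l<N. ?s l)"
      unfolding prod ps R(1) by simp
    fix r assume r: "in_box N ?s r"
    let ?x = "lex_pos 0 k s r" and ?z = "lex_pos (Suc k) N s r"
    have in_s: "r l < s l" if "l < N" "l \<noteq> k" for l
      using r that unfolding in_box_def by (metis fun_upd_other)
    have "in_box k s r" using in_s assms(3) by (simp add: in_box_def)
    then have x: "?x < u" using lex_pos_bound assms(6) by blast
    have z: "?z < p"
      using lex_pos_less[of "Suc k" N r s] in_s assms(7)
      by (simp add: atLeastSucLessThan_greaterThanLessThan)
    have i: "r k < ?m" using r assms(3) by (auto simp: in_box_def)
    have pos: "lex_pos 0 N ?s r = (?x * ?m + r k) * p + ?z"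
      using lex_pos_split_color[OF assms(3), of ?s r] ps by simp
    have "L ! ((?x * ?n + j) * p + ?z) = X (r(k := j))" if "j < ?n" for j
    proof -
      have "in_box N s (r(k := j))" using r that by (auto simp: in_box_def)
      moreover have "lex_pos 0 N s (r(k := j)) = (?x * ?n + j) * p + ?z"
        using lex_pos_split_color[OF assms(3), of s "r(k := j)"] assms(7) by simp
      ultimately show ?thesis using assms(4) by (auto simp: rep_def)
    qed
    moreover have "wmap w (Suc (r k)) \<le> ?n" using tmap_le[OF wa(1), of "Suc (r k)"] wa i by simp
    ultimately have "fprod op e (\<lambda>j. L ! ((?x * ?n + j) * p + ?z)) [wmap w (r k)..<wmap w (Suc (r k))]
      = fprod op e (\<lambda>i. X (r(k := i))) [wmap w (r k)..<wmap w (Suc (r k))]"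
      by (intro fprod_cong) auto
    then show "power_list u ?n p (word_list (map2 op) (replicate p e) w) L ! lex_pos 0 N ?s r
      = fprod op e (\<lambda>i. X (r(k := i))) [wmap w (r k)..<wmap w (Suc (r k))]"
      unfolding pos using R(2)[OF x i z] by simp
  qed
qed

section \<open>The bar construction as an operation on lists\<close>

lemma power_monoidal_sel [simp]:
  "mulO (power_monoidal p C) = map2 (mulO C)" "mulA (power_monoidal p C) = map2 (mulA C)"
  "unitO (power_monoidal p C) = replicate p (unitO C)" "idn (power_monoidal p C) = map (idn C)"
  by (simp_all add: power_monoidal_def power_cat_def category.defs monoidal.defs)

lemma bar_basic_basic_list:
  "fobj (bar_basic C b) = basic_list (mulO C) (unitO C) b"
  "farr (bar_basic C b) = basic_list (mulA C) (idn C (unitO C)) b"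
  by (cases b; simp)+

lemma bar_word_list:
  "fobj (bar C f) = word_list (mulO C) (unitO C) (nf f)"
  "farr (bar C f) = word_list (mulA C) (idn C (unitO C)) (nf f)"
proof -
  have "fobj (foldr (\<lambda>b F. bar_basic C b \<circ>\<^sub>F F) w fid) = word_list (mulO C) (unitO C) w
    \<and> farr (foldr (\<lambda>b F. bar_basic C b \<circ>\<^sub>F F) w fid) = word_list (mulA C) (idn C (unitO C)) w" for w
    by (induction w) (auto simp: fid_def fcomp_def word_list_def bar_basic_basic_list)
  then show "fobj (bar C f) = word_list (mulO C) (unitO C) (nf f)"
    "farr (bar C f) = word_list (mulA C) (idn C (unitO C)) (nf f)"
    by (auto simp: bar_def)
qed

lemma Wbar_power_list:
  "fobj (Wbar M k p u f) = power_list u (tgt Delta f) p (word_list (map2 (\<lambda>A B. tenO M A k B)) (replicate p (unt M k)) (nf f))"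
  "farr (Wbar M k p u f) = power_list u (tgt Delta f) p (word_list (map2 (\<lambda>A B. tenA M A k B)) (replicate p (idn M (unt M k))) (nf f))"
  by (auto simp: fun_eq_iff Wbar_def funct_power_def flatten_funct_def bar_word_list power_list_def comp_def monoidal_part_def)

lemma Wbar_basic_power_list:
  "fobj (Wbar_basic M k p u b) = power_list u (bsrc b) p (word_list (map2 (\<lambda>A B. tenO M A k B)) (replicate p (unt M k)) [b])"
  "farr (Wbar_basic M k p u b) = power_list u (bsrc b) p (word_list (map2 (\<lambda>A B. tenA M A k B)) (replicate p (idn M (unt M k))) [b])"
  by (auto simp: fun_eq_iff Wbar_basic_def funct_power_def flatten_funct_def bar_basic_basic_list power_list_def comp_def monoidal_part_def)

section \<open>Shuffles act as words\<close>

lemma concat_map_uniform: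
  assumes "\<And>i. i < u \<Longrightarrow> length (f (i + 1)) = p"
  shows "length (concat (map f [1..<u + 1])) = u * p"
    "x < u \<Longrightarrow> z < p \<Longrightarrow> concat (map f [1..<u + 1]) ! (x * p + z) = f (x + 1) ! z"
proof -
  have "length (concat (map f [1..<u + 1])) = length (map f [1..<u + 1]) * p"
    using assms by (intro length_concat_uniform) (simp add: nth_append del: upt_Suc)
  then show "length (concat (map f [1..<u + 1])) = u * p" by simp
  assume "x < u" "z < p"
  then have "concat (map f [1..<u + 1]) ! (x * p + z) = map f [1..<u + 1] ! x ! z"
    using assms by (intro nth_concat_uniform) (simp_all add: nth_append del: upt_Suc)
  then show "concat (map f [1..<u + 1]) ! (x * p + z) = f (x + 1) ! z"
    using \<open>x < u\<close> by (simp add: nth_append del: upt_Suc)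
qed

text \<open>The comprehension is a nest of concatenations with pieces of constant length, so each
  level consumes one digit of the mixed-radix position.\<close>

lemma lex_indices_simps:
  "length (lex_indices u n v m w) = u * (n * (v * (m * w)))"
  "x < u \<Longrightarrow> r < n \<Longrightarrow> y < v \<Longrightarrow> q < m \<Longrightarrow> z < w \<Longrightarrow>
    lex_indices u n v m w ! ((((x * n + r) * v + y) * m + q) * w + z) = (x + 1, r + 1, y + 1, q + 1, z + 1)"
proof -
  define f4 where "f4 x r y q = map (\<lambda>z. (x, r, y, q, z)) [1..<w + 1]" for x r y q :: nat
  define f3 where "f3 x r y = concat (map (f4 x r y) [1..<m + 1])" for x r y
  define f2 where "f2 x r = concat (map (f3 x r) [1..<v + 1])" for x r
  define f1 where "f1 x = concat (map (f2 x) [1..<n + 1])" for x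
  have l4: "length (f4 x r y q) = w" for x r y q by (simp add: f4_def)
  have l3: "length (f3 x r y) = m * w" for x r y
    unfolding f3_def by (rule concat_map_uniform(1)) (rule l4)
  have l2: "length (f2 x r) = v * (m * w)" for x r
    unfolding f2_def by (rule concat_map_uniform(1)) (rule l3)
  have l1: "length (f1 x) = n * (v * (m * w))" for x
    unfolding f1_def by (rule concat_map_uniform(1)) (rule l2)
  have lex: "lex_indices u n v m w = concat (map f1 [1..<u + 1])"
    by (simp add: lex_indices_def f1_def[abs_def] f2_def[abs_def] f3_def[abs_def] f4_def[abs_def] del: upt_Suc)
  show "length (lex_indices u n v m w) = u * (n * (v * (m * w)))"
    unfolding lex by (rule concat_map_uniform(1)) (rule l1)
  assume i: "x < u" "r < n" "y < v" "q < m" "z < w"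
  have "lex_indices u n v m w ! (x * (n * (v * (m * w))) + (r * (v * (m * w)) + (y * (m * w) + (q * w + z))))
      = f4 (x + 1) (r + 1) (y + 1) (q + 1) ! z"
  proof -
    have d4: "q * w + z < m * w" by (rule digit_less) fact+
    have d3: "y * (m * w) + (q * w + z) < v * (m * w)" by (rule digit_less) fact+
    have d2: "r * (v * (m * w)) + (y * (m * w) + (q * w + z)) < n * (v * (m * w))"
        by (rule digit_less) fact+
    show ?thesis
      unfolding lex concat_map_uniform(2)[of u f1, OF l1 i(1) d2]
      unfolding f1_def concat_map_uniform(2)[of n "f2 _", OF l2 i(2) d3]
      unfolding f2_def concat_map_uniform(2)[of v "f3 _ _", OF l3 i(3) d4]
      unfolding f3_def concat_map_uniform(2)[of m "f4 _ _ _", OF l4 i(4,5)] ..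
  qed
  also have "\<dots> = (x + 1, r + 1, y + 1, q + 1, z + 1)"
    using i by (simp add: f4_def del: upt_Suc)
  finally show "lex_indices u n v m w ! ((((x * n + r) * v + y) * m + q) * w + z)
      = (x + 1, r + 1, y + 1, q + 1, z + 1)"
    by (simp add: algebra_simps)
qed

text \<open>Inside the box, intervals of length other than one occur exactly at the coordinates
  singled out by \<open>chi_coord\<close>.\<close>

lemma bmap_interval:
  "basic_valid (Face n j) \<Longrightarrow> [bmap (Face n j) i..<bmap (Face n j) (Suc i)]
    = (if 0 < j \<and> Suc i = j then [j - 1, j] else [bmap (Face n j) i])"
  "[bmap (Degen n j) i..<bmap (Degen n j) (Suc i)] = (if i = j then [] else [bmap (Degen n j) i])"
  by (auto simp: upt_rec)

lemma colour_tgt_Cons: "colour_tgt s ((f, k) # \<Lambda>) = (colour_tgt s \<Lambda>)(k := btgt f)"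
  by auto

lemma colour_tgt_append: "colour_tgt s (\<Gamma> @ \<Lambda>) = colour_tgt (colour_tgt s \<Lambda>) \<Gamma>"
  by (induction \<Gamma>) (auto simp: fun_eq_iff)

definition letters :: "shuffle \<Rightarrow> ((nat \<Rightarrow> nat) \<times> nat) list" where
  "letters \<Lambda> = map (\<lambda>(b, k). (bmap b, k)) \<Lambda>"

lemma letters_simps [simp]: "letters [] = []" "letters ((b, k) # \<Lambda>) = (bmap b, k) # letters \<Lambda>"
    "letters (\<Gamma> @ \<Lambda>) = letters \<Gamma> @ letters \<Lambda>"
  by (simp_all add: letters_def)

fun vshuffle :: "nat \<Rightarrow> (nat \<Rightarrow> nat) \<Rightarrow> shuffle \<Rightarrow> bool" where
  "vshuffle N s [] \<longleftrightarrow> True"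
| "vshuffle N s ((f, k) # \<Lambda>) \<longleftrightarrow> k < N \<and> basic_valid f \<and> bsrc f = colour_tgt s \<Lambda> k \<and> vshuffle N s \<Lambda>"

lemma vshuffle_append: "vshuffle N s (\<Gamma> @ \<Lambda>) \<longleftrightarrow> vshuffle N (colour_tgt s \<Lambda>) \<Gamma> \<and> vshuffle N s \<Lambda>"
  by (induction \<Gamma>) (auto simp: colour_tgt_append)

lemma prod_split_color:
  fixes t :: "nat \<Rightarrow> nat"
  assumes "a \<le> k" "k < n"
  shows "(\<Prod>l\<in>{a..<n}. t l) = (\<Prod>l\<in>{a..<k}. t l) * t k * (\<Prod>l\<in>{k<..<n}. t l)"
proof -
  have "{a..<n} = {a..<k} \<union> {k} \<union> {k<..<n}" using assms by auto
  then show ?thesis by (simp only:) (subst prod.union_disjoint; auto)+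
qed

context N_fold_strict_monoidal_category
begin

section \<open>Functors and transformations given by lists act on arrays\<close>

lemma vword_letters: "vshuffle N s \<Lambda> \<Longrightarrow> vword (letters \<Lambda>)"
  by (induction \<Lambda>) (auto simp: bmap_mono)

lemma rep_Wbar:
  assumes "k < N" "f \<in> arrs Delta" "tgt Delta f = s k"
    "u = (\<Prod>l<k. s l)" "p = (\<Prod>l\<in>{k<..<N}. s l)"
  shows "rep N s L X \<Longrightarrow> obA X \<Longrightarrow>
      rep N (s(k := src Delta f)) (fobj (Wbar M k p u f) L) (TO k (tmap f) X)"
    "rep N s L' F \<Longrightarrow> arA F \<Longrightarrow>
      rep N (s(k := src Delta f)) (farr (Wbar M k p u f) L') (TA k (tmap f) F)"
proof -
  note nf = nf_simps[OF assms(2), unfolded assms(3)]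
  show "rep N (s(k := src Delta f)) (fobj (Wbar M k p u f) L) (TO k (tmap f) X)" if "rep N s L X" "obA X"
    using rep_power_list[OF monoid_on_O[OF assms(1)] nf(1) assms(1) that(1) _ assms(4,5)] that(2)
    by (simp add: nf Wbar_power_list TO_def PO_def assms(3))
  show "rep N (s(k := src Delta f)) (farr (Wbar M k p u f) L') (TA k (tmap f) F)" if "rep N s L' F" "arA F"
    using rep_power_list[OF monoid_on_A[OF assms(1)] nf(1) assms(1) that(1) _ assms(4,5)] that(2)
    by (simp add: nf Wbar_power_list TA_def PA_def assms(3))
qed

lemma rep_Wbar_basic:
  assumes "k < N" "basic_valid b" "bsrc b = s k"
    "u = (\<Prod>l<k. s l)" "p = (\<Prod>l\<in>{k<..<N}. s l)"
  shows "rep N s L X \<Longrightarrow> obA X \<Longrightarrow>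
      rep N (s(k := btgt b)) (fobj (Wbar_basic M k p u b) L) (TO k (bmap b) X)"
    "rep N s L' F \<Longrightarrow> arA F \<Longrightarrow>
      rep N (s(k := btgt b)) (farr (Wbar_basic M k p u b) L') (TA k (bmap b) F)"
proof -
  have c: "composable (s k) [b]" using assms(2,3) by simp
  show "rep N (s(k := btgt b)) (fobj (Wbar_basic M k p u b) L) (TO k (bmap b) X)" if "rep N s L X" "obA X"
    using rep_power_list[OF monoid_on_O[OF assms(1)] c assms(1) that(1) _ assms(4,5)] that(2)
    by (simp add: Wbar_basic_power_list TO_def PO_def assms(3))
  show "rep N (s(k := btgt b)) (farr (Wbar_basic M k p u b) L') (TA k (bmap b) F)" if "rep N s L' F" "arA F"
    using rep_power_list[OF monoid_on_A[OF assms(1)] c assms(1) that(1) _ assms(4,5)] that(2)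
    by (simp add: Wbar_basic_power_list TA_def PA_def assms(3))
qed

text \<open>The targets \<open>colour_tgt\<close> that define the inner and outer powers in
  \<open>Wbar_shuffle\<close> are the sizes of the current box, so each member satisfies the
  hypotheses of \<open>rep_Wbar_basic\<close>.\<close>

lemma rep_Wbar_shuffle:
  assumes "vshuffle N s \<Lambda>"
  shows "rep N s L X \<Longrightarrow> obA X \<Longrightarrow>
      rep N (colour_tgt s \<Lambda>) (fobj (Wbar_shuffle N M s \<Lambda>) L) (TW (letters \<Lambda>) X)"
    "rep N s L' F \<Longrightarrow> arA F \<Longrightarrow>
      rep N (colour_tgt s \<Lambda>) (farr (Wbar_shuffle N M s \<Lambda>) L') (TWA (letters \<Lambda>) F)"
proof -
  show "rep N (colour_tgt s \<Lambda>) (fobj (Wbar_shuffle N M s \<Lambda>) L) (TW (letters \<Lambda>) X)" if "rep N s L X" "obA X"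
    using assms
  proof (induction \<Lambda>)
    case Nil
    have "colour_tgt s [] = s" by auto
    then have "rep N (colour_tgt s []) (fobj (Wbar_shuffle N M s []) L) (TW (letters []) X)"
      using that by (simp add: fid_def)
    then show ?case .
  next
    case (Cons x \<Lambda>)
    obtain f k where x: "x = (f, k)" by force
    have "rep N ((colour_tgt s \<Lambda>)(k := btgt f)) (fobj (Wbar_shuffle N M s (x # \<Lambda>)) L) (TW (letters (x # \<Lambda>)) X)"
      unfolding x Wbar_shuffle.simps fcomp_def letters_simps TW.simps fst_conv snd_conv funct.simps comp_apply
      by (rule rep_Wbar_basic(1)) (use Cons vword_letters[of s \<Lambda>] x that in auto)
    then show ?case unfolding x colour_tgt_Cons .
  qed
  show "rep N (colour_tgt s \<Lambda>) (farr (Wbar_shuffle N M s \<Lambda>) L') (TWA (letters \<Lambda>) F)" if "rep N s L' F"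
      "arA F"
    using assms
  proof (induction \<Lambda>)
    case Nil
    have "colour_tgt s [] = s" by auto
    then have "rep N (colour_tgt s []) (farr (Wbar_shuffle N M s []) L') (TWA (letters []) F)"
      using that by (simp add: fid_def)
    then show ?case .
  next
    case (Cons x \<Lambda>)
    obtain f k where x: "x = (f, k)" by force
    have "rep N ((colour_tgt s \<Lambda>)(k := btgt f)) (farr (Wbar_shuffle N M s (x # \<Lambda>)) L') (TWA (letters (x # \<Lambda>)) F)"
      unfolding x Wbar_shuffle.simps fcomp_def letters_simps TWA.simps fst_conv snd_conv funct.simps comp_apply
      by (rule rep_Wbar_basic(2)) (use Cons vword_letters[of s \<Lambda>] x that in auto)
    then show ?case unfolding x colour_tgt_Cons .
  qed
qed

text \<open>At each coordinate \<open>chiA\<close> is \<open>GG\<close> on two intervals of length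
  at most two. If one of them has length one the component is an identity; otherwise
  \<open>GG_units\<close> gives the arrow prescribed by \<open>chi_coord\<close>.\<close>

lemma rep_chi:
  assumes "k < l" "l < N" "basic_valid f" "basic_valid g" "bsrc f = s k" "bsrc g = s l"
    "u = (\<Prod>i<k. s i)" "v = (\<Prod>i\<in>{k<..<l}. s i)" "w = (\<Prod>i\<in>{l<..<N}. s i)"
    "rep N s L X" "obA X"
  shows "rep N (s(l := btgt g, k := btgt f)) (chi M k l u v w f g L) (chiA k (bmap f) l (bmap g) X)"
proof -
  interpret color_pair N M k l using assms by (simp add: color_pairI)
  let ?s = "s(l := btgt g, k := btgt f)"
  let ?Y = "fobj (chi_source M k l u v w f g) L"
  let ?n = "btgt f" and ?m = "btgt g"
  \<comment> \<open>\<open>g\<close> acts before \<open>f\<close>: its outer power contains the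
    source of \<open>f\<close>, while the inner power of \<open>f\<close> already contains the
    target of \<open>g\<close>.\<close>
  have up: "(\<Prod>i<l. s i) = u * bsrc f * v"
    using prod_split_color[of 0 k l s] assms by (simp add: atLeast0LessThan)
  have vp: "(\<Prod>i\<in>{k<..<N}. (s(l := btgt g)) i) = v * btgt g * w"
    using prod_split_color[of "Suc k" l N "s(l := btgt g)"] assms
    by (simp add: atLeastSucLessThan_greaterThanLessThan)
  have kp: "(\<Prod>i<k. (s(l := btgt g)) i) = u"
  proof -
    have "i \<noteq> l" if "i < k" for i using less_trans[OF that kl] by auto
    then show ?thesis unfolding assms(7) by (intro prod.cong) auto
  qed
  have R: "rep N (s(l := btgt g)) (fobj (Wbar_basic M l w (u * bsrc f * v) g) L) (TO l (bmap g) X)"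
    by (rule rep_Wbar_basic(1)) (use assms up in auto)
  have "rep N ?s (fobj (Wbar_basic M k (v * btgt g * w) u f) (fobj (Wbar_basic M l w (u * bsrc f * v) g) L))
      (TO k (bmap f) (TO l (bmap g) X))"
    by (rule rep_Wbar_basic(1)[OF _ _ _ _ _ R]) (use assms vp kp in auto)
  then have Y: "rep N ?s ?Y (TO k (bmap f) (TO l (bmap g) X))"
    by (simp add: chi_source_def fcomp_def)
  have len: "(\<Prod>i<N. ?s i) = u * (?n * (v * (?m * w)))"
  proof -
    have "(\<Prod>i<N. ?s i) = (\<Prod>i<l. ?s i) * ?m * w"
      using prod_split_color[of 0 l N ?s] assms by (simp add: atLeast0LessThan)
    also have "(\<Prod>i<l. ?s i) = u * ?n * v"
      using prod_split_color[of 0 k l ?s] assms by (simp add: atLeast0LessThan)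
    finally show ?thesis unfolding mult.assoc .
  qed
  show ?thesis
    unfolding rep_def
  proof (intro conjI allI impI)
    show len': "length (chi M k l u v w f g L) = (\<Prod>i<N. ?s i)"
    proof -
      have "length ?Y = (\<Prod>i<N. ?s i)" using Y unfolding rep_def by blast
      moreover have "length (chi M k l u v w f g L) = min (u * (?n * (v * (?m * w)))) (length ?Y)"
        by (simp add: chi_def lex_indices_simps(1))
      ultimately show ?thesis by (simp only: len min.idem)
    qed
    fix r assume r: "in_box N ?s r"
    let ?x = "lex_pos 0 k s r" and ?y = "lex_pos (Suc k) l s r" and ?z = "lex_pos (Suc l) N s r"
    let ?pos = "(((?x * ?n + r k) * v + ?y) * ?m + r l) * w + ?z"
    have in_s: "r i < s i" if "i < N" "i \<noteq> k" "i \<noteq> l" for i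
      using r that unfolding in_box_def by (metis fun_upd_other)
    have rk: "r k < ?n" "r l < ?m"       using r[unfolded in_box_def, rule_format, OF kN] r[unfolded in_box_def, rule_format, OF lN] by simp_all
    have "in_box k s r"
      unfolding in_box_def using in_s less_trans[OF _ kl] less_trans[OF _ kN] by (metis less_irrefl)
    then have x: "?x < u" using lex_pos_bound assms(7) by blast
    have "r i < s i" if "Suc k \<le> i" "i < l" for i
      using that less_trans[OF _ lN] by (intro in_s) auto
    then have y: "?y < v"
      using lex_pos_less[of "Suc k" l r s] assms(8) by (simp add: atLeastSucLessThan_greaterThanLessThan)
    have "r i < s i" if "Suc l \<le> i" "i < N" for i
      using that less_trans[OF kl, of i] by (intro in_s) auto
    then have z: "?z < w"
      using lex_pos_less[of "Suc l" N r s] assms(9) by (simp add: atLeastSucLessThan_greaterThanLessThan)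
    have ne: "i < k \<Longrightarrow> i \<noteq> l" "l < i \<Longrightarrow> i \<noteq> k" for i
      using less_trans[of i k l] less_trans[of k l i] by auto
    \<comment> \<open>Stated for arbitrary sizes and digits at \<open>k\<close> and \<open>l\<close>
      because it is used in the target box, for the component, and in the source box, for the
      arguments of \<iota>.\<close>
    have split: "lex_pos 0 N t r' = (((lex_pos 0 k s r * t k + r' k) * v + lex_pos (Suc k) l s r) * t l + r' l) * w + lex_pos (Suc l) N s r"
      if "\<And>i. i \<noteq> k \<Longrightarrow> i \<noteq> l \<Longrightarrow> t i = s i \<and> r' i = r i" for t r'
    proof -
      have "lex_pos 0 k t r' = lex_pos 0 k s r" "lex_pos (Suc k) l t r' = lex_pos (Suc k) l s r"
          "lex_pos (Suc l) N t r' = lex_pos (Suc l) N s r"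
        using that ne by (auto intro!: lex_pos_cong)
      moreover have "(\<Prod>i\<in>{k<..<l}. t i) = v" "(\<Prod>i\<in>{l<..<N}. t i) = w"
        unfolding assms(8,9) using that ne by (auto intro!: prod.cong)
      ultimately show ?thesis
        using lex_pos_split_color[OF lN, of t r'] lex_pos_split_color[OF kl, of t r'] by simp
    qed
    have pos: "lex_pos 0 N ?s r = ?pos"
      using split[of ?s r] by simp
    have pos_less: "?pos < length ?Y" using Y lex_pos_bound[OF r] pos by (simp add: rep_def)
    define A where "A = (\<lambda>i j. X (r(k := i, l := j)))"
    have A[simp]: "ob (A i j)" for i j using assms(11) by (simp add: A_def)
    \<comment> \<open>The summands 1 reconcile coordinates counted from one in \<open>coord\<close>
      with array indices counted from zero.\<close>
    have At: "coord (bsrc f) v (bsrc g) w L (?x + 1) (i + 1) (?y + 1) (j + 1) (?z + 1) = A i j"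
      if "i < s k" "j < s l" for i j
    proof -
      have "in_box N s (r(k := i, l := j))" using that in_s by (auto simp: in_box_def)
      then have "L ! lex_pos 0 N s (r(k := i, l := j)) = A i j" using assms(10)
          unfolding rep_def A_def by blast
      moreover have "lex_pos 0 N s (r(k := i, l := j)) = (((?x * s k + i) * v + ?y) * s l + j) * w + ?z"
        using split[of s "r(k := i, l := j)"] by simp
      ultimately show ?thesis using assms(5,6) by (simp add: coord_def)
    qed
    define I where "I = [bmap f (r k)..<bmap f (Suc (r k))]"
    define J where "J = [bmap g (r l)..<bmap g (Suc (r l))]"
    let ?X = "TO k (bmap f) (TO l (bmap g) X) r"
    have X: "?X = PO k (\<lambda>i. PO l (A i) J) I" by (simp add: TO_def A_def I_def J_def)
    have GGs: "GG k l A I J = \<one> ?X" if "I = [i] \<or> J = [j]" for i j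
      using that GG_single_left[of A i J, OF A] GG_single_right[of A I j, OF A]
      unfolding X by (auto simp del: GG.simps)
    have leq: "length (lex_indices u ?n v ?m w) = length ?Y"
      unfolding lex_indices_simps(1) len[symmetric] using Y unfolding rep_def by simp
    have "chi M k l u v w f g L ! ?pos
      = chi_coord M k l (coord (bsrc f) v (bsrc g) w L) f g (lex_indices u ?n v ?m w ! ?pos) (?Y ! ?pos)"
      using pos_less leq unfolding chi_def by simp
    also have "\<dots> = chi_coord M k l (coord (bsrc f) v (bsrc g) w L) f g (?x + 1, r k + 1, ?y + 1, r l + 1, ?z + 1) (?Y ! ?pos)"
      unfolding lex_indices_simps(2)[OF x rk(1) y rk(2) z] ..
    also have "?Y ! ?pos = ?X" using Y r unfolding rep_def pos[symmetric] by blast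
    also have "chi_coord M k l (coord (bsrc f) v (bsrc g) w L) f g (?x + 1, r k + 1, ?y + 1, r l + 1, ?z + 1) ?X
      = GG k l A I J"
    proof (cases f)
      case f: (Degen n j)
      have I: "I = (if r k = j then [] else [bmap f (r k)])" unfolding I_def f by (rule bmap_interval(2))
      show ?thesis
      proof (cases g)
        case g: (Degen m i)
        have J: "J = (if r l = i then [] else [bmap g (r l)])" unfolding J_def g by (rule bmap_interval(2))
        show ?thesis
        proof (cases "r k = j \<and> r l = i")
          case True
          then show ?thesis using I J GG_units(1)[of A, OF A] f g by (simp del: GG.simps)
        next
          case False
          then have "GG k l A I J = \<one> ?X" using I J by (intro GGs) auto
          then show ?thesis using False by (auto simp: f g simp del: GG.simps)
        qed
      next
        case g: (Face m i)
        have J: "J = (if 0 < i \<and> Suc (r l) = i then [i - 1, i] else [bmap g (r l)])"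
          unfolding J_def g by (rule bmap_interval(1)) (use assms g in simp)
        show ?thesis
        proof (cases "r k = j \<and> Suc (r l) = i")
          case True
          then show ?thesis using I J GG_units(3)[of A "i - 1" i, OF A] f g rk(2)
              by (auto simp del: GG.simps)
        next
          case False
          then have "GG k l A I J = \<one> ?X" using I J by (intro GGs[of "bmap f (r k)" "bmap g (r l)"]) auto
          then show ?thesis using False by (auto simp: f g simp del: GG.simps)
        qed
      qed
    next
      case f: (Face n j)
      have I: "I = (if 0 < j \<and> Suc (r k) = j then [j - 1, j] else [bmap f (r k)])"
        unfolding I_def f by (rule bmap_interval(1)) (use assms f in simp)
      show ?thesis
      proof (cases g)
        case g: (Degen m i)
        have J: "J = (if r l = i then [] else [bmap g (r l)])" unfolding J_def g by (rule bmap_interval(2))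
        show ?thesis
        proof (cases "Suc (r k) = j \<and> r l = i")
          case True
          then show ?thesis using I J GG_units(2)[of A "j - 1" j, OF A] f g rk(1)
              by (auto simp del: GG.simps)
        next
          case False
          then have "GG k l A I J = \<one> ?X" using I J by (intro GGs[of "bmap f (r k)" "bmap g (r l)"]) auto
          then show ?thesis using False by (auto simp: f g simp del: GG.simps)
        qed
      next
        case g: (Face m i)
        have J: "J = (if 0 < i \<and> Suc (r l) = i then [i - 1, i] else [bmap g (r l)])"
          unfolding J_def g by (rule bmap_interval(1)) (use assms g in simp)
        show ?thesis
        proof (cases "Suc (r k) = j \<and> Suc (r l) = i")
          case True
          \<comment> \<open>Membership in the target box gives \<open>r k < n - 1\<close> and
            \<open>r l < m - 1\<close>, so both faces are inner, as the \<iota> case of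
            \<open>chi_coord\<close> demands.\<close>
          then have "j < n" "i < m" using rk f g by auto
          then have *: "coord n v m w L (?x + 1) j (?y + 1) i (?z + 1) = A (j - 1) (i - 1)"
            "coord n v m w L (?x + 1) j (?y + 1) (i + 1) (?z + 1) = A (j - 1) i"
            "coord n v m w L (?x + 1) (j + 1) (?y + 1) i (?z + 1) = A j (i - 1)"
            "coord n v m w L (?x + 1) (j + 1) (?y + 1) (i + 1) (?z + 1) = A j i"
            using At[of "j - 1" "i - 1"] At[of "j - 1" i] At[of j "i - 1"] At[of j i] True assms(5,6) f g
            by auto
          show ?thesis
            using I J GG_units(4)[of A "j - 1" j "i - 1" i, OF A] f g True * \<open>j < n\<close> \<open>i < m\<close>
            by (auto simp del: GG.simps)
        next
          case False
          then have "GG k l A I J = \<one> ?X" using I J by (intro GGs[of "bmap f (r k)" "bmap g (r l)"]) auto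
          then show ?thesis using False by (auto simp: f g simp del: GG.simps)
        qed
      qed
    qed
    finally show "chi M k l u v w f g L ! lex_pos 0 N ?s r = chiA k (bmap f) l (bmap g) X r"
      unfolding pos chiA_def A_def I_def J_def .
  qed
qed

lemma rep_phi_swap:
  assumes "k < l" "vshuffle N s (\<Gamma> @ (f, k) # (g, l) # \<Lambda>)" "rep N s L X" "obA X"
  shows "rep N (colour_tgt s (\<Gamma> @ (f, k) # (g, l) # \<Lambda>)) (phi_swap N M s \<Gamma> (f, k) (g, l) \<Lambda> L)
    (TWA (letters \<Gamma>) (chiA k (bmap f) l (bmap g) (TW (letters \<Lambda>) X)))"
proof -
  let ?t = "colour_tgt s \<Lambda>"
  have v: "vshuffle N s \<Lambda>" "l < N" "basic_valid f" "basic_valid g" "bsrc f = ?t k" "bsrc g = ?t l"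
    "vshuffle N (colour_tgt s ((f, k) # (g, l) # \<Lambda>)) \<Gamma>"
    using assms(1,2) by (auto simp: vshuffle_append)
  have ob: "obA (TW (letters \<Lambda>) X)" using v(1) vword_letters assms(4) by simp
  have "rep N (?t(l := btgt g, k := btgt f))
     (chi M k l (\<Prod>z<k. ?t z) (\<Prod>z\<in>{k<..<l}. ?t z) (\<Prod>z\<in>{l<..<N}. ?t z) f g (fobj (Wbar_shuffle N M s \<Lambda>) L))
     (chiA k (bmap f) l (bmap g) (TW (letters \<Lambda>) X))"
    by (rule rep_chi) (use assms(1) v ob rep_Wbar_shuffle(1)[OF v(1) assms(3,4)] in auto)
  then show ?thesis
    unfolding colour_tgt_append phi_swap_def Let_def prod.case
    by (intro rep_Wbar_shuffle(2)[OF v(7)])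
        (use assms(1) v(2) ob in \<open>simp_all only: colour_tgt_Cons chiA_simps\<close>)
qed

end

section \<open>Normalizing paths\<close>

text \<open>The swapped letters differ in colour, so the swap begins at the first position where the
  two shuffles differ; this fixes the prefix and then everything else.\<close>

lemma is_swap_unique:
  assumes "is_swap \<Theta> \<Theta>' \<Gamma> x y \<Lambda>" "is_swap \<Theta> \<Theta>' \<Gamma>' x' y' \<Lambda>'"
  shows "\<Gamma> = \<Gamma>' \<and> x = x' \<and> y = y' \<and> \<Lambda> = \<Lambda>'"
proof -
  have "snd x < snd y" "snd x' < snd y'" "\<Gamma> @ x # y # \<Lambda> = \<Gamma>' @ x' # y' # \<Lambda>'" "\<Gamma> @ y # x # \<Lambda> = \<Gamma>'
      @ y' # x' # \<Lambda>'"
    using assms by (auto simp: is_swap_def)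
  then show ?thesis
  proof (induction \<Gamma> arbitrary: \<Gamma>')
    case Nil
    show ?case
    proof (cases \<Gamma>')
      case nil: Nil
      then show ?thesis using Nil.prems(3) by simp
    next
      case (Cons c' \<Gamma>'')
      have "x = c'" using Nil.prems(3) Cons by simp
      moreover have "y = c'" using Nil.prems(4) Cons by simp
      ultimately show ?thesis using Nil.prems(1) by simp
    qed
  next
    case (Cons c \<Gamma>)
    show ?case
    proof (cases \<Gamma>')
      case Nil
      have "c = x'" using Cons.prems(3) Nil by simp
      moreover have "c = y'" using Cons.prems(4) Nil by simp
      ultimately show ?thesis using Cons.prems(2) by simp
    next
      case cons: (Cons c' \<Gamma>'')
      have "\<Gamma> @ x # y # \<Lambda> = \<Gamma>'' @ x' # y' # \<Lambda>'" "\<Gamma> @ y # x # \<Lambda> = \<Gamma>'' @ y' # x' # \<Lambda>'" "c = c'"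
        using Cons.prems(3,4) cons by simp_all
      then show ?thesis using Cons.IH[OF Cons.prems(1,2)] cons by simp
    qed
  qed
qed

lemma phi_step_eq:
  assumes "is_swap \<Theta> \<Theta>' \<Gamma> x y \<Lambda>"
  shows "phi_step N M s \<Theta> \<Theta>' = phi_swap N M s \<Gamma> x y \<Lambda>"
  unfolding phi_step_def
proof (rule the_equality)
  show "\<exists>\<Gamma>' x' y' \<Lambda>'. is_swap \<Theta> \<Theta>' \<Gamma>' x' y' \<Lambda>' \<and> phi_swap N M s \<Gamma> x y \<Lambda> = phi_swap N M s \<Gamma>' x' y' \<Lambda>'"
    using assms by blast
  fix \<phi>
  assume "\<exists>\<Gamma> x y \<Lambda>. is_swap \<Theta> \<Theta>' \<Gamma> x y \<Lambda> \<and> \<phi> = phi_swap N M s \<Gamma> x y \<Lambda>"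
  then show "\<phi> = phi_swap N M s \<Gamma> x y \<Lambda>" using is_swap_unique[OF assms] by blast
qed

section \<open>Sorting shuffles by admissible swaps\<close>

definition swaps :: "shuffle \<Rightarrow> shuffle \<Rightarrow> bool" where
  "swaps \<Theta> \<Theta>' \<longleftrightarrow> (\<exists>\<Gamma> x y \<Lambda>. is_swap \<Theta> \<Theta>' \<Gamma> x y \<Lambda>)"

lemma swaps_append: "swaps\<^sup>*\<^sup>* \<Theta> \<Theta>' \<Longrightarrow> swaps\<^sup>*\<^sup>* (\<Gamma> @ \<Theta>) (\<Gamma> @ \<Theta>')"
proof (induction rule: rtranclp_induct)
  case (step \<Theta>1 \<Theta>2)
  then obtain \<Gamma>' x y \<Lambda> where "is_swap \<Theta>1 \<Theta>2 \<Gamma>' x y \<Lambda>" by (auto simp: swaps_def)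
  then have "is_swap (\<Gamma> @ \<Theta>1) (\<Gamma> @ \<Theta>2) (\<Gamma> @ \<Gamma>') x y \<Lambda>" by (auto simp: is_swap_def)
  then have "swaps (\<Gamma> @ \<Theta>1) (\<Gamma> @ \<Theta>2)" unfolding swaps_def by blast
  then show ?case using step.IH by simp
qed simp

lemma swaps_move: "(\<And>y. y \<in> set B \<Longrightarrow> snd x < snd y) \<Longrightarrow> swaps\<^sup>*\<^sup>* (x # B @ C) (B @ x # C)"
proof (induction B)
  case (Cons y B)
  have "is_swap (x # (y # B) @ C) (y # x # B @ C) [] x y (B @ C)"
    using Cons.prems by (simp add: is_swap_def)
  then have "swaps (x # (y # B) @ C) (y # x # B @ C)" unfolding swaps_def by blast
  moreover have "swaps\<^sup>*\<^sup>* ([y] @ x # B @ C) ([y] @ B @ x # C)"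
    using Cons by (intro swaps_append) simp
  ultimately show ?case by (simp add: converse_rtranclp_into_rtranclp)
qed simp

lemma normal_shuffle_simps [simp]:
  "normal_shuffle 0 \<Phi> = []" "normal_shuffle (Suc n) \<Phi> = \<Phi> n @ normal_shuffle n \<Phi>"
  by (simp_all add: normal_shuffle_def)

lemma normal_shuffle_cong: "(\<And>k. k < n \<Longrightarrow> \<Phi> k = \<Phi>' k) \<Longrightarrow> normal_shuffle n \<Phi> = normal_shuffle n \<Phi>'"
  by (induction n) auto

text \<open>One step of insertion sort, parallel to the recursion of \<open>coh\<close>: the new
  letter passes the blocks of higher colour and stops at the head of its own.\<close>

lemma swaps_insert:
  assumes "\<And>l y. y \<in> set (\<Phi> l) \<Longrightarrow> snd y = l" "snd x < n"
  shows "swaps\<^sup>*\<^sup>* (x # normal_shuffle n \<Phi>) (normal_shuffle n (\<Phi>(snd x := x # \<Phi> (snd x))))"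
  using assms(2)
proof (induction n)
  case (Suc n)
  let ?\<Phi> = "\<Phi>(snd x := x # \<Phi> (snd x))"
  have "swaps\<^sup>*\<^sup>* (x # normal_shuffle (Suc n) \<Phi>) (normal_shuffle (Suc n) ?\<Phi>)"
  proof (cases "snd x = n")
    case True
    then have "normal_shuffle n ?\<Phi> = normal_shuffle n \<Phi>" by (intro normal_shuffle_cong) auto
    then show ?thesis using True by simp
  next
    case False
    then have "swaps\<^sup>*\<^sup>* (x # \<Phi> n @ normal_shuffle n \<Phi>) (\<Phi> n @ x # normal_shuffle n \<Phi>)"
      using Suc.prems assms(1) by (intro swaps_move) fastforce
    moreover have "swaps\<^sup>*\<^sup>* (\<Phi> n @ x # normal_shuffle n \<Phi>) (\<Phi> n @ normal_shuffle n ?\<Phi>)"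
      using Suc.prems False by (intro swaps_append Suc.IH) simp
    ultimately show ?thesis using False by simp
  qed
  then show ?case .
qed simp

lemma swaps_normal:
  "(\<And>x. x \<in> set \<Theta> \<Longrightarrow> snd x < n) \<Longrightarrow>
    swaps\<^sup>*\<^sup>* \<Theta> (normal_shuffle n (\<lambda>k. filter (\<lambda>x. snd x = k) \<Theta>))"
proof (induction \<Theta>)
  case Nil
  have "normal_shuffle n (\<lambda>k. []) = []" by (induction n) auto
  then show ?case by simp
next
  case (Cons x \<Theta>)
  let ?\<Phi> = "\<lambda>k. filter (\<lambda>x. snd x = k) \<Theta>"
  have "swaps\<^sup>*\<^sup>* ([x] @ \<Theta>) ([x] @ normal_shuffle n ?\<Phi>)"
    using Cons by (intro swaps_append) simp
  moreover have "swaps\<^sup>*\<^sup>* (x # normal_shuffle n ?\<Phi>) (normal_shuffle n (?\<Phi>(snd x := x # ?\<Phi> (snd x))))"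
    using Cons.prems by (intro swaps_insert) auto
  moreover have "?\<Phi>(snd x := x # ?\<Phi> (snd x)) = (\<lambda>k. filter (\<lambda>x. snd x = k) (x # \<Theta>))"
    by auto
  ultimately show ?case by simp
qed

lemma swaps_shuffle: "swaps \<Theta> \<Theta>' \<Longrightarrow> is_shuffle N \<Phi> \<Theta> \<Longrightarrow> is_shuffle N \<Phi> \<Theta>'"
proof -
  assume "swaps \<Theta> \<Theta>'" and s: "is_shuffle N \<Phi> \<Theta>"
  then obtain \<Gamma> x y \<Lambda> where "snd x < snd y" "\<Theta> = \<Gamma> @ x # y # \<Lambda>" "\<Theta>' = \<Gamma> @ y # x # \<Lambda>"
    by (auto simp: swaps_def is_swap_def)
  moreover from this have "filter (\<lambda>x. snd x = k) \<Theta>' = filter (\<lambda>x. snd x = k) \<Theta>" for k by auto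
  ultimately show "is_shuffle N \<Phi> \<Theta>'" using s by (auto simp: is_shuffle_def)
qed

text \<open>Insertion sort provides a path, which gives the choice of a path in \<open>phi\<close>
  its meaning.\<close>

lemma normalizing_path_exists:
  assumes "is_shuffle N \<Phi> \<Theta>"
  shows "\<exists>\<Theta>s. normalizing_path N \<Phi> \<Theta> \<Theta>s"
proof -
  have "normal_shuffle N (\<lambda>k. filter (\<lambda>x. snd x = k) \<Theta>) = normal_shuffle N \<Phi>"
    using assms by (intro normal_shuffle_cong) (auto simp: is_shuffle_def)
  then have "swaps\<^sup>*\<^sup>* \<Theta> (normal_shuffle N \<Phi>)"
    using swaps_normal[of \<Theta> N] assms by (auto simp: is_shuffle_def)
  then show ?thesis using assms
  proof (induction rule: converse_rtranclp_induct)
    case base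
    then have "normalizing_path N \<Phi> (normal_shuffle N \<Phi>) [normal_shuffle N \<Phi>]"
      by (simp add: normalizing_path_def)
    then show ?case by blast
  next
    case (step \<Theta> \<Theta>')
    then obtain \<Theta>s where p: "normalizing_path N \<Phi> \<Theta>' \<Theta>s" using swaps_shuffle by blast
    have nxt: "swaps ((\<Theta> # \<Theta>s) ! i) ((\<Theta> # \<Theta>s) ! (i + 1))" if "i < length \<Theta>s" for i
    proof (cases i)
      case 0
      have "\<Theta>s ! 0 = \<Theta>'" using p by (auto simp: normalizing_path_def hd_conv_nth)
      then show ?thesis using 0 step(1) by simp
    next
      case (Suc i')
      then have "i' < length \<Theta>s - 1" using that by simp
      then have "swaps (\<Theta>s ! i') (\<Theta>s ! (i' + 1))"
        using p unfolding normalizing_path_def swaps_def by blast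
      then show ?thesis using Suc by simp
    qed
    have "normalizing_path N \<Phi> \<Theta> (\<Theta> # \<Theta>s)"
      using p step.prems nxt unfolding normalizing_path_def swaps_def[symmetric] by auto
    then show ?case by blast
  qed
qed

lemma colour_tgt_swap:
  "k \<noteq> l \<Longrightarrow> colour_tgt s ((g, l) # (f, k) # \<Lambda>) = colour_tgt s ((f, k) # (g, l) # \<Lambda>)"
  by (auto simp: fun_eq_iff)

lemma swaps_tgt:
  assumes "swaps \<Theta> \<Theta>'"
  shows "colour_tgt s \<Theta>' = colour_tgt s \<Theta>"
proof -
  obtain \<Gamma> f k g l \<Lambda> where *: "k < l" "\<Theta> = \<Gamma> @ (f, k) # (g, l) # \<Lambda>" "\<Theta>' = \<Gamma> @ (g, l) # (f, k) # \<Lambda>"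
    using assms by (auto simp: swaps_def is_swap_def)
  then have "k \<noteq> l" by simp
  show ?thesis unfolding *(2,3) colour_tgt_append colour_tgt_swap[OF \<open>k \<noteq> l\<close>] ..
qed

lemma swaps_vshuffle: "swaps \<Theta> \<Theta>' \<Longrightarrow> vshuffle N s \<Theta> \<Longrightarrow> vshuffle N s \<Theta>'"
proof -
  assume sw: "swaps \<Theta> \<Theta>'" and s: "vshuffle N s \<Theta>"
  then obtain \<Gamma> f k g l \<Lambda> where *: "k < l" "\<Theta> = \<Gamma> @ (f, k) # (g, l) # \<Lambda>" "\<Theta>' = \<Gamma> @ (g, l) # (f, k) # \<Lambda>"
    by (auto simp: swaps_def is_swap_def)
  then have "k \<noteq> l" by simp
  have "vshuffle N s ((g, l) # (f, k) # \<Lambda>)" using s \<open>k \<noteq> l\<close> unfolding *(2) by (simp add: vshuffle_append)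
  then show "vshuffle N s \<Theta>'"
    using s unfolding *(2,3) vshuffle_append colour_tgt_swap[OF \<open>k \<noteq> l\<close>] by blast
qed

section \<open>Normalizing paths compute the canonical transformation\<close>

context N_fold_strict_monoidal_category
begin

text \<open>Several letters of one colour are allowed, as in the normal shuffle. No letter has a
  higher colour to its right, so \<open>ins_triv\<close> applies throughout.\<close>

lemma coh_sorted:
  assumes "sorted_wrt (\<lambda>x y. snd y \<le> snd x) \<Theta>" "vword \<Theta>" "obA X"
  shows "coh \<Theta> X = idA (TW \<Theta> X)"
  using assms(1,2)
proof (induction \<Theta>)
  case (Cons x \<Theta>)
  have "ev \<Theta> l = id" if "snd x < l" for l
  proof -
    have "\<forall>y\<in>set \<Theta>. snd y < l" using Cons.prems that by auto
    then show ?thesis by (induction \<Theta>) (auto simp: upd_def)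
  qed
  then have "ins N (snd x) (fst x) (ev \<Theta>) X = idA (TO (snd x) (fst x) (WO N (ev \<Theta>) X))"
    using Cons.prems assms(3) by (intro ins_triv) auto
  moreover have "WO N (ev \<Theta>) X = TW \<Theta> X"
    using Cons assms(3) coh_simps(3)[of \<Theta> X] by simp
  ultimately show ?case using Cons assms(3) by simp
qed simp

text \<open>The invariant along a path: by \<open>coh_swap\<close>, each swap splits from
  \<open>coh\<close> exactly the whiskered crossing that the path composes. Hence \<open>F\<close>
  is the discrepancy between the two ends.\<close>

lemma rep_phi_path:
  assumes "\<Theta>s \<noteq> []" "\<forall>i < length \<Theta>s - 1. swaps (\<Theta>s ! i) (\<Theta>s ! (i + 1))" "vshuffle N s (hd \<Theta>s)"
    "rep N s L X" "obA X"
  shows "vshuffle N s (last \<Theta>s) \<and> colour_tgt s (last \<Theta>s) = colour_tgt s (hd \<Theta>s) \<and>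
    (\<exists>F. arA F \<and> dmA F = TW (letters (hd \<Theta>s)) X \<and> cdA F = TW (letters (last \<Theta>s)) X
      \<and> rep N (colour_tgt s (hd \<Theta>s)) (phi_path N M s \<Theta>s L) F
      \<and> coh (letters (hd \<Theta>s)) X = coh (letters (last \<Theta>s)) X \<odot> F)"
  using assms(1-3)
proof (induction \<Theta>s)
  case (Cons \<Theta> \<Theta>s)
  show ?case
  proof (cases \<Theta>s)
    case Nil
    have v: "vshuffle N s \<Theta>" using Cons.prems by simp
    note vword = vword_letters[OF v]
    have "rep N (colour_tgt s \<Theta>) (map (idn M) (fobj (Wbar_shuffle N M s \<Theta>) L)) (idA (TW (letters \<Theta>) X))"
      unfolding idA_def by (rule rep_map) (rule rep_Wbar_shuffle(1)[OF v assms(4,5)])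
    then show ?thesis
      using Nil v vword assms(5) by (intro conjI exI[of _ "idA (TW (letters \<Theta>) X)"]) auto
  next
    case (Cons \<Theta>' \<Theta>s')
    have "swaps \<Theta> \<Theta>'" using Cons Cons.prems(2)[rule_format, of 0] by simp
    then obtain \<Gamma> f k g l \<Lambda> where sw: "is_swap \<Theta> \<Theta>' \<Gamma> (f, k) (g, l) \<Lambda>"
      by (auto simp: swaps_def)
    then have eq: "k < l" "\<Theta> = \<Gamma> @ (f, k) # (g, l) # \<Lambda>" "\<Theta>' = \<Gamma> @ (g, l) # (f, k) # \<Lambda>"
      by (auto simp: is_swap_def)
    have v: "vshuffle N s \<Theta>" and v': "vshuffle N s \<Theta>'"
        using Cons.prems(3) swaps_vshuffle[OF \<open>swaps \<Theta> \<Theta>'\<close>] by auto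
    have tgt: "colour_tgt s \<Theta>' = colour_tgt s \<Theta>" using swaps_tgt[OF \<open>swaps \<Theta> \<Theta>'\<close>] .
    have step: "\<forall>i<length \<Theta>s - 1. swaps (\<Theta>s ! i) (\<Theta>s ! (i + 1))"
      using Cons.prems(2) Cons by auto
    obtain F where F: "vshuffle N s (last \<Theta>s)" "colour_tgt s (last \<Theta>s) = colour_tgt s \<Theta>'"
      "arA F" "dmA F = TW (letters \<Theta>') X" "cdA F = TW (letters (last \<Theta>s)) X"
      "rep N (colour_tgt s \<Theta>') (phi_path N M s \<Theta>s L) F" "coh (letters \<Theta>') X = coh (letters (last \<Theta>s)) X \<odot> F"
      using Cons.IH step v' Cons by auto
    let ?G = "TWA (letters \<Gamma>) (chiA k (bmap f) l (bmap g) (TW (letters \<Lambda>) X))"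
    have vv: "l < N" "k < N" "vword (letters \<Gamma>)" "vword (letters \<Lambda>)" "vword (letters (last \<Theta>s))"
      using v vword_letters[OF v] eq vword_letters[OF F(1)] by auto
    have G: "arA ?G" "dmA ?G = TW (letters \<Theta>) X" "cdA ?G = TW (letters \<Theta>') X"
      using vv eq assms(5) by (simp_all add: TW_append)
    have relG: "rep N (colour_tgt s \<Theta>) (phi_step N M s \<Theta> \<Theta>' L) ?G"
      unfolding phi_step_eq[OF sw] unfolding eq(2)
      by (rule rep_phi_swap) (use eq v assms in auto)
    have "coh (letters \<Theta>) X = coh (letters \<Theta>') X \<odot> ?G"
      unfolding eq(2,3) letters_simps by (rule coh_swap) (use vv eq assms(5) bmap_mono in auto)
    then have coh: "coh (letters \<Theta>) X = coh (letters (last \<Theta>s)) X \<odot> F \<odot> ?G"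
      unfolding F(7) using F G vv assms(5) by simp
    have "rep N (colour_tgt s \<Theta>) (phi_path N M s (\<Theta> # \<Theta>s) L) (F \<odot> ?G)"
      using rep_map2[OF F(6)[unfolded tgt] relG, of "cmp M"] Cons by (simp add: cpA_def)
    then show ?thesis
      using F G coh tgt Cons by (intro conjI exI[of _ "F \<odot> ?G"]) auto
  qed
qed simp

text \<open>The path ends in a sorted word, where \<open>coh\<close> is an identity, so the
  discrepancy \<open>F\<close> is all of \<open>coh\<close>. The same array results for every choice
  of path.\<close>

lemma rep_phi:
  assumes "is_shuffle N \<Phi> \<Theta>" "vshuffle N s \<Theta>" "rep N s L X" "obA X"
    "\<And>k x. x \<in> set (\<Phi> k) \<Longrightarrow> snd x = k"
  shows "rep N (colour_tgt s \<Theta>) (phi N M s \<Phi> \<Theta> L) (coh (letters \<Theta>) X)"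
proof -
  define \<Theta>s where "\<Theta>s = (SOME \<Theta>s. normalizing_path N \<Phi> \<Theta> \<Theta>s)"
  have "normalizing_path N \<Phi> \<Theta> \<Theta>s"
    unfolding \<Theta>s_def using normalizing_path_exists[OF assms(1)] by (rule someI_ex)
  then have p: "\<Theta>s \<noteq> []" "\<forall>i < length \<Theta>s - 1. swaps (\<Theta>s ! i) (\<Theta>s ! (i + 1))"
    "hd \<Theta>s = \<Theta>" "last \<Theta>s = normal_shuffle N \<Phi>"
    by (auto simp: normalizing_path_def swaps_def)
  obtain F where F: "vshuffle N s (normal_shuffle N \<Phi>)" "arA F" "cdA F
      = TW (letters (normal_shuffle N \<Phi>)) X"
    "rep N (colour_tgt s \<Theta>) (phi_path N M s \<Theta>s L) F" "coh (letters \<Theta>) X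
        = coh (letters (normal_shuffle N \<Phi>)) X \<odot> F"
    using rep_phi_path[OF p(1,2), unfolded p(3,4), OF assms(2-4)] by blast
  have "set (normal_shuffle n \<Phi>) \<subseteq> {x. snd x < n}
      \<and> sorted_wrt (\<lambda>x y. snd y \<le> snd x) (letters (normal_shuffle n \<Phi>))" for n
  proof (induction n)
    case (Suc n)
    have *: "sorted_wrt (\<lambda>x y. snd y \<le> snd x) (letters (\<Phi> n))"
      unfolding letters_def sorted_wrt_map sorted_wrt_iff_nth_less using assms(5)[OF nth_mem, of _ n]
      by (simp add: split_beta)
    show ?case using Suc * assms(5)[of _ n]
      by (fastforce simp: sorted_wrt_append letters_def split_beta)
  qed simp
  then have "coh (letters (normal_shuffle N \<Phi>)) X = idA (TW (letters (normal_shuffle N \<Phi>)) X)"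
    using vword_letters[OF F(1)] assms(4) by (intro coh_sorted) auto
  then have "coh (letters \<Theta>) X = F" using F by simp
  then show ?thesis using F(4) by (simp add: phi_def \<Theta>s_def)
qed

end

section \<open>The lax functor\<close>

lemma category_power:
  assumes "category C"
  shows "category (power_cat n C)"
proof -
  interpret C: category C by fact
  have H: "f \<in> hom C (src C f) (tgt C f)" if "f \<in> arrs C" for f using that by (simp add: hom_def)
  have cmp: "cmp C g f \<in> arrs C" "src C (cmp C g f) = src C f" "tgt C (cmp C g f) = tgt C g"
    if "f \<in> arrs C" "g \<in> arrs C" "tgt C f = src C g" for f g
    using C.cmp_hom[of f "src C f" "src C g" g "tgt C g"] that by (auto simp: hom_def)
  have idn: "idn C A \<in> arrs C" "src C (idn C A) = A" "tgt C (idn C A) = A" if "A \<in> objs C" for A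
    using C.idn_hom[OF that] by (auto simp: hom_def)
  have nths: "tgt C (f ! i) = src C (g ! i)" if "map (tgt C) f = map (src C) g" "i < length f" for f g i
    using that by (metis length_map nth_map)
  have in_arrs: "f ! i \<in> arrs C" if "set f \<subseteq> arrs C" "i < length f" for f i using that nth_mem by blast
  show ?thesis
  proof
    fix f g A B D assume "f \<in> hom (power_cat n C) A B" "g \<in> hom (power_cat n C) B D"
    then have fg: "length f = n" "length g = n" "set f \<subseteq> arrs C" "set g \<subseteq> arrs C"
      "map (src C) f = A" "map (tgt C) f = map (src C) g" "map (tgt C) g = D"
      by (auto simp: hom_def power_cat_def)
    have "set (map2 (cmp C) g f) \<subseteq> arrs C"
      using fg nths[OF fg(6)] in_arrs[OF fg(3)] in_arrs[OF fg(4)] by (auto simp: set_zip intro!: cmp(1))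
    moreover have "map (src C) (map2 (cmp C) g f) = map (src C) f" "map (tgt C) (map2 (cmp C) g f)
        = map (tgt C) g"
      using fg nths[OF fg(6)] in_arrs[OF fg(3)] in_arrs[OF fg(4)] by (auto intro!: nth_equalityI simp: cmp)
    ultimately show "cmp (power_cat n C) g f \<in> hom (power_cat n C) A D"
      using fg by (auto simp: hom_def power_cat_def)
  next
    fix f A B assume "f \<in> hom (power_cat n C) A B"
    then have f: "length f = n" "set f \<subseteq> arrs C" "map (src C) f = A" "map (tgt C) f = B"
      by (auto simp: hom_def power_cat_def)
    have "cmp C (idn C (tgt C x)) x = x" "cmp C x (idn C (src C x)) = x" if "x \<in> arrs C" for x
      using C.idn_left C.idn_right H[OF that] by auto
    then show "cmp (power_cat n C) (idn (power_cat n C) B) f = f"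
        "cmp (power_cat n C) f (idn (power_cat n C) A) = f"
      using f in_arrs[OF f(2)] by (auto simp: power_cat_def intro!: nth_equalityI)
  next
    fix f g h A B D E
    assume "f \<in> hom (power_cat n C) A B" "g \<in> hom (power_cat n C) B D" "h \<in> hom (power_cat n C) D E"
    then have fg: "length f = n" "length g = n" "length h = n" "set f \<subseteq> arrs C" "set g \<subseteq> arrs C"
        "set h \<subseteq> arrs C"
      "map (tgt C) f = map (src C) g" "map (tgt C) g = map (src C) h"
      by (auto simp: hom_def power_cat_def)
    have "cmp C (cmp C (h ! i) (g ! i)) (f ! i) = cmp C (h ! i) (cmp C (g ! i) (f ! i))" if "i < n" for i
      using C.cmp_assoc[of "f ! i" "src C (f ! i)" "src C (g ! i)" "g ! i" "src C (h ! i)" "h ! i"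
          "tgt C (h ! i)"]
        nths[OF fg(7)] nths[OF fg(8)] in_arrs[OF fg(4)] in_arrs[OF fg(5)] in_arrs[OF fg(6)] that fg
      by (simp add: hom_def)
    then show "cmp (power_cat n C) (cmp (power_cat n C) h g) f
        = cmp (power_cat n C) h (cmp (power_cat n C) g f)"
      using fg by (auto simp: power_cat_def intro!: nth_equalityI)
  qed (use C.src_obj C.tgt_obj idn in \<open>auto simp: hom_def power_cat_def subset_iff intro!: map_idI\<close>)
qed

lemma prod_list_nth: "prod_list K = (\<Prod>l<length K. K ! l)" for K :: "nat list"
proof (induction K rule: rev_induct)
  case (snoc k K)
  have "(\<Prod>l<length K. (K @ [k]) ! l) = (\<Prod>l<length K. K ! l)"
    by (rule prod.cong) (auto simp: nth_append)
  then show ?case using snoc by simp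
qed simp

text \<open>The default \<open>d\<close> pads the array outside the box and makes it total.\<close>

definition array_of :: "nat \<Rightarrow> (nat \<Rightarrow> nat) \<Rightarrow> 'x \<Rightarrow> 'x list \<Rightarrow> (nat \<Rightarrow> nat) \<Rightarrow> 'x" where
  "array_of n s d L r = (if in_box n s r then L ! lex_pos 0 n s r else d)"

lemma rep_array_of: "length L = (\<Prod>l<n. s l) \<Longrightarrow> rep n s L (array_of n s d L)"
  by (auto simp: rep_def array_of_def)

lemma array_of_in: "length L = (\<Prod>l<n. s l) \<Longrightarrow> set L \<subseteq> S \<Longrightarrow> d \<in> S \<Longrightarrow> array_of n s d L r \<in> S"
  using lex_pos_bound[of n s r] by (auto simp: array_of_def)

lemma array_of_map:
  "length L = (\<Prod>l<n. s l) \<Longrightarrow> array_of n s (f d) (map f L) r = f (array_of n s d L r)"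
  using lex_pos_bound[of n s r] by (auto simp: array_of_def)

section \<open>Normal forms of tuples of simplicial maps\<close>

lemma composable_vshuffle:
  "composable (t k) w \<Longrightarrow> k < N \<Longrightarrow> vshuffle N t (map (\<lambda>b. (b, k)) w)
    \<and> colour_tgt t (map (\<lambda>b. (b, k)) w) = t(k := wtgt (t k) w)"
proof (induction w)
  case Nil
  have "colour_tgt t [] = t" by auto
  then show ?case by auto
next
  case (Cons b w)
  then have "basic_valid b" "composable (t k) w" "bsrc b = wtgt (t k) w"
    unfolding composable_Cons by auto
  then show ?case using Cons by (auto simp: colour_tgt_Cons simp del: colour_tgt.simps)
qed

text \<open>Colours from \<open>N\<close> on are given \<open>id\<close>, so that
  \<open>tmaps N e\<close> equals the \<open>ev\<close> of a valid word as a function and not just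
  below \<open>N\<close>.\<close>

definition tmaps :: "nat \<Rightarrow> simplicial_map list \<Rightarrow> nat \<Rightarrow> nat \<Rightarrow> nat" where
  "tmaps N e k = (if k < N then tmap (e ! k) else id)"

definition arrow_list :: "nat \<Rightarrow> simplicial_map list \<Rightarrow> bool" where
  "arrow_list N e \<longleftrightarrow> length e = N \<and> set e \<subseteq> arrs Delta"

lemma arrowsD: "arrow_list N e \<Longrightarrow> k < N \<Longrightarrow> e ! k \<in> arrs Delta"
  using nth_mem by (fastforce simp: arrow_list_def)

lemma mono_tmaps [simp]: "arrow_list N e \<Longrightarrow> mono (tmaps N e k)"
  by (auto simp: tmaps_def tmap_mono arrowsD)

context N_fold_strict_monoidal_category
begin

lemma ev_map: "ev (map (\<lambda>b. (bmap b, k)) w) l = (if l = k then wmap w else id)"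
  by (induction w) (auto simp: upd_def)

lemma normal_nf_sequence:
  assumes "arrow_list N e" "n \<le> N" "\<And>l. l < N \<Longrightarrow> s l = tgt Delta (e ! l)"
  shows "vshuffle N s (normal_shuffle n (nf_sequence e))
    \<and> colour_tgt s (normal_shuffle n (nf_sequence e)) = (\<lambda>l. if l < n then src Delta (e ! l) else s l)
    \<and> ev (letters (normal_shuffle n (nf_sequence e))) = (\<lambda>l. if l < n then tmap (e ! l) else id)"
  using assms(2)
proof (induction n)
  case 0
  have "colour_tgt s [] = s" by auto
  then have "vshuffle N s (normal_shuffle 0 (nf_sequence e))
    \<and> colour_tgt s (normal_shuffle 0 (nf_sequence e)) = (\<lambda>l. if l < 0 then src Delta (e ! l) else s l)
    \<and> ev (letters (normal_shuffle 0 (nf_sequence e))) = (\<lambda>l. if l < 0 then tmap (e ! l) else id)"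
    by simp
  then show ?case .
next
  case (Suc n)
  let ?t = "colour_tgt s (normal_shuffle n (nf_sequence e))"
  have IH: "vshuffle N s (normal_shuffle n (nf_sequence e))" "?t
      = (\<lambda>l. if l < n then src Delta (e ! l) else s l)"
    "ev (letters (normal_shuffle n (nf_sequence e))) = (\<lambda>l. if l < n then tmap (e ! l) else id)"
    using Suc.IH Suc.prems by simp_all
  have n: "n < N" and e: "e ! n \<in> arrs Delta" using Suc arrowsD[OF assms(1)] by auto
  have tn: "?t n = tgt Delta (e ! n)" using IH(2) assms(3)[OF n] by simp
  note nf = nf_simps[OF e]
  have c: "vshuffle N ?t (nf_sequence e n)" "colour_tgt ?t (nf_sequence e n) = ?t(n := src Delta (e ! n))"
    using composable_vshuffle[of ?t n "nf (e ! n)" N] nf n unfolding nf_sequence_def tn by auto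
  have letters: "letters (nf_sequence e n) = map (\<lambda>b. (bmap b, n)) (nf (e ! n))"
    by (simp add: letters_def nf_sequence_def)
  have "vshuffle N s (normal_shuffle (Suc n) (nf_sequence e))"
    using c IH(1) by (simp add: vshuffle_append)
  moreover have "colour_tgt s (normal_shuffle (Suc n) (nf_sequence e))
      = (\<lambda>l. if l < Suc n then src Delta (e ! l) else s l)"
    unfolding normal_shuffle_simps colour_tgt_append c(2) unfolding IH(2) by auto
  moreover have "ev (letters (normal_shuffle (Suc n) (nf_sequence e))) l
      = (if l < Suc n then tmap (e ! l) else id)" for l
    unfolding normal_shuffle_simps letters_simps ev_append IH(3) letters ev_map nf by auto
  ultimately show ?case by blast
qed

lemma rep_N_fold_bar:
  assumes "arrow_list N e" "\<And>l. l < N \<Longrightarrow> s l = tgt Delta (e ! l)" "\<And>l. l < N \<Longrightarrow> t l = src Delta (e ! l)"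
  shows "rep N s L X \<Longrightarrow> obA X \<Longrightarrow> rep N t (fobj (N_fold_bar N M e) L) (WO N (tmaps N e) X)"
    "rep N s L' F \<Longrightarrow> arA F \<Longrightarrow> rep N t (farr (N_fold_bar N M e) L') (WA N (tmaps N e) F)"
proof -
  define H where "H n = foldr (\<lambda>k F. Wbar M k (\<Prod>l\<in>{k<..<N}. src Delta_op (e ! l)) (\<Prod>l<k. tgt Delta_op (e ! l)) (e ! k)
        \<circ>\<^sub>F F) (rev [0..<n]) fid" for n
  \<comment> \<open>Box sizes after the colours below \<open>n\<close> have acted. Sources and
    targets in \<open>Delta\<close> are exchanged with those in \<open>Delta_op\<close>, so the
    finished colours carry the sizes \<open>src Delta\<close>.\<close>
  define q where "q n l = (if l < n then src Delta (e ! l) else tgt Delta (e ! l))" for n l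
  have q: "(q n)(n := src Delta (e ! n)) = q (Suc n)" for n by (auto simp: q_def)
  have pr: "(\<Prod>l<n. src Delta (e ! l)) = (\<Prod>l<n. q n l)"
    "(\<Prod>l\<in>{n<..<N}. tgt Delta (e ! l)) = (\<Prod>l\<in>{n<..<N}. q n l)" for n
    by (auto simp: q_def)
  have H: "N_fold_bar N M e = H N" by (simp add: N_fold_bar_def H_def)
  have t: "rep N (q N) A Y \<Longrightarrow> rep N t A Y" for A :: "'x list" and Y
    by (erule rep_cong) (simp add: q_def assms)
  have s: "rep N s A Y \<Longrightarrow> rep N (q 0) A Y" for A :: "'x list" and Y
    by (erule rep_cong) (simp add: q_def assms)
  have E: "tmaps N e n = tmap (e ! n)" if "n < N" for n using that by (simp add: tmaps_def)
  have step: "H (Suc n) = Wbar M n (\<Prod>l\<in>{n<..<N}. q n l) (\<Prod>l<n. q n l) (e ! n) \<circ>\<^sub>F H n" for n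
    unfolding H_def pr[symmetric] by simp
  show "rep N t (fobj (N_fold_bar N M e) L) (WO N (tmaps N e) X)" if "rep N s L X" "obA X"
  proof -
    have "rep N (q n) (fobj (H n) L) (WO n (tmaps N e) X)" if "n \<le> N" for n
      using that
    proof (induction n)
      case 0
      have "rep N (q 0) (fobj (H 0) L) (WO 0 (tmaps N e) X)"
        using s[OF \<open>rep N s L X\<close>] by (simp add: H_def fid_def)
      then show ?case .
    next
      case (Suc n)
      have qn: "tgt Delta (e ! n) = q n n" by (simp add: q_def)
      have "rep N ((q n)(n := src Delta (e ! n)))
         (fobj (Wbar M n (\<Prod>l\<in>{n<..<N}. q n l) (\<Prod>l<n. q n l) (e ! n)) (fobj (H n) L))
         (TO n (tmap (e ! n)) (WO n (tmaps N e) X))"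
        by (rule rep_Wbar(1)) (use Suc arrowsD[OF assms(1)] \<open>obA X\<close> qn in auto)
      then have "rep N (q (Suc n)) (fobj (H (Suc n)) L) (WO (Suc n) (tmaps N e) X)"
        unfolding q step using E[of n] Suc.prems by (simp add: fcomp_def)
      then show ?case .
    qed
    then show ?thesis unfolding H using t by blast
  qed
  show "rep N t (farr (N_fold_bar N M e) L') (WA N (tmaps N e) F)" if "rep N s L' F" "arA F"
  proof -
    have "rep N (q n) (farr (H n) L') (WA n (tmaps N e) F)" if "n \<le> N" for n
      using that
    proof (induction n)
      case 0
      have "rep N (q 0) (farr (H 0) L') (WA 0 (tmaps N e) F)"
        using s[OF \<open>rep N s L' F\<close>] by (simp add: H_def fid_def)
      then show ?case .
    next
      case (Suc n)
      have qn: "tgt Delta (e ! n) = q n n" by (simp add: q_def)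
      have "rep N ((q n)(n := src Delta (e ! n)))
         (farr (Wbar M n (\<Prod>l\<in>{n<..<N}. q n l) (\<Prod>l<n. q n l) (e ! n)) (farr (H n) L'))
         (TA n (tmap (e ! n)) (WA n (tmaps N e) F))"
        by (rule rep_Wbar(2)) (use Suc arrowsD[OF assms(1)] \<open>arA F\<close> qn in auto)
      then have "rep N (q (Suc n)) (farr (H (Suc n)) L') (WA (Suc n) (tmaps N e) F)"
        unfolding q step using E[of n] Suc.prems by (simp add: fcomp_def)
      then show ?case .
    qed
    then show ?thesis unfolding H using t by blast
  qed
qed

lemma sorted_normal_nf:
  "sorted_wrt (\<lambda>x y. snd y \<le> snd x) (letters (normal_shuffle n (nf_sequence e)))"
proof -
  have "(\<forall>y\<in>set (letters (normal_shuffle n (nf_sequence e))). snd y < n) \<and>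
    sorted_wrt (\<lambda>x y. snd y \<le> snd x) (letters (normal_shuffle n (nf_sequence e)))"
  proof (induction n)
    case (Suc n)
    have "sorted_wrt (\<lambda>x y. snd y \<le> snd x) (letters (nf_sequence e n))"
      unfolding letters_def nf_sequence_def sorted_wrt_map sorted_wrt_iff_nth_less by simp
    moreover have "\<forall>x\<in>set (letters (nf_sequence e n)). snd x = n"
      by (auto simp: letters_def nf_sequence_def)
    ultimately show ?case
      using Suc unfolding normal_shuffle_simps letters_simps sorted_wrt_append set_append
      by (metis UnE less_SucI lessI less_imp_le_nat)
  qed simp
  then show ?thesis by blast
qed

text \<open>Inserting the letters of a sorted word one by one moves nothing, so only the maps of each
  colour matter.\<close>

lemma coh_normal_nf:
  assumes "arrow_list N e1" "arrow_list N e2" "obA X" "\<And>l. l < N \<Longrightarrow> src Delta (e1 ! l) = tgt Delta (e2 ! l)"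
  shows "coh (letters (normal_shuffle N (nf_sequence e2)) @ letters (normal_shuffle N (nf_sequence e1))) X
    = coh (sword N (tmaps N e2) @ sword N (tmaps N e1)) X"
proof -
  let ?\<Gamma> = "letters (normal_shuffle N (nf_sequence e2))" and ?\<Lambda> =
      "letters (normal_shuffle N (nf_sequence e1))"
  have 1: "vword ?\<Gamma>" "ev ?\<Gamma> = tmaps N e2"
    using normal_nf_sequence[OF assms(2) order_refl, of "\<lambda>l. tgt Delta (e2 ! l)"] vword_letters
    by (auto simp: tmaps_def)
  have 2: "vword ?\<Lambda>" "ev ?\<Lambda> = tmaps N e1"
    using normal_nf_sequence[OF assms(1) order_refl, of "\<lambda>l. tgt Delta (e1 ! l)"] vword_letters
    by (auto simp: tmaps_def)
  have v: "vword (sword N (tmaps N e1))" "vword (sword N (tmaps N e2))" using assms by simp_all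
  have id: "coh ?\<Gamma> Y = idA (TW ?\<Gamma> Y)" "coh ?\<Lambda> Y = idA (TW ?\<Lambda> Y)" if "obA Y" for Y
    using coh_sorted sorted_normal_nf 1 2 that by blast+
  have W: "TW ?\<Gamma> Y = WO N (tmaps N e2) Y" "TW ?\<Lambda> Y = WO N (tmaps N e1) Y" if "obA Y" for Y
    using coh_simps(3)[OF 1(1) that] coh_simps(3)[OF 2(1) that] id[OF that] 1 2 that by auto
  \<comment> \<open>\<open>coh_right\<close> replaces the right block and \<open>coh_left\<close>
    then the left one; the correction factors are \<open>coh\<close> of sorted blocks and hence
    identities.\<close>
  have "coh (?\<Gamma> @ ?\<Lambda>) X = coh (?\<Gamma> @ sword N (tmaps N e1)) X"
    using coh_right[OF 1(1) 2(1) assms(3)] 1 2 v assms(3) by (simp add: id W TW_append)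
  also have "\<dots> = coh (sword N (tmaps N e2) @ sword N (tmaps N e1)) X"
    using coh_left[OF 1(1) v(1) assms(3)] 1 2 v assms by (simp add: id W TW_append)
  finally show ?thesis .
qed

lemma rep_omega:
  assumes "arrow_list N e1" "arrow_list N e2" "\<And>l. l < N \<Longrightarrow> src Delta (e1 ! l) = tgt Delta (e2 ! l)"
    "\<And>l. l < N \<Longrightarrow> s l = tgt Delta (e1 ! l)" "\<And>l. l < N \<Longrightarrow> t l = src Delta (e2 ! l)"
    "rep N s L X" "obA X"
  shows "rep N t (omega N M e2 e1 L) (coh (letters (normal_shuffle N (nf_sequence e2))
      @ letters (normal_shuffle N (nf_sequence e1))) X)"
proof -
  let ?s = "\<lambda>l. tgt Delta (e1 ! l)"
  let ?\<Phi> = "\<lambda>k. nf_sequence e2 k @ nf_sequence e1 k"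
  let ?\<Theta> = "normal_shuffle N (nf_sequence e2) @ normal_shuffle N (nf_sequence e1)"
  have 1: "vshuffle N ?s (normal_shuffle N (nf_sequence e1))"
    "colour_tgt ?s (normal_shuffle N (nf_sequence e1)) = (\<lambda>l. if l < N then src Delta (e1 ! l) else ?s l)"
    using normal_nf_sequence[OF assms(1) order_refl, of ?s] by auto
  \<comment> \<open>The letters of \<open>e2\<close> start from the sizes reached by those of
    \<open>e1\<close>; composability makes these the sizes that \<open>nf_sequence e2\<close>
    expects.\<close>
  let ?u = "\<lambda>l. if l < N then src Delta (e1 ! l) else ?s l"
  have 2: "vshuffle N ?u (normal_shuffle N (nf_sequence e2))"
    "colour_tgt ?u (normal_shuffle N (nf_sequence e2)) = (\<lambda>l. if l < N then src Delta (e2 ! l) else ?u l)"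
    using normal_nf_sequence[OF assms(2) order_refl, of ?u] assms(3) by auto
  have v: "vshuffle N ?s ?\<Theta>" unfolding vshuffle_append 1(2) using 1(1) 2(1) by blast
  have filt: "(\<forall>x\<in>set (normal_shuffle n (nf_sequence e)). snd x < n) \<and>
    (\<forall>k. filter (\<lambda>x. snd x = k) (normal_shuffle n (nf_sequence e))
        = (if k < n then nf_sequence e k else []))" for n e
  proof (induction n)
    case (Suc n)
    have "filter (\<lambda>x. snd x = k) (nf_sequence e n) = (if k = n then nf_sequence e n else [])" for k
      by (auto simp: nf_sequence_def filter_map comp_def)
    moreover have "\<forall>x\<in>set (nf_sequence e n). snd x = n" by (auto simp: nf_sequence_def)
    ultimately show ?case using Suc by (auto simp: less_Suc_eq)
  qed simp
  have sh: "is_shuffle N ?\<Phi> ?\<Theta>" unfolding is_shuffle_def using filt[of N e1] filt[of N e2] by auto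
  have "rep N ?s L X" by (rule rep_cong[OF assms(6)]) (rule assms(4))
  then have "rep N (colour_tgt ?s ?\<Theta>) (omega N M e2 e1 L) (coh (letters ?\<Theta>) X)"
    unfolding omega_def op_cat_sel by (intro rep_phi sh v assms(7)) (auto simp: nf_sequence_def)
  then have "rep N t (omega N M e2 e1 L) (coh (letters ?\<Theta>) X)"
    by (rule rep_cong) (simp add: colour_tgt_append 1(2) 2(2) assms(5))
  then show ?thesis by simp
qed

end

section \<open>Powers of \<open>M\<close> in terms of arrays\<close>

lemma hom_power_Delta:
  "e \<in> hom (power_cat N Delta_op) K L \<longleftrightarrow>
    arrow_list N e \<and> K = map (tgt Delta) e \<and> L = map (src Delta) e"
  by (auto simp: hom_def power_cat_def arrow_list_def)

text \<open>A colour \<open>0\<close> provides the unit object \<open>\<I> 0\<close> and its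
  identity as padding outside the box.\<close>

locale positive_N_fold = N_fold_strict_monoidal_category N M
  for N :: nat and M :: "('o, 'a, 'm) multi_monoidal_scheme" (structure) +
  assumes N_pos: "0 < N"
begin

abbreviation P :: "nat list \<Rightarrow> ('o list, 'a list) category" where
  "P K \<equiv> power_cat (prod_list K) M"

abbreviation repN :: "nat list \<Rightarrow> 'x list \<Rightarrow> ((nat \<Rightarrow> nat) \<Rightarrow> 'x) \<Rightarrow> bool" where
  "repN K \<equiv> rep N (\<lambda>l. K ! l)"

abbreviation arrO :: "nat list \<Rightarrow> 'o list \<Rightarrow> (nat \<Rightarrow> nat) \<Rightarrow> 'o" where
  "arrO K \<equiv> array_of N (\<lambda>l. K ! l) (\<I> 0)"

abbreviation arrA :: "nat list \<Rightarrow> 'a list \<Rightarrow> (nat \<Rightarrow> nat) \<Rightarrow> 'a" where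
  "arrA K \<equiv> array_of N (\<lambda>l. K ! l) (\<one> (\<I> 0))"

lemma objs_P: "length K = N \<Longrightarrow> A \<in> objs (P K) \<Longrightarrow> repN K A (arrO K A) \<and> obA (arrO K A)"
  using N_pos by (auto simp: power_cat_def prod_list_nth obA_def intro!: rep_array_of array_of_in)

lemma hom_P:
  assumes "length K = N" "f \<in> hom (P K) A B"
  shows "repN K f (arrA K f)" "arA (arrA K f)" "dmA (arrA K f) = arrO K A" "cdA (arrA K f) = arrO K B"
    "repN K A (arrO K A)" "repN K B (arrO K B)"
proof -
  have f: "length f = (\<Prod>l<N. K ! l)" "set f \<subseteq> arrs M" "A = map dom f" "B = map cod f"
    using assms by (auto simp: hom_def power_cat_def prod_list_nth)
  have d: "arr (\<one> (\<I> 0))" "dom (\<one> (\<I> 0)) = \<I> 0" "cod (\<one> (\<I> 0)) = \<I> 0" using N_pos by auto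
  show "repN K f (arrA K f)" "repN K A (arrO K A)" "repN K B (arrO K B)"
    using f by (auto intro!: rep_array_of)
  show "arA (arrA K f)" unfolding arA_def using array_of_in[OF f(1,2) d(1)] by blast
  show "dmA (arrA K f) = arrO K A"
    using array_of_map[OF f(1), of dom "\<one> (\<I> 0)"] by (simp add: dmA_def f(3) d fun_eq_iff)
  show "cdA (arrA K f) = arrO K B"
    using array_of_map[OF f(1), of cod "\<one> (\<I> 0)"] by (simp add: cdA_def f(4) d fun_eq_iff)
qed

lemma objs_PI: "length K = N \<Longrightarrow> repN K A X \<Longrightarrow> obA X \<Longrightarrow> A \<in> objs (P K)"
  using rep_set[of N "\<lambda>l. K ! l" A X "objs M"] by (auto simp: power_cat_def prod_list_nth rep_def)

lemma hom_PI:
  assumes "length K = N" "repN K f F" "arA F" "repN K A (dmA F)" "repN K B (cdA F)"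
  shows "f \<in> hom (P K) A B"
proof -
  have "map dom f = A" "map cod f = B"
    using rep_eqI[OF rep_map[OF assms(2), of dom]] rep_eqI[OF rep_map[OF assms(2), of cod]] assms(4,5)
    by (simp_all add: dmA_def cdA_def)
  moreover have "set f \<subseteq> arrs M" using rep_set[OF assms(2), of "arrs M"] assms(3) by simp
  ultimately show ?thesis using assms(1,2) by (simp add: hom_def power_cat_def prod_list_nth rep_def)
qed

lemma P_sel [simp]: "cmp (P K) = map2 (cmp M)" "idn (P K) = map (idn M)"
  by (simp_all add: power_cat_def)

lemma bar_repN:
  assumes "e \<in> hom (power_cat N Delta_op) K L"
  shows "repN K A X \<Longrightarrow> obA X \<Longrightarrow> repN L (fobj (N_fold_bar N M e) A) (WO N (tmaps N e) X)"
    "repN K f F \<Longrightarrow> arA F \<Longrightarrow> repN L (farr (N_fold_bar N M e) f) (WA N (tmaps N e) F)"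
  using assms rep_N_fold_bar[of e "\<lambda>l. K ! l" "\<lambda>l. L ! l"]
  by (auto simp: hom_power_Delta arrow_list_def)

text \<open>Each functor law is an equality of lists; both sides represent the same array because
  \<open>WA\<close> preserves identities and composites.\<close>

lemma bar_functor:
  assumes e: "e \<in> hom (power_cat N Delta_op) K L"
  shows "is_functor (P K) (P L) (N_fold_bar N M e)"
proof
  have len: "length K = N" "length L = N" using e by (auto simp: hom_power_Delta arrow_list_def)
  note bO = bar_repN(1)[OF e] and bA = bar_repN(2)[OF e]
  let ?F = "N_fold_bar N M e"
  fix A assume A: "A \<in> objs (P K)"
  note A' = objs_P[OF len(1) A]
  show "fobj ?F A \<in> objs (P L)"
    using A' by (intro objs_PI[OF len(2) bO]) auto
  have "repN K (map (idn M) A) (idA (arrO K A))"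
    unfolding idA_def using A' by (intro rep_map) simp
  then have "repN L (farr ?F (map (idn M) A)) (idA (WO N (tmaps N e) (arrO K A)))"
    using bA[of "map (idn M) A" "idA (arrO K A)"] A' by simp
  moreover have "repN L (map (idn M) (fobj ?F A)) (idA (WO N (tmaps N e) (arrO K A)))"
    unfolding idA_def using A' bO by (intro rep_map) simp
  ultimately show "farr ?F (idn (P K) A) = idn (P L) (fobj ?F A)"
    unfolding P_sel by (rule rep_eqI)
next
  have len: "length K = N" "length L = N" using e by (auto simp: hom_power_Delta arrow_list_def)
  note bO = bar_repN(1)[OF e] and bA = bar_repN(2)[OF e]
  let ?F = "N_fold_bar N M e"
  fix f A B assume f: "f \<in> hom (P K) A B"
  note f' = hom_P[OF len(1) f]
  have ob: "obA (arrO K A)" "obA (arrO K B)" using f'(2-4) obA_dm_cd by metis+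
  show "farr ?F f \<in> hom (P L) (fobj ?F A) (fobj ?F B)"
    by (rule hom_PI[OF len(2) bA[OF f'(1,2)]]) (use f' ob bO in auto)
  fix g E assume g: "g \<in> hom (P K) B E"
  note g' = hom_P[OF len(1) g]
  have "repN K (map2 (cmp M) g f) (arrA K g \<odot> arrA K f)"
    unfolding cpA_def by (rule rep_map2) (rule g' f')+
  then have "repN L (farr ?F (map2 (cmp M) g f)) (WA N (tmaps N e) (arrA K g)
      \<odot> WA N (tmaps N e) (arrA K f))"
    using bA[of "map2 (cmp M) g f" "arrA K g \<odot> arrA K f"] f' g' by (simp add: WA_cpA)
  moreover have "repN L (map2 (cmp M) (farr ?F g) (farr ?F f)) (WA N (tmaps N e) (arrA K g)
      \<odot> WA N (tmaps N e) (arrA K f))"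
    unfolding cpA_def by (rule rep_map2) (rule bA g' f')+
  ultimately show "farr ?F (cmp (P K) g f) = cmp (P L) (farr ?F g) (farr ?F f)"
    unfolding P_sel by (rule rep_eqI)
qed

section \<open>The comparison transformation on arrays\<close>

definition omegaA :: "simplicial_map list \<Rightarrow> simplicial_map list \<Rightarrow> ((nat \<Rightarrow> nat) \<Rightarrow> 'o) \<Rightarrow> (nat \<Rightarrow> nat) \<Rightarrow> 'a" where
  "omegaA e2 e1 X = coh (sword N (tmaps N e2) @ sword N (tmaps N e1)) X"

lemma omega_repN:
  assumes "e1 \<in> hom (power_cat N Delta_op) K L" "e2 \<in> hom (power_cat N Delta_op) L Q"
    "repN K A X" "obA X"
  shows "repN Q (omega N M e2 e1 A) (omegaA e2 e1 X)"
proof -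
  have e: "arrow_list N e1" "arrow_list N e2" "K = map (tgt Delta) e1" "map (src Delta) e1
      = map (tgt Delta) e2"
    "Q = map (src Delta) e2" "length e1 = N" "length e2 = N"
    using assms(1,2) by (auto simp: hom_power_Delta arrow_list_def)
  have m: "src Delta (e1 ! l) = tgt Delta (e2 ! l)" if "l < N" for l
    using arg_cong[OF e(4), of "\<lambda>xs. xs ! l"] that e(6,7) by simp
  have "coh (letters (normal_shuffle N (nf_sequence e2))
      @ letters (normal_shuffle N (nf_sequence e1))) X = omegaA e2 e1 X"
    unfolding omegaA_def by (rule coh_normal_nf) (fact e assms m)+
  moreover have "repN Q (omega N M e2 e1 A)
      (coh (letters (normal_shuffle N (nf_sequence e2)) @ letters (normal_shuffle N (nf_sequence e1))) X)"
    by (rule rep_omega[OF e(1,2) _ _ _ assms(3,4)]) (simp_all add: m, simp_all add: e)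
  ultimately show ?thesis by simp
qed

lemma tmaps_cmp:
  assumes "e1 \<in> hom (power_cat N Delta_op) K L" "e2 \<in> hom (power_cat N Delta_op) L Q"
  shows "tmaps N (cmp (power_cat N Delta_op) e2 e1) = (\<lambda>k. tmaps N e1 k \<circ> tmaps N e2 k)"
proof
  fix k
  have e: "arrow_list N e1" "arrow_list N e2" "map (src Delta) e1 = map (tgt Delta) e2" "length e1 = N"
      "length e2 = N"
    using assms by (auto simp: hom_power_Delta arrow_list_def)
  show "tmaps N (cmp (power_cat N Delta_op) e2 e1) k = tmaps N e1 k \<circ> tmaps N e2 k"
  proof (cases "k < N")
    case True
    have "src Delta (e1 ! k) = tgt Delta (e2 ! k)"
      using arg_cong[OF e(3), of "\<lambda>xs. xs ! k"] True e(4,5) by simp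
    then show ?thesis
      using True e tmap_cmp[of "e2 ! k" "e1 ! k"] arrowsD by (simp add: tmaps_def power_cat_def)
  qed (simp add: tmaps_def)
qed

lemma tmaps_idn: "length K = N \<Longrightarrow> tmaps N (idn (power_cat N Delta_op) K) = (\<lambda>_. id)"
  by (auto simp: tmaps_def power_cat_def)

lemma omegaA_simps:
  assumes "arrow_list N e1" "arrow_list N e2" "obA X"
  shows "arA (omegaA e2 e1 X)" "dmA (omegaA e2 e1 X) = WO N (tmaps N e2) (WO N (tmaps N e1) X)"
    "cdA (omegaA e2 e1 X) = WO N (\<lambda>k. tmaps N e1 k \<circ> tmaps N e2 k) X"
proof -
  have v: "vword (sword N (tmaps N e2) @ sword N (tmaps N e1))" using assms by simp
  have "ev (sword N (tmaps N e2) @ sword N (tmaps N e1)) = (\<lambda>k. tmaps N e1 k \<circ> tmaps N e2 k)"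
    by (auto simp: ev_append ev_sword tmaps_def)
  then show "arA (omegaA e2 e1 X)" "dmA (omegaA e2 e1 X) = WO N (tmaps N e2) (WO N (tmaps N e1) X)"
    "cdA (omegaA e2 e1 X) = WO N (\<lambda>k. tmaps N e1 k \<circ> tmaps N e2 k) X"
    using v assms(3) by (simp_all add: omegaA_def TW_append)
qed

lemma omegaA_nat:
  assumes "arrow_list N e1" "arrow_list N e2" "arA F"
  shows "omegaA e2 e1 (cdA F) \<odot> WA N (tmaps N e2) (WA N (tmaps N e1) F)
    = WA N (\<lambda>k. tmaps N e1 k \<circ> tmaps N e2 k) F \<odot> omegaA e2 e1 (dmA F)"
proof -
  have v: "vword (sword N (tmaps N e2) @ sword N (tmaps N e1))" using assms by simp
  have "ev (sword N (tmaps N e2) @ sword N (tmaps N e1)) = (\<lambda>k. tmaps N e1 k \<circ> tmaps N e2 k)"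
    by (auto simp: ev_append ev_sword tmaps_def)
  then show ?thesis
    using coh_nat[OF v assms(3)] by (simp add: omegaA_def TWA_append)
qed

text \<open>The block of identity letters is the sorted form of the empty word, so
  \<open>coh_right\<close> and \<open>coh_left\<close> at the empty word remove it and leave a
  sorted word.\<close>

lemma omegaA_idn:
  assumes "arrow_list N e" "obA X" "arrow_list N e'" "tmaps N e' = (\<lambda>_. id)"
  shows "omegaA e e' X = idA (WO N (tmaps N e) X)" "omegaA e' e X = idA (WO N (tmaps N e) X)"
proof -
  have v: "vword (sword N (tmaps N e))" "vword (sword N (\<lambda>_. id))" using assms(1) by simp_all
  have "coh (sword N (tmaps N e)) X = idA (WO N (tmaps N e) X)" using coh_sword[of N
      "tmaps N e" X] assms by simp
  moreover have e: "ev [] = (\<lambda>_. id)" "ev (sword N (tmaps N e)) = tmaps N e"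
      by (auto simp: ev_sword tmaps_def)
  ultimately show "omegaA e e' X = idA (WO N (tmaps N e) X)"
    using coh_right[OF v(1) _ assms(2), of "[]"] v assms(2) unfolding omegaA_def assms(4)
    by (simp add: TW_append)
  have "coh (sword N (\<lambda>_. id) @ sword N (tmaps N e)) X = coh (sword N (tmaps N e)) X"
    using coh_left[OF _ v(1) assms(2), of "[]"] e v assms(2) by (simp add: TW_append)
  then show "omegaA e' e X = idA (WO N (tmaps N e) X)"
    unfolding omegaA_def assms(4) using coh_sword[of N "tmaps N e" X] assms by simp
qed

text \<open>For each law an array represented by both lists is exhibited, and \<open>rep_eqI\<close>
  concludes. The comparison laws come from \<open>omegaA_idn\<close>, \<open>omegaA_nat\<close> and
  \<open>coh_assoc\<close>.\<close>

theorem lax_functor: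
  "lax_functor_to_Cat (power_cat N Delta_op) (\<lambda>ks. power_cat (prod_list ks) M) (N_fold_bar N M) (omega N M)"
proof (rule lax_functor_to_Cat.intro)
  let ?B = "power_cat N Delta_op"
  show base: "category ?B" by (intro category_power category_op category_Delta)
  show "category (P K)" for K by (rule category_power) unfold_locales
  show "is_functor (P K) (P L) (N_fold_bar N M e)" if "e \<in> hom ?B K L" for e K L
    using bar_functor that .
  have idn: "idn ?B K \<in> hom ?B K K" "length K = N" if "K \<in> objs ?B" for K
    using category.idn_hom[OF base that] that by (simp_all add: power_cat_def)
  show "fobj (N_fold_bar N M (idn ?B K)) A = A" if "K \<in> objs ?B" "A \<in> objs (P K)" for K A
  proof -
    note A = objs_P[OF idn(2)[OF that(1)] that(2)]
    have "repN K (fobj (N_fold_bar N M (idn ?B K)) A) (arrO K A)"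
      using bar_repN(1)[OF idn(1)[OF that(1)], of A "arrO K A"] A tmaps_idn[OF idn(2)[OF that(1)]] by simp
    then show ?thesis using A rep_eqI by blast
  qed
  show "farr (N_fold_bar N M (idn ?B K)) f = f" if "K \<in> objs ?B" "f \<in> arrs (P K)" for K f
  proof -
    have "f \<in> hom (P K) (src (P K) f) (tgt (P K) f)" using that by (simp add: hom_def)
    note f = hom_P[OF idn(2)[OF that(1)] this]
    have "repN K (farr (N_fold_bar N M (idn ?B K)) f) (arrA K f)"
      using bar_repN(2)[OF idn(1)[OF that(1)], of f "arrA K f"] f tmaps_idn[OF idn(2)[OF that(1)]] by simp
    then show ?thesis using f(1) rep_eqI by blast
  qed
  fix e1 K L assume e1: "e1 \<in> hom ?B K L"
  have len: "length K = N" "length L = N" and ar1: "arrow_list N e1"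
    using e1 by (auto simp: hom_power_Delta arrow_list_def)
  have KL: "K \<in> objs ?B" "L \<in> objs ?B" using len by (simp_all add: power_cat_def)
  have idn_arrow_list: "arrow_list N (idn ?B K)" if "K \<in> objs ?B" for K
    using idn(1)[OF that] by (simp add: hom_power_Delta)
  {
    fix A assume A: "A \<in> objs (P K)"
    note A' = objs_P[OF len(1) A]
    have F: "repN L (map (idn M) (fobj (N_fold_bar N M e1) A)) (idA (WO N (tmaps N e1) (arrO K A)))"
      unfolding idA_def using A' bar_repN(1)[OF e1] by (intro rep_map) simp
    have "repN L (omega N M e1 (idn ?B K) A) (omegaA e1 (idn ?B K) (arrO K A))"
      using omega_repN[OF idn(1)[OF KL(1)] e1] A' by simp
    then show "omega N M e1 (idn ?B K) A = idn (P L) (fobj (N_fold_bar N M e1) A)"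
      using F omegaA_idn(1)[OF ar1 _ idn_arrow_list[OF KL(1)] tmaps_idn[OF len(1)]] A' rep_eqI by fastforce
    have "repN L (omega N M (idn ?B L) e1 A) (omegaA (idn ?B L) e1 (arrO K A))"
      using omega_repN[OF e1 idn(1)[OF KL(2)]] A' by simp
    then show "omega N M (idn ?B L) e1 A = idn (P L) (fobj (N_fold_bar N M e1) A)"
      using F omegaA_idn(2)[OF ar1 _ idn_arrow_list[OF KL(2)] tmaps_idn[OF len(2)]] A' rep_eqI by fastforce
  }
  fix e2 Q assume e2: "e2 \<in> hom ?B L Q"
  have lenQ: "length Q = N" and ar2: "arrow_list N e2"
    using e2 by (auto simp: hom_power_Delta arrow_list_def)
  have e21: "cmp ?B e2 e1 \<in> hom ?B K Q" using category.cmp_hom[OF base e1 e2] .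
  note E21 = tmaps_cmp[OF e1 e2]
  show "is_nat_trans (P K) (P Q) (N_fold_bar N M e2 \<circ>\<^sub>F N_fold_bar N M e1) (N_fold_bar N M (cmp ?B e2 e1)) (omega N M e2 e1)"
  proof
    fix A assume A: "A \<in> objs (P K)"
    note A' = objs_P[OF len(1) A]
    show "omega N M e2 e1 A \<in> hom (P Q) (fobj (N_fold_bar N M e2 \<circ>\<^sub>F N_fold_bar N M e1) A) (fobj (N_fold_bar N M (cmp ?B e2 e1)) A)"
    proof (rule hom_PI[OF lenQ omega_repN[OF e1 e2]])
      show "repN Q (fobj (N_fold_bar N M e2 \<circ>\<^sub>F N_fold_bar N M e1) A) (dmA (omegaA e2 e1 (arrO K A)))"
        using A' bar_repN(1)[OF e2 bar_repN(1)[OF e1]] omegaA_simps[OF ar1 ar2] by (simp add: fcomp_def)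
      show "repN Q (fobj (N_fold_bar N M (cmp ?B e2 e1)) A) (cdA (omegaA e2 e1 (arrO K A)))"
        using A' bar_repN(1)[OF e21] omegaA_simps[OF ar1 ar2] by (simp add: E21)
    qed (use A' omegaA_simps[OF ar1 ar2] in auto)
  next
    fix f A B assume f: "f \<in> hom (P K) A B"
    note f' = hom_P[OF len(1) f]
    have ob: "obA (arrO K A)" "obA (arrO K B)" using f'(2-4) obA_dm_cd by metis+
    have "repN Q (map2 (cmp M) (omega N M e2 e1 B) (farr (N_fold_bar N M e2 \<circ>\<^sub>F N_fold_bar N M e1) f))
      (omegaA e2 e1 (arrO K B) \<odot> WA N (tmaps N e2) (WA N (tmaps N e1) (arrA K f)))"
      unfolding cpA_def using omega_repN[OF e1 e2 f'(6) ob(2)] bar_repN(2)[OF e2 bar_repN(2)[OF e1 f'(1,2)]] f'(2)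
      by (intro rep_map2) (simp_all add: fcomp_def)
    moreover have "repN Q (map2 (cmp M) (farr (N_fold_bar N M (cmp ?B e2 e1)) f) (omega N M e2 e1 A))
      (WA N (\<lambda>k. tmaps N e1 k \<circ> tmaps N e2 k) (arrA K f) \<odot> omegaA e2 e1 (arrO K A))"
      unfolding cpA_def using omega_repN[OF e1 e2 f'(5) ob(1)] bar_repN(2)[OF e21 f'(1,2)]
      by (intro rep_map2) (simp_all add: E21)
    ultimately show "cmp (P Q) (omega N M e2 e1 B) (farr (N_fold_bar N M e2 \<circ>\<^sub>F N_fold_bar N M e1) f)
      = cmp (P Q) (farr (N_fold_bar N M (cmp ?B e2 e1)) f) (omega N M e2 e1 A)"
      unfolding P_sel omegaA_nat[OF ar1 ar2 f'(2), unfolded f'(3,4)] by (rule rep_eqI)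
  qed
  fix e3 R A assume e3: "e3 \<in> hom ?B Q R" and A: "A \<in> objs (P K)"
  note A' = objs_P[OF len(1) A]
  have ar3: "arrow_list N e3" using e3 by (simp add: hom_power_Delta)
  have e32: "cmp ?B e3 e2 \<in> hom ?B L R" using category.cmp_hom[OF base e2 e3] .
  note E32 = tmaps_cmp[OF e2 e3]
  let ?X = "arrO K A"
  have X: "obA ?X" "repN K A ?X" using A' by auto
  have F1: "repN L (fobj (N_fold_bar N M e1) A) (WO N (tmaps N e1) ?X)" using bar_repN(1)[OF e1 X(2,1)] .
  \<comment> \<open>By \<open>E21\<close> and \<open>E32\<close> the composites in the base become
    composites of monotone maps colour by colour, the form in which \<open>coh_assoc\<close> is
    stated.\<close>
  have assoc: "omegaA (cmp ?B e3 e2) e1 ?X \<odot> omegaA e3 e2 (WO N (tmaps N e1) ?X)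
    = omegaA e3 (cmp ?B e2 e1) ?X \<odot> WA N (tmaps N e3) (omegaA e2 e1 ?X)"
    unfolding omegaA_def E21 E32 by (rule coh_assoc) (use ar1 ar2 ar3 X(1) in simp_all)
  have "repN R (map2 (cmp M) (omega N M (cmp ?B e3 e2) e1 A) (omega N M e3 e2 (fobj (N_fold_bar N M e1) A)))
    (omegaA (cmp ?B e3 e2) e1 ?X \<odot> omegaA e3 e2 (WO N (tmaps N e1) ?X))"
    unfolding cpA_def using omega_repN[OF e1 e32 X(2,1)] omega_repN[OF e2 e3 F1] X(1)
        by (intro rep_map2) simp_all
  moreover have "repN R (map2 (cmp M) (omega N M e3 (cmp ?B e2 e1) A) (farr (N_fold_bar N M e3) (omega N M e2 e1 A)))
    (omegaA e3 (cmp ?B e2 e1) ?X \<odot> WA N (tmaps N e3) (omegaA e2 e1 ?X))"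
    unfolding cpA_def
    using omega_repN[OF e21 e3 X(2,1)] bar_repN(2)[OF e3 omega_repN[OF e1 e2 X(2,1)] omegaA_simps(1)[OF ar1 ar2 X(1)]]
    by (intro rep_map2)
  ultimately show "cmp (P R) (omega N M (cmp ?B e3 e2) e1 A) (omega N M e3 e2 (fobj (N_fold_bar N M e1) A))
    = cmp (P R) (omega N M e3 (cmp ?B e2 e1) A) (farr (N_fold_bar N M e3) (omega N M e2 e1 A))"
    unfolding P_sel assoc by (rule rep_eqI)
qed

end

theorem theorem8p5:
  fixes N :: nat and M :: "('o, 'a) multi_monoidal"
  assumes "N \<ge> 2"
    and "N_fold_strict_monoidal_category N M"
  shows "lax_functor_to_Cat (power_cat N Delta_op) (\<lambda>ks. power_cat (prod_list ks) M)
           (N_fold_bar N M) (omega N M)"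
proof -
  interpret N_fold_strict_monoidal_category N M by fact
  interpret positive_N_fold N M by unfold_locales (use assms(1) in simp)
  show ?thesis by (rule lax_functor)
qed

end
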